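(* The proof-theoretic ordinal of $\mathsf{RCA}_0+\mathrm{RT}^2_2$ is $\omega^\omega$, and the proof-theoretic ordinal of $\mathsf{WKL}_0+\mathrm{RT}^2_2$ is $\omega^\omega$.
   Context: $\mathsf{RCA}_0$: axioms of discrete ordered semirings, $\Sigma^0_1$-induction and $\Delta^0_1$-comprehension, in the language of second-order arithmetic. $\mathsf{WKL}_0$: $\mathsf{RCA}_0$ plus weak König's lemma. $\mathrm{RT}^2_2$: every $f:[\mathbb N]^2\to2$ has an infinite $H\subseteq\mathbb N$ with $f$ constant on $[H]^2$. The proof-theoretic ordinal of a theory $T$ is the one determined by the class of ($\Sigma^0_1$-definable) functions whose totality is provable in $T$. Concretely (for ordinals up to $\omega^\omega$, which suffices here), use the Hardy hierarchy: $H_0(x)=x$, $H_{\beta+1}(x)=H_\beta(x+1)$, $H_\lambda(x)=H_{\lambda[x]}(x)$ for limit $\lambda<\omega^\omega$, where $(\beta+\omega^{j})[x]=\beta+\omega^{j-1}\cdot x$ for $j\ge1$ (Cantor normal form). The proof-theoretic ordinal of $T$ is the least $\alpha\le\omega^\omega$ such that every recursive function $\mathbb N\to\mathbb N$ that is provably total in $T$ (i.e. having a $\Sigma_1$-definition for which $T$ proves $\forall x\exists! y$) is eventually dominated by $H_\beta$ for some $\beta<\alpha$. *)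

theory Defs
  imports Complex_Main "HOL-Library.Multiset_Order"
begin

section \<open>The language of second-order arithmetic\<close>

text \<open>
  Number variables and set variables are two separate families of de Bruijn indices.
  Set equality is not a primitive.
\<close>

datatype tm =
    Var nat
  | Zero ("\<^bold>0")
  | One ("\<^bold>1")
  | Add tm tm (infixl "\<^bold>+" 65)
  | Mul tm tm (infixl "\<^bold>*" 70)

datatype fm =
    Fls ("\<^bold>\<bottom>")
  | Eq tm tm (infix "\<^bold>=" 50)
  | Lt tm tm (infix "\<^bold><" 50)
  | Mem tm nat (infix "\<^bold>\<in>" 50)
  | Imp fm fm (infixr "\<^bold>\<longrightarrow>" 25)
  | And fm fm (infixr "\<^bold>\<and>" 35)
  | Or fm fm (infixr "\<^bold>\<or>" 30)
  | AllN fm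
  | ExN fm
  | AllS fm
  | ExS fm

abbreviation Neg :: "fm \<Rightarrow> fm" ("\<^bold>\<not> _" [40] 40) where
  "\<^bold>\<not> \<phi> \<equiv> \<phi> \<^bold>\<longrightarrow> \<^bold>\<bottom>"

abbreviation Iff :: "fm \<Rightarrow> fm \<Rightarrow> fm" (infixr "\<^bold>\<longleftrightarrow>" 25) where
  "\<phi> \<^bold>\<longleftrightarrow> \<psi> \<equiv> (\<phi> \<^bold>\<longrightarrow> \<psi>) \<^bold>\<and> (\<psi> \<^bold>\<longrightarrow> \<phi>)"

text \<open>
  Simultaneous capture-avoiding substitution of terms for number variables and of
  set variables for set variables.
\<close>

primrec subst_tm :: "(nat \<Rightarrow> tm) \<Rightarrow> tm \<Rightarrow> tm" where
  "subst_tm \<sigma> (Var i) = \<sigma> i"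
| "subst_tm \<sigma> \<^bold>0 = \<^bold>0"
| "subst_tm \<sigma> \<^bold>1 = \<^bold>1"
| "subst_tm \<sigma> (s \<^bold>+ t) = subst_tm \<sigma> s \<^bold>+ subst_tm \<sigma> t"
| "subst_tm \<sigma> (s \<^bold>* t) = subst_tm \<sigma> s \<^bold>* subst_tm \<sigma> t"

abbreviation lift_tm :: "tm \<Rightarrow> tm" where
  "lift_tm \<equiv> subst_tm (\<lambda>i. Var (Suc i))"

definition upN :: "(nat \<Rightarrow> tm) \<Rightarrow> nat \<Rightarrow> tm" where
  "upN \<sigma> = case_nat (Var 0) (\<lambda>i. lift_tm (\<sigma> i))"

definition upS :: "(nat \<Rightarrow> nat) \<Rightarrow> nat \<Rightarrow> nat" where
  "upS \<rho> = case_nat 0 (\<lambda>i. Suc (\<rho> i))"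

primrec subst :: "(nat \<Rightarrow> tm) \<Rightarrow> (nat \<Rightarrow> nat) \<Rightarrow> fm \<Rightarrow> fm" where
  "subst \<sigma> \<rho> \<^bold>\<bottom> = \<^bold>\<bottom>"
| "subst \<sigma> \<rho> (s \<^bold>= t) = (subst_tm \<sigma> s \<^bold>= subst_tm \<sigma> t)"
| "subst \<sigma> \<rho> (s \<^bold>< t) = (subst_tm \<sigma> s \<^bold>< subst_tm \<sigma> t)"
| "subst \<sigma> \<rho> (t \<^bold>\<in> X) = (subst_tm \<sigma> t \<^bold>\<in> \<rho> X)"
| "subst \<sigma> \<rho> (\<phi> \<^bold>\<longrightarrow> \<psi>) = (subst \<sigma> \<rho> \<phi> \<^bold>\<longrightarrow> subst \<sigma> \<rho> \<psi>)"
| "subst \<sigma> \<rho> (\<phi> \<^bold>\<and> \<psi>) = (subst \<sigma> \<rho> \<phi> \<^bold>\<and> subst \<sigma> \<rho> \<psi>)"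
| "subst \<sigma> \<rho> (\<phi> \<^bold>\<or> \<psi>) = (subst \<sigma> \<rho> \<phi> \<^bold>\<or> subst \<sigma> \<rho> \<psi>)"
| "subst \<sigma> \<rho> (AllN \<phi>) = AllN (subst (upN \<sigma>) \<rho> \<phi>)"
| "subst \<sigma> \<rho> (ExN \<phi>) = ExN (subst (upN \<sigma>) \<rho> \<phi>)"
| "subst \<sigma> \<rho> (AllS \<phi>) = AllS (subst \<sigma> (upS \<rho>) \<phi>)"
| "subst \<sigma> \<rho> (ExS \<phi>) = ExS (subst \<sigma> (upS \<rho>) \<phi>)"

abbreviation liftN :: "fm \<Rightarrow> fm" where
  "liftN \<equiv> subst (\<lambda>i. Var (Suc i)) id"

abbreviation liftS :: "fm \<Rightarrow> fm" where
  "liftS \<equiv> subst Var Suc"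

abbreviation instN :: "tm \<Rightarrow> fm \<Rightarrow> fm" where
  "instN t \<equiv> subst (case_nat t Var) id"

abbreviation instS :: "nat \<Rightarrow> fm \<Rightarrow> fm" where
  "instS X \<equiv> subst Var (case_nat X id)"

text \<open>\<open>below n m \<phi>\<close>: the free number variables are below \<open>n\<close>, the free set variables below \<open>m\<close>.\<close>

primrec below_tm :: "nat \<Rightarrow> tm \<Rightarrow> bool" where
  "below_tm n (Var i) = (i < n)"
| "below_tm n \<^bold>0 = True"
| "below_tm n \<^bold>1 = True"
| "below_tm n (s \<^bold>+ t) = (below_tm n s \<and> below_tm n t)"
| "below_tm n (s \<^bold>* t) = (below_tm n s \<and> below_tm n t)"

primrec below :: "nat \<Rightarrow> nat \<Rightarrow> fm \<Rightarrow> bool" where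
  "below n m \<^bold>\<bottom> = True"
| "below n m (s \<^bold>= t) = (below_tm n s \<and> below_tm n t)"
| "below n m (s \<^bold>< t) = (below_tm n s \<and> below_tm n t)"
| "below n m (t \<^bold>\<in> X) = (below_tm n t \<and> X < m)"
| "below n m (\<phi> \<^bold>\<longrightarrow> \<psi>) = (below n m \<phi> \<and> below n m \<psi>)"
| "below n m (\<phi> \<^bold>\<and> \<psi>) = (below n m \<phi> \<and> below n m \<psi>)"
| "below n m (\<phi> \<^bold>\<or> \<psi>) = (below n m \<phi> \<and> below n m \<psi>)"
| "below n m (AllN \<phi>) = below (Suc n) m \<phi>"
| "below n m (ExN \<phi>) = below (Suc n) m \<phi>"
| "below n m (AllS \<phi>) = below n (Suc m) \<phi>"
| "below n m (ExS \<phi>) = below n (Suc m) \<phi>"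

text \<open>
  The universal closures of a formula; they differ from one another only in vacuous quantifiers.
\<close>

definition closures :: "fm \<Rightarrow> fm set" where
  "closures \<phi> = {(AllS ^^ m) ((AllN ^^ n) \<phi>) | n m. below n m \<phi>}"


section \<open>Derivability\<close>

text \<open>
  Two-sorted classical natural deduction with equality. Lifting the hypotheses expresses
  the eigenvariable conditions.
\<close>

inductive derives :: "fm set \<Rightarrow> fm \<Rightarrow> bool" (infix "\<turnstile>" 20) where
  Hyp: "\<phi> \<in> \<Gamma> \<Longrightarrow> \<Gamma> \<turnstile> \<phi>"
| Contr: "insert (\<^bold>\<not> \<phi>) \<Gamma> \<turnstile> \<^bold>\<bottom> \<Longrightarrow> \<Gamma> \<turnstile> \<phi>"
| ImpI: "insert \<phi> \<Gamma> \<turnstile> \<psi> \<Longrightarrow> \<Gamma> \<turnstile> \<phi> \<^bold>\<longrightarrow> \<psi>"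
| ImpE: "\<Gamma> \<turnstile> \<phi> \<^bold>\<longrightarrow> \<psi> \<Longrightarrow> \<Gamma> \<turnstile> \<phi> \<Longrightarrow> \<Gamma> \<turnstile> \<psi>"
| AndI: "\<Gamma> \<turnstile> \<phi> \<Longrightarrow> \<Gamma> \<turnstile> \<psi> \<Longrightarrow> \<Gamma> \<turnstile> \<phi> \<^bold>\<and> \<psi>"
| AndE1: "\<Gamma> \<turnstile> \<phi> \<^bold>\<and> \<psi> \<Longrightarrow> \<Gamma> \<turnstile> \<phi>"
| AndE2: "\<Gamma> \<turnstile> \<phi> \<^bold>\<and> \<psi> \<Longrightarrow> \<Gamma> \<turnstile> \<psi>"
| OrI1: "\<Gamma> \<turnstile> \<phi> \<Longrightarrow> \<Gamma> \<turnstile> \<phi> \<^bold>\<or> \<psi>"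
| OrI2: "\<Gamma> \<turnstile> \<psi> \<Longrightarrow> \<Gamma> \<turnstile> \<phi> \<^bold>\<or> \<psi>"
| OrE: "\<Gamma> \<turnstile> \<phi> \<^bold>\<or> \<psi> \<Longrightarrow> insert \<phi> \<Gamma> \<turnstile> \<chi> \<Longrightarrow> insert \<psi> \<Gamma> \<turnstile> \<chi> \<Longrightarrow> \<Gamma> \<turnstile> \<chi>"
| AllNI: "liftN ` \<Gamma> \<turnstile> \<phi> \<Longrightarrow> \<Gamma> \<turnstile> AllN \<phi>"
| AllNE: "\<Gamma> \<turnstile> AllN \<phi> \<Longrightarrow> \<Gamma> \<turnstile> instN t \<phi>"
| ExNI: "\<Gamma> \<turnstile> instN t \<phi> \<Longrightarrow> \<Gamma> \<turnstile> ExN \<phi>"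
| ExNE: "\<Gamma> \<turnstile> ExN \<phi> \<Longrightarrow> insert \<phi> (liftN ` \<Gamma>) \<turnstile> liftN \<chi> \<Longrightarrow> \<Gamma> \<turnstile> \<chi>"
| AllSI: "liftS ` \<Gamma> \<turnstile> \<phi> \<Longrightarrow> \<Gamma> \<turnstile> AllS \<phi>"
| AllSE: "\<Gamma> \<turnstile> AllS \<phi> \<Longrightarrow> \<Gamma> \<turnstile> instS X \<phi>"
| ExSI: "\<Gamma> \<turnstile> instS X \<phi> \<Longrightarrow> \<Gamma> \<turnstile> ExS \<phi>"
| ExSE: "\<Gamma> \<turnstile> ExS \<phi> \<Longrightarrow> insert \<phi> (liftS ` \<Gamma>) \<turnstile> liftS \<chi> \<Longrightarrow> \<Gamma> \<turnstile> \<chi>"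
| EqI: "\<Gamma> \<turnstile> t \<^bold>= t"
| EqE: "\<Gamma> \<turnstile> s \<^bold>= t \<Longrightarrow> \<Gamma> \<turnstile> instN s \<phi> \<Longrightarrow> \<Gamma> \<turnstile> instN t \<phi>"


section \<open>The theories\<close>

inductive bounded_fm :: "fm \<Rightarrow> bool" where
  "bounded_fm \<^bold>\<bottom>"
| "bounded_fm (s \<^bold>= t)"
| "bounded_fm (s \<^bold>< t)"
| "bounded_fm (t \<^bold>\<in> X)"
| "bounded_fm \<phi> \<Longrightarrow> bounded_fm \<psi> \<Longrightarrow> bounded_fm (\<phi> \<^bold>\<longrightarrow> \<psi>)"
| "bounded_fm \<phi> \<Longrightarrow> bounded_fm \<psi> \<Longrightarrow> bounded_fm (\<phi> \<^bold>\<and> \<psi>)"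
| "bounded_fm \<phi> \<Longrightarrow> bounded_fm \<psi> \<Longrightarrow> bounded_fm (\<phi> \<^bold>\<or> \<psi>)"
| "bounded_fm \<phi> \<Longrightarrow> bounded_fm (AllN (Var 0 \<^bold>< lift_tm t \<^bold>\<longrightarrow> \<phi>))"
| "bounded_fm \<phi> \<Longrightarrow> bounded_fm (ExN (Var 0 \<^bold>< lift_tm t \<^bold>\<and> \<phi>))"

definition Sigma01 :: "fm \<Rightarrow> bool" where
  "Sigma01 \<phi> \<longleftrightarrow> (\<exists>\<theta>. bounded_fm \<theta> \<and> \<phi> = ExN \<theta>)"

definition Pi01 :: "fm \<Rightarrow> bool" where
  "Pi01 \<phi> \<longleftrightarrow> (\<exists>\<theta>. bounded_fm \<theta> \<and> \<phi> = AllN \<theta>)"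

text \<open>The usual axioms of PA without induction; their universal closures are taken in \<open>RCA0\<close>.\<close>

definition discrete_ordered_semiring :: "fm set" where
  "discrete_ordered_semiring =
    (let x = Var 0; y = Var 1; z = Var 2 in
     {(x \<^bold>+ y) \<^bold>+ z \<^bold>= x \<^bold>+ (y \<^bold>+ z),
      x \<^bold>+ y \<^bold>= y \<^bold>+ x,
      (x \<^bold>* y) \<^bold>* z \<^bold>= x \<^bold>* (y \<^bold>* z),
      x \<^bold>* y \<^bold>= y \<^bold>* x,
      x \<^bold>* (y \<^bold>+ z) \<^bold>= x \<^bold>* y \<^bold>+ x \<^bold>* z,
      x \<^bold>+ \<^bold>0 \<^bold>= x,
      x \<^bold>* \<^bold>0 \<^bold>= \<^bold>0,
      x \<^bold>* \<^bold>1 \<^bold>= x,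
      x \<^bold>< y \<^bold>\<and> y \<^bold>< z \<^bold>\<longrightarrow> x \<^bold>< z,
      \<^bold>\<not> (x \<^bold>< x),
      x \<^bold>< y \<^bold>\<or> x \<^bold>= y \<^bold>\<or> y \<^bold>< x,
      x \<^bold>< y \<^bold>\<longrightarrow> x \<^bold>+ z \<^bold>< y \<^bold>+ z,
      \<^bold>0 \<^bold>< z \<^bold>\<and> x \<^bold>< y \<^bold>\<longrightarrow> x \<^bold>* z \<^bold>< y \<^bold>* z,
      x \<^bold>< y \<^bold>\<longrightarrow> ExN (lift_tm x \<^bold>+ Var 0 \<^bold>= lift_tm y),
      \<^bold>0 \<^bold>< \<^bold>1,
      \<^bold>0 \<^bold>< x \<^bold>\<longrightarrow> \<^bold>1 \<^bold>= x \<^bold>\<or> \<^bold>1 \<^bold>< x,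
      \<^bold>0 \<^bold>= x \<^bold>\<or> \<^bold>0 \<^bold>< x})"

text \<open>
  Induction is on number variable 0. Here and in the comprehension scheme, all other
  variables of \<open>\<phi>\<close> (numbers and sets) are parameters, bound by the universal closure.
\<close>

definition induction_axiom :: "fm \<Rightarrow> fm" where
  "induction_axiom \<phi> =
    (instN \<^bold>0 \<phi> \<^bold>\<and> AllN (\<phi> \<^bold>\<longrightarrow> subst (case_nat (Var 0 \<^bold>+ \<^bold>1) (\<lambda>i. Var (Suc i))) id \<phi>)
     \<^bold>\<longrightarrow> AllN \<phi>)"

definition comprehension_axiom :: "fm \<Rightarrow> fm \<Rightarrow> fm" where
  "comprehension_axiom \<phi> \<psi> =
    (AllN (\<phi> \<^bold>\<longleftrightarrow> \<psi>) \<^bold>\<longrightarrow> ExS (AllN (Var 0 \<^bold>\<in> 0 \<^bold>\<longleftrightarrow> liftS \<phi>)))"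

definition RCA0 :: "fm set" where
  "RCA0 = \<Union> (closures `
     (discrete_ordered_semiring
      \<union> {induction_axiom \<phi> | \<phi>. Sigma01 \<phi>}
      \<union> {comprehension_axiom \<phi> \<psi> | \<phi> \<psi>. Sigma01 \<phi> \<and> Pi01 \<psi>}))"

abbreviation Two :: tm ("\<^bold>2") where
  "\<^bold>2 \<equiv> \<^bold>1 \<^bold>+ \<^bold>1"

definition infinite_fm :: "nat \<Rightarrow> fm" where
  "infinite_fm X = AllN (ExN (Var 1 \<^bold>< Var 0 \<^bold>\<and> Var 0 \<^bold>\<in> X))"

text \<open>
  A finite binary string \<open>\<sigma>\<close> is coded by the positive number whose binary expansion is
  \<open>1\<sigma>\<close>. This is a bijection between strings and positive numbers; the empty string has
  code \<open>1\<close> and the two immediate extensions of \<open>s\<close> have codes \<open>2s\<close> and \<open>2s+1\<close>.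
  A binary tree is thus a set of positive numbers closed under \<open>2s \<mapsto> s\<close> and \<open>2s+1 \<mapsto> s\<close>
  for \<open>s > 0\<close>. An infinite path is given by the set of its finite initial segments.
\<close>

definition binary_tree_fm :: "nat \<Rightarrow> fm" where
  "binary_tree_fm T =
    (AllN (Var 0 \<^bold>\<in> T \<^bold>\<longrightarrow> \<^bold>0 \<^bold>< Var 0) \<^bold>\<and>
     AllN (\<^bold>0 \<^bold>< Var 0 \<^bold>\<and> (\<^bold>2 \<^bold>* Var 0 \<^bold>\<in> T \<^bold>\<or> \<^bold>2 \<^bold>* Var 0 \<^bold>+ \<^bold>1 \<^bold>\<in> T) \<^bold>\<longrightarrow> Var 0 \<^bold>\<in> T))"

definition path_fm :: "nat \<Rightarrow> nat \<Rightarrow> fm" where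
  "path_fm P T =
    (AllN (Var 0 \<^bold>\<in> P \<^bold>\<longrightarrow> Var 0 \<^bold>\<in> T) \<^bold>\<and>
     binary_tree_fm P \<^bold>\<and>
     \<^bold>1 \<^bold>\<in> P \<^bold>\<and>
     AllN (Var 0 \<^bold>\<in> P \<^bold>\<longrightarrow> (\<^bold>2 \<^bold>* Var 0 \<^bold>\<in> P \<^bold>\<longleftrightarrow> \<^bold>\<not> (\<^bold>2 \<^bold>* Var 0 \<^bold>+ \<^bold>1 \<^bold>\<in> P))))"

definition weak_koenig :: fm where
  "weak_koenig = AllS (binary_tree_fm 0 \<^bold>\<and> infinite_fm 0 \<^bold>\<longrightarrow> ExS (path_fm 0 1))"

definition WKL0 :: "fm set" where
  "WKL0 = insert weak_koenig RCA0"

text \<open>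
  A colouring \<open>f\<close> of the pairs \<open>x < y\<close> is given by its graph, the set of the codes of
  \<open>((x, y), f(x, y))\<close> under the pairing \<open>(a, b) = (a + b)\<^sup>2 + a\<close>, which is injective provably
  in \<open>RCA0\<close>. Other elements of the set are irrelevant.
\<close>

definition pair_tm :: "tm \<Rightarrow> tm \<Rightarrow> tm" where
  "pair_tm s t = (s \<^bold>+ t) \<^bold>* (s \<^bold>+ t) \<^bold>+ s"

definition colouring_fm :: "nat \<Rightarrow> fm" where
  "colouring_fm F =
    AllN (AllN (Var 1 \<^bold>< Var 0 \<^bold>\<longrightarrow>
      ExN (Var 0 \<^bold>< \<^bold>2 \<^bold>\<and>
        AllN (pair_tm (pair_tm (Var 3) (Var 2)) (Var 0) \<^bold>\<in> F \<^bold>\<longleftrightarrow> Var 0 \<^bold>= Var 1))))"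

definition homogeneous_fm :: "nat \<Rightarrow> nat \<Rightarrow> fm" where
  "homogeneous_fm H F =
    ExN (Var 0 \<^bold>< \<^bold>2 \<^bold>\<and>
      AllN (AllN (Var 1 \<^bold>\<in> H \<^bold>\<and> Var 0 \<^bold>\<in> H \<^bold>\<and> Var 1 \<^bold>< Var 0 \<^bold>\<longrightarrow>
        pair_tm (pair_tm (Var 1) (Var 0)) (Var 2) \<^bold>\<in> F)))"

definition RT22 :: fm where
  "RT22 = AllS (colouring_fm 0 \<^bold>\<longrightarrow> ExS (infinite_fm 0 \<^bold>\<and> homogeneous_fm 0 1))"


section \<open>Provably total recursive functions\<close>

primrec eval :: "(nat \<Rightarrow> nat) \<Rightarrow> tm \<Rightarrow> nat" where
  "eval e (Var i) = e i"
| "eval e \<^bold>0 = 0"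
| "eval e \<^bold>1 = 1"
| "eval e (s \<^bold>+ t) = eval e s + eval e t"
| "eval e (s \<^bold>* t) = eval e s * eval e t"

text \<open>Truth in the standard model, with set variables ranging over all sets of numbers.\<close>

primrec sat :: "(nat \<Rightarrow> nat) \<Rightarrow> (nat \<Rightarrow> nat set) \<Rightarrow> fm \<Rightarrow> bool" where
  "sat e v \<^bold>\<bottom> = False"
| "sat e v (s \<^bold>= t) = (eval e s = eval e t)"
| "sat e v (s \<^bold>< t) = (eval e s < eval e t)"
| "sat e v (t \<^bold>\<in> X) = (eval e t \<in> v X)"
| "sat e v (\<phi> \<^bold>\<longrightarrow> \<psi>) = (sat e v \<phi> \<longrightarrow> sat e v \<psi>)"
| "sat e v (\<phi> \<^bold>\<and> \<psi>) = (sat e v \<phi> \<and> sat e v \<psi>)"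
| "sat e v (\<phi> \<^bold>\<or> \<psi>) = (sat e v \<phi> \<or> sat e v \<psi>)"
| "sat e v (AllN \<phi>) = (\<forall>n. sat (case_nat n e) v \<phi>)"
| "sat e v (ExN \<phi>) = (\<exists>n. sat (case_nat n e) v \<phi>)"
| "sat e v (AllS \<phi>) = (\<forall>A. sat e (case_nat A v) \<phi>)"
| "sat e v (ExS \<phi>) = (\<exists>A. sat e (case_nat A v) \<phi>)"

text \<open>
  \<open>recursive_on k F\<close>: on lists of length \<open>k\<close>, \<open>F\<close> is a total \<open>k\<close>-ary recursive function.
  Minimization is applied to regular functions only, so that all functions are total.
\<close>

inductive recursive_on :: "nat \<Rightarrow> (nat list \<Rightarrow> nat) \<Rightarrow> bool" where
  "recursive_on k (\<lambda>xs. 0)"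
| "recursive_on 1 (\<lambda>xs. Suc (xs ! 0))"
| "i < k \<Longrightarrow> recursive_on k (\<lambda>xs. xs ! i)"
| "recursive_on (length Gs) F \<Longrightarrow> \<forall>G\<in>set Gs. recursive_on k G \<Longrightarrow>
    recursive_on k (\<lambda>xs. F (map (\<lambda>G. G xs) Gs))"
| "recursive_on k F \<Longrightarrow> recursive_on (Suc (Suc k)) G \<Longrightarrow>
    recursive_on (Suc k) (\<lambda>xs. rec_nat (F (tl xs)) (\<lambda>n r. G (n # r # tl xs)) (hd xs))"
| "recursive_on (Suc k) F \<Longrightarrow> \<forall>xs. length xs = k \<longrightarrow> (\<exists>n. F (n # xs) = 0) \<Longrightarrow>
    recursive_on k (\<lambda>xs. LEAST n. F (n # xs) = 0)"

definition recursive :: "(nat \<Rightarrow> nat) \<Rightarrow> bool" where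
  "recursive f \<longleftrightarrow> (\<exists>F. recursive_on 1 F \<and> (\<forall>x. F [x] = f x))"

text \<open>
  Unique existence of number variable 0. The substitution turns variable 0 of \<open>\<phi>\<close> into the
  innermost bound variable and skips the variable bound by the outer quantifier.
\<close>

definition Ex1N :: "fm \<Rightarrow> fm" where
  "Ex1N \<phi> =
    ExN (\<phi> \<^bold>\<and>
      AllN (subst (case_nat (Var 0) (\<lambda>i. Var (Suc (Suc i)))) id \<phi> \<^bold>\<longrightarrow> Var 0 \<^bold>= Var 1))"

text \<open>
  In the defining formula, variable 1 is the argument and variable 0 the value; there are
  no further parameters, in particular no set parameters.
\<close>

definition Sigma1_defines :: "fm \<Rightarrow> (nat \<Rightarrow> nat) \<Rightarrow> bool" where
  "Sigma1_defines \<phi> f \<longleftrightarrow>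
    Sigma01 \<phi> \<and> below 2 0 \<phi> \<and>
    (\<forall>x y e v. sat (case_nat y (case_nat x e)) v \<phi> \<longleftrightarrow> y = f x)"

definition provably_total :: "fm set \<Rightarrow> (nat \<Rightarrow> nat) \<Rightarrow> bool" where
  "provably_total T f \<longleftrightarrow> (\<exists>\<phi>. Sigma1_defines \<phi> f \<and> (T \<turnstile> AllN (Ex1N \<phi>)))"


section \<open>Ordinals up to \<open>\<omega>\<^sup>\<omega>\<close> and the Hardy hierarchy\<close>

text \<open>
  An ordinal below \<open>\<omega>\<^sup>\<omega>\<close> is represented by the multiset of the exponents in its Cantor normal
  form \<open>\<omega>\<^sup>a + \<omega>\<^sup>b + \<dots>\<close> (\<open>a \<ge> b \<ge> \<dots>\<close>). The order of ordinals is the library's multiset order: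
  the multiplicities are compared at the largest exponent at which they differ.
\<close>

type_synonym cnf = "nat multiset"

lemma cnf_less_iff:
  fixes \<alpha> \<beta> :: cnf
  shows "\<alpha> < \<beta> \<longleftrightarrow> (\<exists>j. count \<alpha> j < count \<beta> j \<and> (\<forall>i>j. count \<alpha> i = count \<beta> i))"
proof
  assume "\<alpha> < \<beta>"
  then have ne: "\<alpha> \<noteq> \<beta>"
    and ho: "\<And>j. count \<beta> j < count \<alpha> j \<Longrightarrow> \<exists>i>j. count \<alpha> i < count \<beta> i"
    by (auto simp: less_multiset\<^sub>H\<^sub>O)
  define D where "D = {i. count \<alpha> i \<noteq> count \<beta> i}"
  have "D \<subseteq> set_mset \<alpha> \<union> set_mset \<beta>"
    by (auto simp: D_def simp flip: count_greater_zero_iff)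
  then have fin: "finite D"
    by (rule finite_subset) simp
  have "D \<noteq> {}"
    using ne by (auto simp: D_def multiset_eq_iff)
  with fin have in_D: "Max D \<in> D" and max: "\<And>i. i \<in> D \<Longrightarrow> i \<le> Max D"
    by auto
  have above: "count \<alpha> i = count \<beta> i" if "i > Max D" for i
    using max[of i] that by (auto simp: D_def)
  moreover have "count \<alpha> (Max D) < count \<beta> (Max D)"
  proof (rule ccontr)
    assume "\<not> ?thesis"
    with in_D have "count \<beta> (Max D) < count \<alpha> (Max D)"
      by (simp add: D_def)
    from ho[OF this] above show False
      by force
  qed
  ultimately show "\<exists>j. count \<alpha> j < count \<beta> j \<and> (\<forall>i>j. count \<alpha> i = count \<beta> i)"
    by blast
next
  assume "\<exists>j. count \<alpha> j < count \<beta> j \<and> (\<forall>i>j. count \<alpha> i = count \<beta> i)"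
  then obtain j where j: "count \<alpha> j < count \<beta> j" "\<And>i. i > j \<Longrightarrow> count \<alpha> i = count \<beta> i"
    by blast
  have "\<exists>i>k. count \<alpha> i < count \<beta> i" if "count \<beta> k < count \<alpha> k" for k
    using j that by (metis less_asym less_irrefl linorder_neqE_nat)
  with j(1) show "\<alpha> < \<beta>"
    unfolding less_multiset\<^sub>H\<^sub>O by (metis less_irrefl)
qed

lemma fundamental_less:
  fixes \<beta> :: cnf
  assumes "\<And>i. i \<in># \<gamma> \<Longrightarrow> i < j"
  shows "\<beta> + \<gamma> < add_mset j \<beta>"
proof -
  have "\<gamma> < {#j#}"
    by (rule ex_gt_imp_less_multiset) (use assms in auto)
  then have "\<beta> + \<gamma> < \<beta> + {#j#}"
    by (rule add_strict_left_mono)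
  then show ?thesis
    by simp
qed

text \<open>
  The least exponent \<open>j\<close> of \<open>\<alpha> \<noteq> 0\<close> is the exponent of the last summand of its normal form, so
  \<open>\<alpha> = \<beta> + \<omega>\<^sup>j\<close> for the ordinal \<open>\<beta>\<close> with that summand removed. It is a successor if \<open>j = 0\<close>;
  otherwise it is a limit and \<open>\<alpha>[x] = \<beta> + \<omega>\<^bsup>j-1\<^esup> \<sqdot> x\<close>.
\<close>

function hardy :: "cnf \<Rightarrow> nat \<Rightarrow> nat" where
  "hardy \<alpha> x =
    (if \<alpha> = {#} then x
     else let j = Min (set_mset \<alpha>); \<beta> = \<alpha> - {#j#} in
       if j = 0 then hardy \<beta> (x + 1)
       else hardy (\<beta> + replicate_mset x (j - 1)) x)"
  by pat_completeness auto
termination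
proof (relation "inv_image {(\<alpha>, \<beta>). \<alpha> < \<beta>} fst")
  show "wf (inv_image {(\<alpha> :: cnf, \<beta>). \<alpha> < \<beta>} (fst :: cnf \<times> nat \<Rightarrow> cnf))"
    by (intro wf_inv_image wf_less_multiset)
next
  fix \<alpha> \<beta> :: cnf and x j :: nat
  assume "\<alpha> \<noteq> {#}" and j: "j = Min (set_mset \<alpha>)" and \<beta>: "\<beta> = \<alpha> - {#j#}"
  then have "j \<in># \<alpha>"
    by simp
  then have \<alpha>: "\<alpha> = add_mset j \<beta>"
    by (simp add: \<beta>)
  show "((\<beta>, x + 1), (\<alpha>, x)) \<in> inv_image {(\<alpha>, \<beta>). \<alpha> < \<beta>} fst"
    using fundamental_less[of "{#}" j \<beta>] by (simp add: \<alpha>)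
  show "((\<beta> + replicate_mset x (j - 1), x), (\<alpha>, x)) \<in> inv_image {(\<alpha>, \<beta>). \<alpha> < \<beta>} fst"
    if "j \<noteq> 0"
    using fundamental_less[of "replicate_mset x (j - 1)" j \<beta>] that
    by (simp add: \<alpha> in_replicate_mset)
qed

declare hardy.simps [simp del]

datatype ord = Below cnf | Omega_Omega ("\<omega>\<^sup>\<omega>")

instantiation ord :: linorder
begin

fun less_eq_ord :: "ord \<Rightarrow> ord \<Rightarrow> bool" where
  "Below \<alpha> \<le> Below \<beta> \<longleftrightarrow> \<alpha> \<le> \<beta>"
| "\<omega>\<^sup>\<omega> \<le> Below \<beta> \<longleftrightarrow> False"
| "\<alpha> \<le> \<omega>\<^sup>\<omega> \<longleftrightarrow> True"

definition less_ord :: "ord \<Rightarrow> ord \<Rightarrow> bool" where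
  "less_ord \<alpha> \<beta> \<longleftrightarrow> \<alpha> \<le> \<beta> \<and> \<not> \<beta> \<le> \<alpha>"

instance
proof
  fix \<alpha> \<beta> \<gamma> :: ord
  show "\<alpha> < \<beta> \<longleftrightarrow> \<alpha> \<le> \<beta> \<and> \<not> \<beta> \<le> \<alpha>"
    by (fact less_ord_def)
  show "\<alpha> \<le> \<alpha>"
    by (cases \<alpha>) auto
  show "\<alpha> \<le> \<beta> \<Longrightarrow> \<beta> \<le> \<gamma> \<Longrightarrow> \<alpha> \<le> \<gamma>"
    by (cases \<alpha>; cases \<beta>; cases \<gamma>) auto
  show "\<alpha> \<le> \<beta> \<Longrightarrow> \<beta> \<le> \<alpha> \<Longrightarrow> \<alpha> = \<beta>"
    by (cases \<alpha>; cases \<beta>) auto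
  show "\<alpha> \<le> \<beta> \<or> \<beta> \<le> \<alpha>"
    by (cases \<alpha>; cases \<beta>) auto
qed

end

definition hardy_bounds :: "fm set \<Rightarrow> ord \<Rightarrow> bool" where
  "hardy_bounds T \<alpha> \<longleftrightarrow>
    (\<forall>f. recursive f \<and> provably_total T f \<longrightarrow>
      (\<exists>\<beta>. Below \<beta> < \<alpha> \<and> (\<forall>\<^sub>F x in sequentially. f x \<le> hardy \<beta> x)))"

definition is_proof_theoretic_ordinal :: "fm set \<Rightarrow> ord \<Rightarrow> bool" where
  "is_proof_theoretic_ordinal T \<alpha> \<longleftrightarrow>
    hardy_bounds T \<alpha> \<and> (\<forall>\<alpha>'. hardy_bounds T \<alpha>' \<longrightarrow> \<alpha> \<le> \<alpha>')"

end

theory Submission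
  imports Defs "HOL-Library.Countable_Set" "HOL-Library.Nat_Bijection"
begin

text \<open>
  The functions \<open>fast n\<close> play the role of the Hardy functions at \<open>\<omega>\<^sup>n\<close>. A finite set is
  \<open>large (n + 1)\<close> if it contains an element \<open>x\<close> followed by \<open>x\<close> consecutive blocks that are
  \<open>large n\<close>; the interval from \<open>a\<close> to \<open>fast n a\<close> is \<open>large n\<close>, and for every \<open>n\<close> there is an
  \<open>N\<close> such that each 2-colouring of the pairs of a \<open>large N\<close> set has a homogeneous \<open>large n\<close>
  subset.

  Upper bound: if \<open>f\<close> is dominated by no \<open>fast n\<close>, choose \<open>a n\<close> with \<open>fast n (a n) < f (a n)\<close>.
  In a countable ultrapower of the natural numbers, the interval from \<open>a\<close> to \<open>f a\<close> is then
  large for every standard \<open>n\<close>, and can be thinned out infinitely often, deciding one internal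
  colouring and one internal gap at a time. The minima of the resulting sets determine a cut
  containing \<open>a\<close> but not \<open>f a\<close>. With the internal sets, it is a model of weak Koenig's lemma
  and Ramsey's theorem in which \<open>f\<close> has no value at \<open>a\<close>.

  Lower bound: the graph of \<open>fast n\<close> (up to domination) is defined by bounded formulas that
  code finite sets by divisibility. Totality follows by \<open>\<Sigma>\<^sub>1\<close> induction, argued in a Henkin
  term model.
\<close>

section \<open>Large finite sets\<close>

text \<open>The sets of the cut model are internal sets restricted to the cut, so every axiom
  becomes a statement about finite sets at almost all indices. Comprehension and weak Koenig's lemma
  demand nothing of the colourings and gaps. \<open>\<Sigma>\<^sub>1\<close> induction is what the
  gaps are for (the cut has to be semiregular), and Ramsey's theorem needs homogeneous sets that are
  cofinal in the cut. Two constraints shape the ultrapower. Its functions must be countable in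
  number, since only \<open>\<omega>\<close> thinning steps are available to treat all of them. They
  must also be closed under thinning, so a step has to be one definite operation that serves all
  standard levels of largeness at once. The steps can be iterated because the level needed before a
  step depends only on the level wanted after it. The obstacle to the lower bound is the lack of
  exponentiation in the language. Coding by divisibility needs only common multiples, and these
  exist by \<open>\<Sigma>\<^sub>1\<close> induction. The term model replaces formal derivations by
  ordinary reasoning in ordered semirings.\<close>

definition before :: "nat set \<Rightarrow> nat set \<Rightarrow> bool" (infix "\<lless>" 50) where
  "A \<lless> B \<longleftrightarrow> (\<forall>a\<in>A. \<forall>b\<in>B. a < b)"

text \<open>The index set is an arbitrary finite set of numbers: blocks are discarded by shrinking
  \<open>J\<close>, without renumbering, and only the order of the indices matters.\<close>

definition blocks :: "nat set \<Rightarrow> nat set \<Rightarrow> (nat \<Rightarrow> nat set) \<Rightarrow> bool" where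
  "blocks X J Y \<longleftrightarrow> finite J \<and> (\<forall>i\<in>J. Y i \<subseteq> X) \<and> (\<forall>i\<in>J. \<forall>j\<in>J. i < j \<longrightarrow> Y i \<lless> Y j)"

lemma before_mono: "A \<lless> B \<Longrightarrow> A' \<subseteq> A \<Longrightarrow> B' \<subseteq> B \<Longrightarrow> A' \<lless> B'"
  unfolding before_def by blast

lemma blocks_mono:
  assumes "blocks X J Y" "J' \<subseteq> J" "\<And>i. i \<in> J' \<Longrightarrow> Z i \<subseteq> Y i"
  shows "blocks X J' Z"
  unfolding blocks_def
proof (intro conjI ballI impI)
  show "finite J'"
    using assms(1,2) by (auto simp: blocks_def intro: finite_subset)
  show "Z i \<subseteq> X" if "i \<in> J'" for i
    using assms that unfolding blocks_def by blast
  show "Z i \<lless> Z j" if "i \<in> J'" "j \<in> J'" "i < j" for i j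
  proof -
    have "Y i \<lless> Y j"
      using assms that unfolding blocks_def by blast
    then show ?thesis
      using assms(3) that by (blast intro: before_mono)
  qed
qed

lemma blocks_superset: "blocks X J Y \<Longrightarrow> X \<subseteq> X' \<Longrightarrow> blocks X' J Y"
  unfolding blocks_def by blast

text \<open>A form of \<open>\<omega>^n\<close>-largeness in the sense of Ketonen and Solovay. The
  leading element \<open>x\<close> need not be the minimum and the blocks need not exhaust the rest,
  so a superset of a large set is large at the same level.\<close>

primrec large :: "nat \<Rightarrow> nat set \<Rightarrow> bool" where
  "large 0 X \<longleftrightarrow> X \<noteq> {}"
| "large (Suc n) X \<longleftrightarrow>
    (\<exists>x\<in>X. \<exists>J Y. blocks {y\<in>X. x < y} J Y \<and> card J = x \<and> (\<forall>i\<in>J. large n (Y i)))"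

lemma large_nonempty: "large n X \<Longrightarrow> X \<noteq> {}"
  by (cases n) auto

lemma large_Suc: "large (Suc n) X \<Longrightarrow> large n X"
proof (induction n arbitrary: X)
  case 0
  then show ?case by (auto dest: large_nonempty)
next
  case (Suc n)
  then obtain x J Y where *: "x \<in> X" "blocks {y\<in>X. x < y} J Y" "card J = x" "\<forall>i\<in>J. large (Suc n) (Y i)"
    by auto
  then have "\<forall>i\<in>J. large n (Y i)"
    using Suc.IH by blast
  with * show ?case by auto
qed

lemma large_le: "large n X \<Longrightarrow> m \<le> n \<Longrightarrow> large m X"
  by (induction n) (auto simp: le_Suc_eq simp del: large.simps dest: large_Suc)

lemma large_SucI:
  assumes "x \<in> X" "blocks X J Y" "x \<le> card J" "\<And>i. i \<in> J \<Longrightarrow> large n (Y i)"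
    and "\<And>i. i \<in> J \<Longrightarrow> {x} \<lless> Y i"
  shows "large (Suc n) X"
proof -
  obtain J' where J': "J' \<subseteq> J" "card J' = x"
    using assms(3) obtain_subset_with_card_n by blast
  have "blocks X J' Y"
    using blocks_mono[OF assms(2) J'(1)] by blast
  then have "blocks {y \<in> X. x < y} J' Y"
    using assms(5) J'(1) unfolding blocks_def before_def by blast
  moreover have "\<forall>i\<in>J'. large n (Y i)"
    using assms(4) J'(1) by blast
  ultimately show ?thesis
    unfolding large.simps using assms(1) J'(2) by blast
qed

lemma large_SucE:
  assumes "large (Suc n) X"
  obtains x J Y where "x \<in> X" "blocks X J Y" "card J = x" "\<And>i. i \<in> J \<Longrightarrow> large n (Y i)"
    "\<And>i. i \<in> J \<Longrightarrow> {x} \<lless> Y i"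
proof -
  from assms obtain x J Y where *: "x \<in> X" "blocks {y\<in>X. x < y} J Y" "card J = x" "\<forall>i\<in>J. large n (Y i)"
    by auto
  show thesis
  proof (rule that[of x J Y])
    show "blocks X J Y"
      by (rule blocks_superset[OF *(2)]) blast
    show "{x} \<lless> Y i" if "i \<in> J" for i
      using *(2) that unfolding blocks_def before_def by blast
  qed (use * in auto)
qed

text \<open>Two levels give a product: the number of blocks equals the leading element, so there are
  at least \<open>k\<close> outer blocks with at least \<open>l\<close> inner blocks each.\<close>

lemma large_blocks_Suc_Suc:
  assumes "large (Suc (Suc n)) X" "\<And>x. x \<in> X \<Longrightarrow> k \<le> x" "\<And>x. x \<in> X \<Longrightarrow> l \<le> x" "k > 0"
  obtains J Y where "blocks X J Y" "k * l \<le> card J" "\<And>i. i \<in> J \<Longrightarrow> large n (Y i)"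
proof -
  obtain x J Y where X: "x \<in> X" "blocks X J Y" "card J = x" "\<And>i. i \<in> J \<Longrightarrow> large (Suc n) (Y i)"
    using large_SucE[OF assms(1)] by metis
  define j0 where "j0 = Min J"
  have "J \<noteq> {}"
    using X(3) assms(2)[OF X(1)] \<open>k > 0\<close> by auto
  have finJ: "finite J"
    using X(2) by (simp add: blocks_def)
  have "\<forall>i\<in>J. \<exists>x' J' Y'. x' \<in> Y i \<and> blocks (Y i) J' Y' \<and> card J' = x' \<and> (\<forall>i\<in>J'. large n (Y' i))"
    using X(4) by (metis large_SucE)
  then obtain x' J' Y' where Y: "\<And>i. i \<in> J \<Longrightarrow> x' i \<in> Y i \<and> blocks (Y i) (J' i) (Y' i) \<and> card (J' i) = x' i
      \<and> (\<forall>j\<in>J' i. large n (Y' i j))"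
    by metis
  define m where "m = Suc (Max (\<Union>i\<in>J. J' i))"
  have finU: "finite (\<Union>i\<in>J. J' i)"
    using finJ Y by (auto simp: blocks_def)
  have m: "j < m" if "i \<in> J" "j \<in> J' i" for i j
    unfolding m_def using finU that by (metis Max_ge UN_I less_Suc_eq_le)
  \<comment> \<open>Index pairs are ordered lexicographically: \<open>m\<close> exceeds every inner
    index, so \<open>div\<close> and \<open>mod\<close> recover the pair and the outer index
    dominates.\<close>
  define K where "K = (\<lambda>(i, j). i * m + j) ` (SIGMA i:J. J' i)"
  define Z where "Z p = Y' (p div m) (p mod m)" for p
  have inj: "inj_on (\<lambda>(i, j). i * m + j) (SIGMA i:J. J' i)"
  proof (rule inj_onI, clarify)
    fix i j i' j' assume *: "i \<in> J" "j \<in> J' i" "i' \<in> J" "j' \<in> J' i'" "i * m + j = i' * m + j'"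
    have "j < m" "j' < m"
      using m * by auto
    then have "(i * m + j) div m = i" "(i' * m + j') div m = i'"
      by (auto simp: )
    with *(5) show "i = i' \<and> j = j'"
      by auto
  qed
  have fin': "finite (J' i)" if "i \<in> J" for i
    using Y[OF that] by (auto simp: blocks_def)
  have cK: "card K = (\<Sum>i\<in>J. card (J' i))"
    unfolding K_def using card_image[OF inj] finJ fin' by (simp add: card_SigmaI)
  have "l \<le> card (J' i)" if "i \<in> J" for i
    using Y[OF that] X(2) that assms(3) unfolding blocks_def by auto
  then have "card J * l \<le> card K"
    unfolding cK using sum_bounded_below[of J l "\<lambda>i. card (J' i)"] by simp
  moreover have "k * l \<le> card J * l"
    using X assms(2) by simp
  ultimately have card: "k * l \<le> card K"
    by linarith
  have Kd: "\<exists>i\<in>J. \<exists>j\<in>J' i. p = i * m + j \<and> p div m = i \<and> p mod m = j" if "p \<in> K" for p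
    using that m by (force simp: K_def)
  have bl: "blocks X K Z"
    unfolding blocks_def
  proof (intro conjI ballI impI)
    show "finite K"
      unfolding K_def using finJ fin' by auto
    show "Z p \<subseteq> X" if pK: "p \<in> K" for p
    proof -
      obtain i j where "i \<in> J" "j \<in> J' i" "p div m = i" "p mod m = j"
        using Kd[OF pK] by blast
      then have "Z p \<subseteq> Y i" "Y i \<subseteq> X"
        using Y X(2) unfolding Z_def blocks_def by auto
      then show ?thesis by blast
    qed
    show "Z p \<lless> Z q" if pq: "p \<in> K" "q \<in> K" "p < q" for p q
    proof -
      obtain i j where p: "i \<in> J" "j \<in> J' i" "p = i * m + j" "p div m = i" "p mod m = j"
        using Kd[OF pq(1)] by blast
      obtain i' j' where q: "i' \<in> J" "j' \<in> J' i'" "q = i' * m + j'" "q div m = i'" "q mod m = j'"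
        using Kd[OF pq(2)] by blast
      have "i \<le> i'"
        using pq(3) p(4) q(4) by (metis div_le_mono less_imp_le)
      show ?thesis
      proof (cases "i = i'")
        case True
        with pq(3) p q have "j < j'" by simp
        then show ?thesis
          using Y[OF p(1)] p q True unfolding Z_def blocks_def by simp
      next
        case False
        with \<open>i \<le> i'\<close> have "Y i \<lless> Y i'"
          using X(2) p q unfolding blocks_def by auto
        then show ?thesis
          using Y[OF p(1)] Y[OF q(1)] p q unfolding Z_def blocks_def by (metis before_mono)
      qed
    qed
  qed
  have "large n (Z p)" if "p \<in> K" for p
    using Kd[OF that] Y unfolding Z_def by metis
  with bl card show thesis
    using that by blast
qed

lemma majority:
  assumes "finite J" "finite C" "C \<noteq> {}" "c ` J \<subseteq> C" "card C * l \<le> card J"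
  obtains d where "d \<in> C" "l \<le> card {i\<in>J. c i = d}"
proof -
  have "\<exists>d\<in>C. l \<le> card {i\<in>J. c i = d}"
  proof (rule ccontr)
    assume "\<not> ?thesis"
    then have *: "\<And>d. d \<in> C \<Longrightarrow> card {i\<in>J. c i = d} < l"
      by auto
    have "card J = (\<Sum>d\<in>C. card {i\<in>J. c i = d})"
    proof -
      have "J = (\<Union>d\<in>C. {i\<in>J. c i = d})"
        using assms(4) by auto
      then have "card J = card (\<Union>d\<in>C. {i\<in>J. c i = d})"
        by simp
      also have "\<dots> = (\<Sum>d\<in>C. card {i\<in>J. c i = d})"
        by (rule card_UN_disjoint) (use assms in auto)
      finally show ?thesis .
    qed
    also have "\<dots> < (\<Sum>d\<in>C. l)"
      by (rule sum_strict_mono) (use assms * in auto)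
    finally show False
      using assms(5) by simp
  qed
  with that show thesis by blast
qed

text \<open>
  Cut \<open>X\<close> into more zones than there are colours. In each zone, a majority colour is carried
  by more blocks than any element of the previous zones, and two zones share their
  majority colour.
\<close>

lemma large_pigeonhole:
  assumes "large (3 * n) X" "finite (c ` X)" "\<And>x. x \<in> X \<Longrightarrow> card (c ` X) < x"
  shows "\<exists>Y\<subseteq>X. \<exists>d. large n Y \<and> c ` Y = {d}"
  using assms
proof (induction n arbitrary: X)
  case 0
  then obtain x where "x \<in> X" by auto
  then show ?case
    by (intro exI[of _ "{x}"] conjI) auto
next
  case (Suc n)
  let ?k = "card (c ` X)"
  \<comment> \<open>The three levels spent on each \<open>n\<close>: one for the zones, two for
    finding enough blocks of level \<open>3 * n\<close> inside a zone.\<close>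
  have "large (Suc (3 * n + 2)) X"
    using Suc.prems(1) by (simp del: large.simps add: algebra_simps numeral_3_eq_3)
  then obtain x J Y where X: "x \<in> X" "blocks X J Y" "card J = x" "\<And>i. i \<in> J \<Longrightarrow> large (3 * n + 2) (Y i)"
    "\<And>i. i \<in> J \<Longrightarrow> {x} \<lless> Y i"
    using large_SucE by metis
  have finJ: "finite J" and YX: "\<And>i. i \<in> J \<Longrightarrow> Y i \<subseteq> X"
    using X(2) by (auto simp: blocks_def)
  have kpos: "?k > 0"
    using X(1) Suc.prems(2) by (metis card_gt_0_iff empty_iff imageI)
  have mono: "\<exists>Z\<subseteq>W. \<exists>d\<in>c ` X. large n Z \<and> c ` Z = {d}" if W: "large (3 * n) W" "W \<subseteq> X" for W
  proof -
    have sub: "c ` W \<subseteq> c ` X" using W by auto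
    then have "card (c ` W) \<le> ?k"
      using Suc.prems(2) by (simp add: card_mono)
    then have "\<exists>Z\<subseteq>W. \<exists>d. large n Z \<and> c ` Z = {d}"
    proof (intro Suc.IH)
      show "large (3 * n) W" by (fact W(1))
      show "finite (c ` W)"
        using sub Suc.prems(2) by (rule finite_subset)
      show "card (c ` W) < w" if "w \<in> W" for w
        using \<open>card (c ` W) \<le> ?k\<close> Suc.prems(3)[of w] W(2) that by auto
    qed
    then obtain Z d where Z: "Z \<subseteq> W" "large n Z" "c ` Z = {d}"
      by blast
    then have "d \<in> c ` X"
      using W(2) by (metis image_mono insert_subset subset_trans)
    with Z show ?thesis
      by blast
  qed
  define Q where "Q i l d K Z \<longleftrightarrow> d \<in> c ` X \<and> blocks (Y i) K Z \<and> l \<le> card K \<and>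
    (\<forall>j\<in>K. large n (Z j) \<and> c ` Z j = {d})" for i l d K Z
  have zone: "\<exists>d K Z. Q i l d K Z"
    if i: "i \<in> J" and l: "\<And>y. y \<in> Y i \<Longrightarrow> l \<le> y" for i l
  proof -
    have "large (Suc (Suc (3 * n))) (Y i)"
      using X(4)[OF i] by (simp del: large.simps)
    moreover have "?k \<le> y" if "y \<in> Y i" for y
      using Suc.prems(3)[of y] YX[OF i] that by auto
    ultimately have "\<exists>K V. blocks (Y i) K V \<and> ?k * l \<le> card K \<and> (\<forall>j\<in>K. large (3 * n) (V j))"
      using large_blocks_Suc_Suc[of "3 * n" "Y i" ?k l] l kpos by metis
    then obtain K V where V: "blocks (Y i) K V" "?k * l \<le> card K" "\<And>j. j \<in> K \<Longrightarrow> large (3 * n) (V j)"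
      by blast
    have "\<forall>j\<in>K. \<exists>Z d. Z \<subseteq> V j \<and> d \<in> c ` X \<and> large n Z \<and> c ` Z = {d}"
    proof
      fix j assume "j \<in> K"
      then have "V j \<subseteq> X"
        using V(1) YX[OF i] by (auto simp: blocks_def)
      with mono[OF V(3)[OF \<open>j \<in> K\<close>]] show "\<exists>Z d. Z \<subseteq> V j \<and> d \<in> c ` X \<and> large n Z \<and> c ` Z = {d}"
        by blast
    qed
    then obtain Z d where Z: "\<And>j. j \<in> K \<Longrightarrow> Z j \<subseteq> V j \<and> d j \<in> c ` X \<and> large n (Z j) \<and> c ` Z j = {d j}"
      by metis
    have "finite K" "d ` K \<subseteq> c ` X" "c ` X \<noteq> {}"
      using V(1) Z X(1) by (auto simp: blocks_def)
    then obtain d0 where d0: "d0 \<in> c ` X" "l \<le> card {j\<in>K. d j = d0}"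
      using majority[OF _ Suc.prems(2), of K d l] V(2) by metis
    have "blocks (Y i) {j\<in>K. d j = d0} Z"
      by (rule blocks_mono[OF V(1)]) (use Z in auto)
    with d0 Z have "Q i l d0 {j\<in>K. d j = d0} Z"
      by (simp add: Q_def)
    then show ?thesis by blast
  qed
  \<comment> \<open>The number of blocks demanded from zone \<open>i\<close> is its least element,
    which exceeds the leader \<open>x\<close> and all elements of earlier zones.\<close>
  define l where "l i = (LEAST y. y \<in> Y i)" for i
  have l: "l i \<le> y" if "y \<in> Y i" for i y
    unfolding l_def using that by (rule Least_le)
  have "\<forall>i\<in>J. \<exists>d K Z. Q i (l i) d K Z"
    using zone l by metis
  then obtain d J' Z where "\<And>i. i \<in> J \<Longrightarrow> Q i (l i) (d i) (J' i) (Z i)"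
    by metis
  then have Z: "d i \<in> c ` X \<and> blocks (Y i) (J' i) (Z i) \<and> l i \<le> card (J' i)
      \<and> (\<forall>j\<in>J' i. large n (Z i j) \<and> c ` Z i j = {d i})" if "i \<in> J" for i
    using that by (simp add: Q_def)
  have "\<not> inj_on d J"
  proof
    assume "inj_on d J"
    moreover have "d ` J \<subseteq> c ` X"
      using Z by auto
    ultimately have "card J \<le> ?k"
      using Suc.prems(2) by (metis card_inj_on_le)
    with X(3) Suc.prems(3)[OF X(1)] show False by simp
  qed
  then obtain i i' where i: "i \<in> J" "i' \<in> J" "d i = d i'" "i < i'"
    unfolding inj_on_def by (metis linorder_neqE_nat)
  have lY: "l i \<in> Y i" if "i \<in> J" for i
    unfolding l_def using large_nonempty[OF X(4)[OF that]] by (metis LeastI ex_in_conv)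
  have "J' i \<noteq> {}"
    using Z[OF i(1)] lY[OF i(1)] X(5)[OF i(1)] by (auto simp: before_def)
  then obtain j where j: "j \<in> J' i" by auto
  then obtain y where y: "y \<in> Z i j"
    using Z[OF i(1)] large_nonempty by blast
  have yY: "y \<in> Y i"
    using y j Z[OF i(1)] by (auto simp: blocks_def)
  have bef: "{y} \<lless> Y i'"
    using X(2) i yY unfolding blocks_def before_def by blast
  let ?W = "insert y (\<Union>j\<in>J' i'. Z i' j)"
  have "large (Suc n) ?W"
  proof (rule large_SucI)
    show "y \<in> ?W" by simp
    show "blocks ?W (J' i') (Z i')"
      using Z[OF i(2)] unfolding blocks_def by blast
    show "y \<le> card (J' i')"
      using Z[OF i(2)] bef lY[OF i(2)] unfolding before_def by force
    show "large n (Z i' j)" if "j \<in> J' i'" for j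
      using Z[OF i(2)] that by blast
    show "{y} \<lless> Z i' j" if "j \<in> J' i'" for j
      using Z[OF i(2)] that bef by (auto simp: blocks_def before_def)
  qed
  moreover have "?W \<subseteq> X"
    using yY YX Z i unfolding blocks_def by blast
  moreover have "c ` ?W = {d i'}"
  proof -
    have "c y = d i'"
      using Z[OF i(1)] j y i(3) by auto
    moreover have "c w = d i'" if "j \<in> J' i'" "w \<in> Z i' j" for j w
      using Z[OF i(2)] that by auto
    ultimately show ?thesis by auto
  qed
  ultimately show ?case by blast
qed

section \<open>Fast-growing functions\<close>

text \<open>The iteration starts at \<open>Suc x\<close> because a large interval spends
  \<open>x\<close> itself as its leader: from \<open>Suc x\<close> on, the \<open>x\<close> iterates
  are the endpoints of the blocks.\<close>

primrec fast :: "nat \<Rightarrow> nat \<Rightarrow> nat" where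
  "fast 0 x = Suc x"
| "fast (Suc n) x = (fast n ^^ x) (Suc x)"

lemma funpow_inflationary:
  fixes f :: "nat \<Rightarrow> nat"
  assumes "\<And>x. x < f x"
  shows "x + k \<le> (f ^^ k) x"
proof (induction k)
  case (Suc k)
  then show ?case
    using assms[of "(f ^^ k) x"] by simp
qed simp

lemma funpow_mono2:
  fixes f :: "nat \<Rightarrow> nat"
  assumes "\<And>x. x \<le> f x" "mono f" "k \<le> l" "x \<le> y"
  shows "(f ^^ k) x \<le> (f ^^ l) y"
proof -
  have infl: "z \<le> (f ^^ m) z" for m z
  proof (induction m)
    case (Suc m)
    then show ?case
      using assms(1)[of "(f ^^ m) z"] by simp
  qed simp
  have "(f ^^ k) x \<le> (f ^^ k) y"
    using assms(2,4) by (simp add: funpow_mono)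
  also have "\<dots> \<le> (f ^^ (l - k)) ((f ^^ k) y)"
    by (rule infl)
  also have "\<dots> = (f ^^ l) y"
    using assms(3) by (metis comp_apply funpow_add le_add_diff_inverse2)
  finally show ?thesis .
qed

lemma fast_gt: "x < fast n x"
proof (induction n arbitrary: x)
  case (Suc n)
  show ?case
    using funpow_inflationary[of "fast n" "Suc x" x, OF Suc.IH] by simp
qed simp

lemma fast_mono: "mono (fast n)"
proof (induction n)
  case (Suc n)
  then show ?case
    by (intro monoI) (simp add: funpow_mono2 fast_gt less_imp_le)
qed (simp add: mono_def)

lemma large_interval: "fast n a \<le> b \<Longrightarrow> large n {a..<b}"
proof (induction n arbitrary: a b)
  case 0
  then show ?case by auto
next
  case (Suc n)
  define p where "p i = (fast n ^^ i) (Suc a)" for i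
  have pmono: "p i \<le> p j" if "i \<le> j" for i j
    unfolding p_def using that by (intro funpow_mono2 fast_mono) (auto intro: less_imp_le fast_gt)
  have p0: "a < p i" for i
    using pmono[of 0 i] by (simp add: p_def)
  have pb: "p i \<le> b" if "i \<le> a" for i
    using pmono[OF that] Suc.prems by (simp add: p_def)
  show ?case
  proof (rule large_SucI)
    show "a \<in> {a..<b}"
      using p0[of 0] pb[of 0] by simp
    show "blocks {a..<b} {..<a} (\<lambda>i. {p i..<p (Suc i)})"
      unfolding blocks_def before_def
    proof (intro conjI ballI impI)
      show "{p i..<p (Suc i)} \<subseteq> {a..<b}" if "i \<in> {..<a}" for i
        using p0[of i] pb[of "Suc i"] that by auto
      show "x < y" if "i < j" "x \<in> {p i..<p (Suc i)}" "y \<in> {p j..<p (Suc j)}" for i j x y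
        using pmono[of "Suc i" j] that by auto
    qed simp
    show "large n {p i..<p (Suc i)}" if "i \<in> {..<a}" for i
      by (rule Suc.IH) (simp add: p_def)
    show "{a} \<lless> {p i..<p (Suc i)}" if "i \<in> {..<a}" for i
      using p0[of i] by (auto simp: before_def)
  qed simp
qed

text \<open>The leader \<open>x\<close> is followed by \<open>x\<close> distinct larger elements,
  while only \<open>x - 1\<close> numbers lie strictly between \<open>x\<close> and
  \<open>2 * x\<close>.\<close>

lemma large_1_double:
  assumes "large 1 X" "\<And>x. x \<in> X \<Longrightarrow> q \<le> x" "0 < q"
  shows "\<exists>y\<in>X. 2 * q \<le> y"
proof -
  have "large (Suc 0) X"
    using assms(1) by simp
  then obtain x J Y where X: "x \<in> X" "blocks X J Y" "card J = x" "\<And>i. i \<in> J \<Longrightarrow> large 0 (Y i)"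
    "\<And>i. i \<in> J \<Longrightarrow> {x} \<lless> Y i"
    using large_SucE by metis
  obtain g where g: "\<And>i. i \<in> J \<Longrightarrow> g i \<in> Y i"
  proof -
    have "\<exists>y. y \<in> Y i" if "i \<in> J" for i
      using X(4)[OF that] by auto
    then show thesis
      using that by metis
  qed
  have "inj_on g J"
  proof (rule linorder_inj_onI)
    show "g i \<noteq> g j" if "i < j" "i \<in> J" "j \<in> J" for i j
    proof -
      have "Y i \<lless> Y j"
        using X(2) that unfolding blocks_def by blast
      then show ?thesis
        using g[OF that(2)] g[OF that(3)] unfolding before_def by (metis less_irrefl)
    qed
  qed auto
  then have card: "card (g ` J) = x"
    using X(3) by (simp add: card_image)
  have "\<exists>i\<in>J. 2 * x \<le> g i"
  proof (rule ccontr)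
    assume "\<not> ?thesis"
    then have "g ` J \<subseteq> {x<..<2 * x}"
    proof (intro image_subsetI)
      fix i assume "i \<in> J"
      then have "x < g i" "g i < 2 * x"
        using g X(5)[of i] \<open>\<not> (\<exists>i\<in>J. 2 * x \<le> g i)\<close> unfolding before_def by auto
      then show "g i \<in> {x<..<2 * x}" by simp
    qed
    then have "card (g ` J) \<le> card {x<..<2 * x}"
      by (intro card_mono) auto
    with card assms(2)[OF X(1)] assms(3) show False by simp
  qed
  then obtain i where i: "i \<in> J" "2 * x \<le> g i" by blast
  then have "g i \<in> X" "2 * q \<le> g i"
    using g[OF i(1)] X(2) assms(2)[OF X(1)] unfolding blocks_def by auto
  then show ?thesis by blast
qed

text \<open>Each block at least doubles what has been reached before, as
  \<open>large_1_double\<close> applies with the last element found as lower bound. The case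
  \<open>y = q\<close> serves the empty family.\<close>

lemma blocks_double:
  assumes "blocks X J Y" "\<And>i. i \<in> J \<Longrightarrow> large 1 (Y i)" "\<And>x. x \<in> X \<Longrightarrow> q \<le> x" "0 < q"
  shows "\<exists>y. (y = q \<or> (\<exists>i\<in>J. y \<in> Y i)) \<and> 2 ^ card J * q \<le> y"
  using assms(1,2)
proof (induction "card J" arbitrary: J)
  case 0
  then show ?case
    by (intro exI[of _ q]) (use 0 in \<open>auto simp: blocks_def\<close>)
next
  case (Suc k)
  have finJ: "finite J"
    using Suc.prems(1) by (simp add: blocks_def)
  then have M: "Max J \<in> J"
    using Suc.hyps(2) by (intro Max_in) auto
  have k: "k = card (J - {Max J})"
    using Suc.hyps(2) M finJ by simp
  have "blocks X (J - {Max J}) Y"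
    by (rule blocks_mono[OF Suc.prems(1)]) auto
  from Suc.hyps(1)[OF k this] obtain y where y: "y = q \<or> (\<exists>i\<in>J - {Max J}. y \<in> Y i)" "2 ^ k * q \<le> y"
    using Suc.prems(2) k by auto
  have le: "y \<le> z" if z: "z \<in> Y (Max J)" for z
    using y(1)
  proof
    assume "y = q"
    then show ?thesis
      using assms(3) z Suc.prems(1) M unfolding blocks_def by blast
  next
    assume "\<exists>i\<in>J - {Max J}. y \<in> Y i"
    then obtain i where i: "i \<in> J" "i \<noteq> Max J" "y \<in> Y i" by blast
    then have "i < Max J"
      using finJ by (meson Max_ge le_neq_implies_less)
    then have "Y i \<lless> Y (Max J)"
      using Suc.prems(1) i(1) M unfolding blocks_def by blast
    then show ?thesis
      using i(3) z unfolding before_def by (simp add: less_imp_le)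
  qed
  have "0 < y"
    using y(2) assms(4) by (metis gr0I le_zero_eq mult_is_0 neq0_conv power_not_zero zero_neq_numeral)
  then obtain z where z: "z \<in> Y (Max J)" "2 * y \<le> z"
    using large_1_double[OF Suc.prems(2)[OF M] le] by blast
  have "2 ^ card J * q \<le> z"
    using y(2) z(2) Suc.hyps(2)[symmetric] by simp
  with z(1) M show ?case by blast
qed

text \<open>The leader \<open>x\<close> is at least \<open>q\<close>, and its \<open>x\<close>
  blocks double it \<open>x\<close> times.\<close>

lemma large_2_exp:
  assumes "large 2 X" "\<And>x. x \<in> X \<Longrightarrow> q \<le> x" "0 < q"
  shows "\<exists>y\<in>X. 2 ^ q \<le> y"
proof -
  have "large (Suc 1) X"
    using assms(1) by (simp del: large.simps add: numeral_2_eq_2)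
  then obtain x J Y where X: "x \<in> X" "blocks X J Y" "card J = x" "\<And>i. i \<in> J \<Longrightarrow> large 1 (Y i)"
    "\<And>i. i \<in> J \<Longrightarrow> {x} \<lless> Y i"
    using large_SucE by metis
  have bl: "blocks (\<Union>i\<in>J. Y i) J Y"
    using X(2) unfolding blocks_def by blast
  have x: "q \<le> x" "0 < x"
    using assms(2)[OF X(1)] assms(3) by auto
  have "\<exists>y. (y = x \<or> (\<exists>i\<in>J. y \<in> Y i)) \<and> 2 ^ card J * x \<le> y"
  proof (rule blocks_double[OF bl X(4) _ x(2)])
    show "x \<le> y" if "y \<in> (\<Union>i\<in>J. Y i)" for y
      using X(5) that unfolding before_def by (metis UN_E insertI1 less_imp_le)
  qed
  then obtain y where y: "y = x \<or> (\<exists>i\<in>J. y \<in> Y i)" "2 ^ card J * x \<le> y"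
    by blast
  have "y \<in> X"
    using y(1) X(1,2) unfolding blocks_def by blast
  moreover have "(2 ^ q :: nat) \<le> 2 ^ card J * x"
    using x X(3) by (metis One_nat_def Suc_leI mult.right_neutral mult_le_mono one_le_numeral power_increasing)
  ultimately show ?thesis
    using y(2) le_trans by blast
qed

lemma two_elements:
  fixes J :: "nat set"
  assumes "2 \<le> card J"
  obtains i j where "i \<in> J" "j \<in> J" "i < j"
proof -
  obtain K where K: "K \<subseteq> J" "card K = 2"
    by (rule obtain_subset_with_card_n[OF assms])
  then obtain x y where "K = {x, y}" "x \<noteq> y"
    by (auto simp: card_2_iff)
  with K(1) have "x \<in> J" "y \<in> J" "x < y \<or> y < x"
    by auto
  with that show thesis
    by blast
qed

text \<open>Trades one level for an exponential jump: the earlier of two blocks contains a number at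
  or above \<open>2 ^ q\<close> by \<open>large_2_exp\<close>, and the later block lies entirely
  beyond it. The level kept is at least 2 so that the earlier block is \<open>large 2\<close>; the
  bound \<open>2 \<le> q\<close> provides two blocks.\<close>

lemma large_pass:
  assumes "large (Suc (Suc (Suc n))) X" "\<And>x. x \<in> X \<Longrightarrow> q \<le> x" "2 \<le> q"
  shows "\<exists>Y\<subseteq>X. large (Suc (Suc n)) Y \<and> (\<forall>y\<in>Y. 2 ^ q < y)"
proof -
  obtain x J Y where X: "x \<in> X" "blocks X J Y" "card J = x" "\<And>i. i \<in> J \<Longrightarrow> large (Suc (Suc n)) (Y i)"
    "\<And>i. i \<in> J \<Longrightarrow> {x} \<lless> Y i"
    using large_SucE[OF assms(1)] by metis
  have finJ: "finite J"
    using X(2) by (simp add: blocks_def)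
  have "2 \<le> card J"
    using assms(2)[OF X(1)] assms(3) X(3) by simp
  then obtain i j where ij: "i \<in> J" "j \<in> J" "i < j"
    using two_elements by blast
  have "large 2 (Y i)"
    using X(4)[OF ij(1)] by (rule large_le) simp
  then obtain y where y: "y \<in> Y i" "2 ^ q \<le> y"
  proof -
    have "q \<le> x" if "x \<in> Y i" for x
      using X(2) ij(1) that by (intro assms(2)) (auto simp: blocks_def)
    then show thesis
      using large_2_exp[OF \<open>large 2 (Y i)\<close>, of q] assms(3) that by auto
  qed
  have "2 ^ q < z" if "z \<in> Y j" for z
  proof -
    have "Y i \<lless> Y j"
      using X(2) ij unfolding blocks_def by blast
    then show ?thesis
      using y that unfolding before_def by (meson le_less_trans)
  qed
  moreover have "Y j \<subseteq> X"
    using X(2) ij(2) by (auto simp: blocks_def)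
  ultimately show ?thesis
    using X(4)[OF ij(2)] by blast
qed

section \<open>Ramsey's theorem for large sets\<close>

text \<open>An intermediate form of homogeneity that suits an induction on both colours: only pairs
  from different blocks of one family are controlled, and the element \<open>x\<close> merely counts
  the blocks.\<close>

primrec cs :: "(nat \<Rightarrow> nat \<Rightarrow> bool) \<Rightarrow> bool \<Rightarrow> nat \<Rightarrow> nat set \<Rightarrow> bool" where
  "cs f c 0 X \<longleftrightarrow> X \<noteq> {}"
| "cs f c (Suc n) X \<longleftrightarrow> (\<exists>x\<in>X. \<exists>J Y. blocks X J Y \<and> x \<le> card J \<and> (\<forall>i\<in>J. cs f c n (Y i)) \<and>
     (\<forall>i\<in>J. \<forall>j\<in>J. i < j \<longrightarrow> (\<forall>a\<in>Y i. \<forall>b\<in>Y j. f a b = c)))"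

lemma cs_SucE:
  assumes "cs f c (Suc n) X"
  obtains x J Y where "x \<in> X" "blocks X J Y" "x \<le> card J" "\<And>i. i \<in> J \<Longrightarrow> cs f c n (Y i)"
    "\<And>i j a b. i \<in> J \<Longrightarrow> j \<in> J \<Longrightarrow> i < j \<Longrightarrow> a \<in> Y i \<Longrightarrow> b \<in> Y j \<Longrightarrow> f a b = c"
proof -
  from assms obtain x J Y where *: "x \<in> X" "blocks X J Y" "x \<le> card J" "\<forall>i\<in>J. cs f c n (Y i)"
    "\<forall>i\<in>J. \<forall>j\<in>J. i < j \<longrightarrow> (\<forall>a\<in>Y i. \<forall>b\<in>Y j. f a b = c)"
    by auto
  show thesis
    by (rule that[OF *(1-3)]) (use *(4,5) in simp_all)
qed

lemma cs_mono: "cs f c n X \<Longrightarrow> X \<subseteq> X' \<Longrightarrow> cs f c n X'"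
proof (cases n)
  case (Suc m)
  assume "cs f c n X" "X \<subseteq> X'"
  then obtain x J Y where "x \<in> X" "blocks X J Y" "x \<le> card J" "\<forall>i\<in>J. cs f c m (Y i)"
    "\<forall>i\<in>J. \<forall>j\<in>J. i < j \<longrightarrow> (\<forall>a\<in>Y i. \<forall>b\<in>Y j. f a b = c)"
    using Suc by auto
  moreover have "x \<in> X'" "blocks X' J Y"
    using calculation(1,2) \<open>X \<subseteq> X'\<close> blocks_superset by auto
  ultimately show ?thesis
    unfolding Suc cs.simps(2) by blast
qed auto

lemma cs_nonempty: "cs f c n X \<Longrightarrow> X \<noteq> {}"
  by (cases n) auto

text \<open>Two levels yield one. Any element \<open>y\<close> of an earlier block has colour
  \<open>c\<close> with all of a later block, so it can lead; the later block supplies more than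
  \<open>y\<close> subblocks, which are thinned by induction.\<close>

lemma cs_large:
  assumes "cs f c (2 * n) X" "\<And>x. x \<in> X \<Longrightarrow> 2 \<le> x"
  shows "\<exists>Y\<subseteq>X. large n Y \<and> (\<forall>a\<in>Y. \<forall>b\<in>Y. a < b \<longrightarrow> f a b = c)"
  using assms
proof (induction n arbitrary: X)
  case 0
  then obtain x where "x \<in> X" by auto
  then show ?case
    by (intro exI[of _ "{x}"]) auto
next
  case (Suc n)
  have "cs f c (Suc (Suc (2 * n))) X"
    using Suc.prems(1) by simp
  then obtain x J Y where X: "x \<in> X" "blocks X J Y" "x \<le> card J" "\<And>i. i \<in> J \<Longrightarrow> cs f c (Suc (2 * n)) (Y i)"
    "\<And>i j a b. i \<in> J \<Longrightarrow> j \<in> J \<Longrightarrow> i < j \<Longrightarrow> a \<in> Y i \<Longrightarrow> b \<in> Y j \<Longrightarrow> f a b = c"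
    by (rule cs_SucE) simp
  have finJ: "finite J"
    using X(2) by (simp add: blocks_def)
  have "2 \<le> card J"
    using Suc.prems(2)[OF X(1)] X(3) by simp
  then obtain i j where ij: "i \<in> J" "j \<in> J" "i < j"
    using two_elements by blast
  have bef: "Y i \<lless> Y j" and sub: "Y i \<subseteq> X" "Y j \<subseteq> X"
    using X(2) ij unfolding blocks_def by blast+
  obtain y where y: "y \<in> Y i"
    using cs_nonempty[OF X(4)[OF ij(1)]] by blast
  obtain w K Z where W: "w \<in> Y j" "blocks (Y j) K Z" "w \<le> card K" "\<And>i. i \<in> K \<Longrightarrow> cs f c (2 * n) (Z i)"
    "\<And>i j a b. i \<in> K \<Longrightarrow> j \<in> K \<Longrightarrow> i < j \<Longrightarrow> a \<in> Z i \<Longrightarrow> b \<in> Z j \<Longrightarrow> f a b = c"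
    by (rule cs_SucE[OF X(4)[OF ij(2)]]) simp
  have ZX: "Z k \<subseteq> Y j" if "k \<in> K" for k
    using W(2) that unfolding blocks_def by blast
  have "\<exists>V. V \<subseteq> Z k \<and> large n V \<and> (\<forall>a\<in>V. \<forall>b\<in>V. a < b \<longrightarrow> f a b = c)" if "k \<in> K" for k
    using Suc.IH[OF W(4)[OF that]] ZX[OF that] sub Suc.prems(2) by blast
  then obtain V where V: "\<And>k. k \<in> K \<Longrightarrow> V k \<subseteq> Z k" "\<And>k. k \<in> K \<Longrightarrow> large n (V k)"
    "\<And>k a b. k \<in> K \<Longrightarrow> a \<in> V k \<Longrightarrow> b \<in> V k \<Longrightarrow> a < b \<Longrightarrow> f a b = c"
    by metis
  let ?W = "insert y (\<Union>k\<in>K. V k)"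
  have VY: "V k \<subseteq> Y j" if "k \<in> K" for k
    using V(1)[OF that] ZX[OF that] by blast
  have yV: "y < v" if "k \<in> K" "v \<in> V k" for k v
    using VY[OF that(1)] that(2) y bef unfolding before_def by blast
  have blV: "blocks (Y j) K V"
    by (rule blocks_mono[OF W(2)]) (use V(1) in auto)
  have "large (Suc n) ?W"
  proof (rule large_SucI)
    show "blocks ?W K V"
      using blV unfolding blocks_def by blast
    show "y \<le> card K"
      using W(1,3) y bef unfolding before_def by (meson le_trans less_imp_le)
    show "{y} \<lless> V k" if "k \<in> K" for k
      using yV that by (auto simp: before_def)
  qed (use V(2) in auto)
  moreover have "?W \<subseteq> X"
    using y sub VY by blast
  moreover have "f a b = c" if ab: "a \<in> ?W" "b \<in> ?W" "a < b" for a b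
  proof (cases "a = y")
    case True
    with ab obtain k where "k \<in> K" "b \<in> V k" by auto
    then show ?thesis
      using X(5)[OF ij y, of b] VY True by blast
  next
    case False
    with ab(1) obtain k where k: "k \<in> K" "a \<in> V k" by auto
    with ab yV have "b \<noteq> y"
      by (metis less_asym)
    with ab(2) obtain l where l: "l \<in> K" "b \<in> V l" by auto
    have "k \<le> l"
    proof (rule ccontr)
      assume "\<not> k \<le> l"
      then have "V l \<lless> V k"
        using blV k l unfolding blocks_def by auto
      with k l ab(3) show False
        unfolding before_def by (meson less_asym)
    qed
    then show ?thesis
      using V(3)[OF k(1,2)] W(5)[OF k(1) l(1)] V(1) k l ab(3) by (metis le_neq_implies_less subsetD)
  qed
  ultimately show ?case by blast
qed

text \<open>The Erdos-Szekeres argument: the least vertex splits the others by colour, and one part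
  has at least half of the bound. The explicit bound fixes the number \<open>2 ^ (x + x)\<close> of
  groups in \<open>grouping\<close>.\<close>

lemma ramsey_pairs:
  fixes g :: "nat \<Rightarrow> nat \<Rightarrow> bool"
  assumes "finite V" "2 ^ (a + b) \<le> card V"
  shows "\<exists>H\<subseteq>V. (a \<le> card H \<and> (\<forall>i\<in>H. \<forall>j\<in>H. i < j \<longrightarrow> g i j)) \<or>
    (b \<le> card H \<and> (\<forall>i\<in>H. \<forall>j\<in>H. i < j \<longrightarrow> \<not> g i j))"
  using assms
proof (induction "a + b" arbitrary: a b V)
  case 0
  then show ?case by auto
next
  case (Suc n)
  show ?case
  proof (cases "a = 0 \<or> b = 0")
    case True
    then show ?thesis by (intro exI[of _ "{}"]) auto
  next
    case False
    then obtain a' b' where ab: "a = Suc a'" "b = Suc b'"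
      by (meson not0_implies_Suc)
    have "V \<noteq> {}"
      using Suc.prems(2) by auto
    define v where "v = Min V"
    have v: "v \<in> V" "\<And>w. w \<in> V \<Longrightarrow> v \<le> w"
      using Suc.prems(1) \<open>V \<noteq> {}\<close> by (auto simp: v_def)
    define R where "R = {w\<in>V - {v}. g v w}"
    define B where "B = {w\<in>V - {v}. \<not> g v w}"
    have fin: "finite R" "finite B"
      using Suc.prems(1) by (auto simp: R_def B_def)
    have "V = insert v (R \<union> B)" "v \<notin> R \<union> B" "R \<inter> B = {}"
      using v(1) by (auto simp: R_def B_def)
    then have "card V = Suc (card R + card B)"
      using fin by (simp add: card_Un_disjoint)
    moreover have "2 ^ Suc n \<le> card V"
      using Suc.prems(2) Suc.hyps(2) by simp
    ultimately have "2 ^ n \<le> card R \<or> 2 ^ n \<le> card B"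
      by auto
    then show ?thesis
    proof
      assume R: "2 ^ n \<le> card R"
      have "n = a' + b"
        using Suc.hyps(2) ab by simp
      from Suc.hyps(1)[OF this fin(1)] R this obtain H where H: "H \<subseteq> R"
        "(a' \<le> card H \<and> (\<forall>i\<in>H. \<forall>j\<in>H. i < j \<longrightarrow> g i j)) \<or>
         (b \<le> card H \<and> (\<forall>i\<in>H. \<forall>j\<in>H. i < j \<longrightarrow> \<not> g i j))"
        by auto
      show ?thesis
      proof (cases "b \<le> card H \<and> (\<forall>i\<in>H. \<forall>j\<in>H. i < j \<longrightarrow> \<not> g i j)")
        case True
        with H(1) show ?thesis
          by (intro exI[of _ H]) (auto simp: R_def)
      next
        case False
        have "v \<notin> H" "finite H"
          using H(1) fin(1) by (auto simp: R_def intro: finite_subset)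
        moreover have A: "a' \<le> card H" "\<And>i j. i \<in> H \<Longrightarrow> j \<in> H \<Longrightarrow> i < j \<Longrightarrow> g i j"
          using H(2) False by blast+
        ultimately have "a \<le> card (insert v H)"
          using ab by simp
        moreover have "g i j" if "i \<in> insert v H" "j \<in> insert v H" "i < j" for i j
        proof -
          have "v \<le> i" "H \<subseteq> V - {v}" "\<And>w. w \<in> H \<Longrightarrow> g v w"
            using that(1) H(1) v(2) by (auto simp: R_def)
          with that A(2) v(2) show ?thesis
            by (metis insert_iff leD)
        qed
        ultimately show ?thesis
          using H(1) v(1) by (intro exI[of _ "insert v H"]) (auto simp: R_def)
      qed
    next
      assume B: "2 ^ n \<le> card B"
      have "n = a + b'"
        using Suc.hyps(2) ab by simp
      from Suc.hyps(1)[OF this fin(2)] B this obtain H where H: "H \<subseteq> B"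
        "(a \<le> card H \<and> (\<forall>i\<in>H. \<forall>j\<in>H. i < j \<longrightarrow> g i j)) \<or>
         (b' \<le> card H \<and> (\<forall>i\<in>H. \<forall>j\<in>H. i < j \<longrightarrow> \<not> g i j))"
        by auto
      show ?thesis
      proof (cases "a \<le> card H \<and> (\<forall>i\<in>H. \<forall>j\<in>H. i < j \<longrightarrow> g i j)")
        case True
        with H(1) show ?thesis
          by (intro exI[of _ H]) (auto simp: B_def)
      next
        case False
        have "v \<notin> H" "finite H"
          using H(1) fin(2) by (auto simp: B_def intro: finite_subset)
        moreover have A: "b' \<le> card H" "\<And>i j. i \<in> H \<Longrightarrow> j \<in> H \<Longrightarrow> i < j \<Longrightarrow> \<not> g i j"
          using H(2) False by blast+
        ultimately have "b \<le> card (insert v H)"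
          using ab by simp
        moreover have "\<not> g i j" if "i \<in> insert v H" "j \<in> insert v H" "i < j" for i j
        proof -
          have "v \<le> i" "H \<subseteq> V - {v}" "\<And>w. w \<in> H \<Longrightarrow> \<not> g v w"
            using that(1) H(1) v(2) by (auto simp: B_def)
          with that A(2) v(2) show ?thesis
            by (metis insert_iff leD)
        qed
        ultimately show ?thesis
          using H(1) v(1) by (intro exI[of _ "insert v H"]) (auto simp: B_def)
      qed
    qed
  qed
qed

text \<open>Three exponentials are what \<open>grouping\<close> needs: the number
  \<open>R = 2 ^ (x + x)\<close> of groups is at most \<open>2 ^ 2 ^ x\<close>, so all elements get
  above the number \<open>2 ^ R\<close> of sets of groups.\<close>

lemma large_pass_3:
  assumes "large (n + 5) X" "\<And>x. x \<in> X \<Longrightarrow> q \<le> x" "2 \<le> q"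
  shows "\<exists>Y\<subseteq>X. large (n + 2) Y \<and> (\<forall>y\<in>Y. 2 ^ 2 ^ 2 ^ q < y)"
proof -
  have ge: "2 \<le> (2::nat) ^ r" if "2 \<le> r" for r
    using that by (metis le_trans less_exp less_imp_le)
  have "large (Suc (Suc (Suc (n + 2)))) X"
    using assms(1) by (simp del: large.simps add: eval_nat_numeral)
  from large_pass[OF this assms(2,3)]
  obtain Y1 where Y1: "Y1 \<subseteq> X" "large (Suc (Suc (n + 2))) Y1" "\<And>y. y \<in> Y1 \<Longrightarrow> 2 ^ q \<le> y"
    by (metis less_imp_le)
  have "large (Suc (Suc (Suc (n + 1)))) Y1"
    using Y1(2) by (simp del: large.simps add: eval_nat_numeral)
  from large_pass[OF this Y1(3) ge[OF assms(3)]]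
  obtain Y2 where Y2: "Y2 \<subseteq> Y1" "large (Suc (Suc (n + 1))) Y2" "\<And>y. y \<in> Y2 \<Longrightarrow> 2 ^ 2 ^ q \<le> y"
    by (metis less_imp_le)
  have "large (Suc (Suc (Suc n))) Y2"
    using Y2(2) by (simp del: large.simps add: eval_nat_numeral)
  from large_pass[OF this Y2(3) ge[OF ge[OF assms(3)]]]
  obtain Y3 where Y3: "Y3 \<subseteq> Y2" "large (Suc (Suc n)) Y3" "\<forall>y\<in>Y3. 2 ^ 2 ^ 2 ^ q < y"
    by blast
  have "Y3 \<subseteq> X" "large (n + 2) Y3"
    using Y1(1) Y2(1) Y3(1,2) by (simp_all del: large.simps)
  with Y3(3) show ?thesis
    by blast
qed

text \<open>A colour that is a set records how an element is related to all members of
  \<open>A\<close> at once.\<close>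

lemma large_pigeonhole_Pow:
  assumes "large (3 * n) X" "c ` X \<subseteq> Pow A" "finite A" "\<And>x. x \<in> X \<Longrightarrow> 2 ^ card A < x"
  shows "\<exists>Y d. Y \<subseteq> X \<and> large n Y \<and> (\<forall>y\<in>Y. c y = d)"
proof -
  have fin: "finite (c ` X)"
    using assms(2,3) by (meson finite_Pow_iff finite_subset)
  have "card (c ` X) \<le> 2 ^ card A"
    using assms(2,3) by (metis card_Pow card_mono finite_Pow_iff)
  then have "card (c ` X) < x" if "x \<in> X" for x
    using assms(4)[OF that] by simp
  from large_pigeonhole[OF assms(1) fin this] show ?thesis
    by (metis imageI singletonD)
qed

text \<open>
  First each block is thinned so that its elements look the same from all earlier elements:
  the earlier elements are few compared with the block. Then it is thinned so that its
  elements see the same colours on all later blocks, of which there are few as well.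
\<close>

lemma grouping:
  fixes f :: "nat \<Rightarrow> nat \<Rightarrow> bool"
  assumes "large (9 * M + 8) X" "\<And>x. x \<in> X \<Longrightarrow> 2 \<le> x"
  obtains x J Y where "x \<in> X" "blocks X J Y" "card J = 2 ^ (x + x)" "\<And>i. i \<in> J \<Longrightarrow> large M (Y i)"
    "\<And>i j. i \<in> J \<Longrightarrow> j \<in> J \<Longrightarrow> i < j \<Longrightarrow> \<exists>c. \<forall>a\<in>Y i. \<forall>b\<in>Y j. f a b = c"
proof -
  \<comment> \<open>The two pigeonholes account for \<open>9 * M\<close>. Of the other 8 levels one
    gives \<open>x\<close>, three go to \<open>large_pass_3\<close>, one gives the family of groups
    and one pays a further pass, which leaves two levels unspent.\<close>
  have "large (Suc ((9 * M + 2) + 5)) X"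
    using assms(1) by (simp del: large.simps add: eval_nat_numeral)
  then obtain x J0 Y0 where X: "x \<in> X" "blocks X J0 Y0" "card J0 = x" "\<And>i. i \<in> J0 \<Longrightarrow> large ((9 * M + 2) + 5) (Y0 i)"
    "\<And>i. i \<in> J0 \<Longrightarrow> {x} \<lless> Y0 i"
    using large_SucE by metis
  have x2: "2 \<le> x"
    using assms(2) X(1) by blast
  then have "J0 \<noteq> {}"
    using X(3) by auto
  then obtain i0 where i0: "i0 \<in> J0" by blast
  have xle: "x \<le> y" if "y \<in> Y0 i0" for y
    using X(5)[OF i0] that by (auto simp: before_def)
  obtain V where V: "V \<subseteq> Y0 i0" "large ((9 * M + 2) + 2) V" "\<And>y. y \<in> V \<Longrightarrow> 2 ^ 2 ^ 2 ^ x < y"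
    using large_pass_3[OF X(4)[OF i0] xle x2] by blast
  have VX: "V \<subseteq> X"
    using V(1) X(2) i0 unfolding blocks_def by blast
  define R where "R = (2::nat) ^ (x + x)"
  have RV: "2 ^ R < y" "R < y" if "y \<in> V" for y
  proof -
    have "x + x \<le> 2 ^ x"
      using x2 by (induction x rule: dec_induct) auto
    then have "R \<le> 2 ^ 2 ^ x"
      unfolding R_def by (intro power_increasing) auto
    then have "(2::nat) ^ R \<le> 2 ^ 2 ^ 2 ^ x"
      by (intro power_increasing) auto
    then show "2 ^ R < y" "R < y"
      using V(3)[OF that] less_exp[of R] by linarith+
  qed
  have "large (Suc (9 * M + 3)) V"
    using V(2) by (simp del: large.simps add: eval_nat_numeral)
  then obtain w J1 Y1 where W: "w \<in> V" "blocks V J1 Y1" "card J1 = w" "\<And>i. i \<in> J1 \<Longrightarrow> large (9 * M + 3) (Y1 i)"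
    using large_SucE by metis
  obtain J where J: "J \<subseteq> J1" "card J = R"
    using obtain_subset_with_card_n[of R J1] RV(2)[OF W(1)] W(3) by auto
  have bl1: "blocks V J Y1"
    by (rule blocks_mono[OF W(2) J(1)]) simp
  have finJ: "finite J"
    using bl1 by (simp add: blocks_def)
  define q where "q i = (LEAST y. y \<in> Y1 i)" for i
  have qY: "q i \<in> Y1 i" if "i \<in> J" for i
    unfolding q_def using large_nonempty[OF W(4)] J(1) that by (metis LeastI ex_in_conv subsetD)
  have q: "q i \<le> y" if "y \<in> Y1 i" for i y
    unfolding q_def using that by (rule Least_le)
  \<comment> \<open>Elements of earlier groups lie below \<open>q i\<close>, so at most
    \<open>2 ^ q i\<close> profiles over them are possible; the pass puts the whole group above that
    number.\<close>
  have "\<exists>Y. Y \<subseteq> Y1 i \<and> large (9 * M) Y \<and> (\<forall>y\<in>Y. 2 ^ q i < y)" if "i \<in> J" for i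
  proof -
    have "large (Suc (Suc (Suc (9 * M)))) (Y1 i)"
      using W(4)[of i] J(1) that by (simp del: large.simps add: eval_nat_numeral subsetD)
    moreover have "2 \<le> q i"
      using qY[OF that] bl1 that VX assms(2) unfolding blocks_def by blast
    ultimately obtain Y where "Y \<subseteq> Y1 i" "large (Suc (Suc (9 * M))) Y" "\<forall>y\<in>Y. 2 ^ q i < y"
      using large_pass[of "9 * M" "Y1 i" "q i"] q by blast
    then show ?thesis
      using large_le[of "Suc (Suc (9 * M))" Y "9 * M"] by auto
  qed
  then obtain Y2 where Y2: "\<And>i. i \<in> J \<Longrightarrow> Y2 i \<subseteq> Y1 i" "\<And>i. i \<in> J \<Longrightarrow> large (9 * M) (Y2 i)"
    "\<And>i y. i \<in> J \<Longrightarrow> y \<in> Y2 i \<Longrightarrow> 2 ^ q i < y"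
    by metis
  \<comment> \<open>The profile of \<open>b\<close> over the elements of earlier groups. The
    pigeonhole makes it constant on each group.\<close>
  define c1 where "c1 j b = {a. \<exists>i\<in>J. i < j \<and> a \<in> Y1 i \<and> f a b}" for j b
  have "\<exists>Y d. Y \<subseteq> Y2 j \<and> large (3 * M) Y \<and> (\<forall>b\<in>Y. c1 j b = d)" if j: "j \<in> J" for j
  proof -
    have "large (3 * (3 * M)) (Y2 j)"
      using Y2(2)[OF j] by (simp del: large.simps)
    moreover have "c1 j ` Y2 j \<subseteq> Pow {..<q j}"
    proof (clarsimp simp: c1_def)
      fix a i assume "i \<in> J" "i < j" "a \<in> Y1 i"
      then show "a < q j"
        using bl1 j qY[OF j] unfolding blocks_def before_def by blast
    qed
    moreover have "2 ^ card {..<q j} < y" if "y \<in> Y2 j" for y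
      using Y2(3)[OF j that] by simp
    ultimately show ?thesis
      using large_pigeonhole_Pow[of "3 * M" "Y2 j" "c1 j" "{..<q j}"] by (metis finite_lessThan)
  qed
  then obtain Y3 d1 where Y3: "\<And>j. j \<in> J \<Longrightarrow> Y3 j \<subseteq> Y2 j" "\<And>j. j \<in> J \<Longrightarrow> large (3 * M) (Y3 j)"
    "\<And>j b. j \<in> J \<Longrightarrow> b \<in> Y3 j \<Longrightarrow> c1 j b = d1 j"
    by metis
  \<comment> \<open>The colour of \<open>a\<close> and \<open>b\<close> now depends on
    \<open>b\<close> only through its group, so an element \<open>a\<close> of group
    \<open>i\<close> is described by a set of later groups.\<close>
  define c2 where "c2 i a = {j\<in>J. i < j \<and> a \<in> d1 j}" for i a
  have Y3V: "Y3 i \<subseteq> V" if "i \<in> J" for i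
    using Y3(1)[OF that] Y2(1)[OF that] bl1 that unfolding blocks_def by blast
  have "\<exists>Y d. Y \<subseteq> Y3 i \<and> large M Y \<and> (\<forall>a\<in>Y. c2 i a = d)" if i: "i \<in> J" for i
  proof -
    have "c2 i ` Y3 i \<subseteq> Pow J"
      by (auto simp: c2_def)
    moreover have "2 ^ card J < y" if "y \<in> Y3 i" for y
      using RV(1)[of y] Y3V[OF i] that J(2) by auto
    ultimately show ?thesis
      using large_pigeonhole_Pow[OF Y3(2)[OF i] _ finJ, of "c2 i"] by metis
  qed
  then obtain Y d2 where Y: "\<And>j. j \<in> J \<Longrightarrow> Y j \<subseteq> Y3 j" "\<And>j. j \<in> J \<Longrightarrow> large M (Y j)"
    "\<And>j b. j \<in> J \<Longrightarrow> b \<in> Y j \<Longrightarrow> c2 j b = d2 j"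
    by metis
  have YY1: "Y i \<subseteq> Y1 i" if "i \<in> J" for i
    using Y(1) Y3(1) Y2(1) that by blast
  show thesis
  proof (rule that[of x J Y])
    show "blocks X J Y"
      by (rule blocks_superset[OF blocks_mono[OF bl1 subset_refl YY1] VX])
    show "\<exists>c. \<forall>a\<in>Y i. \<forall>b\<in>Y j. f a b = c" if ij: "i \<in> J" "j \<in> J" "i < j" for i j
    proof (intro exI ballI)
      fix a b assume a: "a \<in> Y i" and b: "b \<in> Y j"
      have uniq: "i' = i" if "i' \<in> J" "a \<in> Y1 i'" for i'
      proof (rule ccontr)
        assume "i' \<noteq> i"
        then consider "i' < i" | "i < i'" by linarith
        then show False
          using bl1 that ij(1) a YY1[OF ij(1)] unfolding blocks_def before_def
          by cases (metis less_irrefl subsetD)+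
      qed
      have "f a b \<longleftrightarrow> a \<in> c1 j b"
        using ij a YY1 uniq by (auto simp: c1_def)
      also have "\<dots> \<longleftrightarrow> a \<in> d1 j"
        using Y3(3)[OF ij(2)] b Y(1)[OF ij(2)] by blast
      also have "\<dots> \<longleftrightarrow> j \<in> c2 i a"
        using ij by (simp add: c2_def)
      finally show "f a b = (j \<in> d2 i)"
        using Y(3)[OF ij(1) a] by simp
    qed
  qed (use X(1) J(2) R_def Y(2) in auto)
qed

text \<open>If \<open>X\<close> has neither structure then no group has one, so by induction each
  group has both of the next smaller structures. The finite Ramsey theorem selects \<open>x\<close>
  groups with a single colour between them, and either colour completes a structure on
  \<open>X\<close>.\<close>

lemma ramsey_structured:
  "\<exists>N. \<forall>X f. (\<forall>x\<in>X. 2 \<le> x) \<longrightarrow> large N X \<longrightarrow> cs f True s X \<or> cs f False t X"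
proof (induction "s + t" arbitrary: s t)
  case 0
  then show ?case
    by (intro exI[of _ 0]) simp
next
  case (Suc k)
  show ?case
  proof (cases "s = 0 \<or> t = 0")
    case True
    then show ?thesis
      by (intro exI[of _ 0]) auto
  next
    case False
    then obtain s' t' where st: "s = Suc s'" "t = Suc t'"
      by (meson not0_implies_Suc)
    have "k = s' + t" "k = s + t'"
      using Suc.hyps(2) st by auto
    with Suc.hyps(1) obtain N1 N2 where
      N1: "\<And>X f. \<forall>x\<in>X. 2 \<le> x \<Longrightarrow> large N1 X \<Longrightarrow> cs f True s' X \<or> cs f False t X" and
      N2: "\<And>X f. \<forall>x\<in>X. 2 \<le> x \<Longrightarrow> large N2 X \<Longrightarrow> cs f True s X \<or> cs f False t' X"
      by metis
    define M where "M = max N1 N2"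
    have "cs f True s X \<or> cs f False t X" if X: "\<forall>x\<in>X. 2 \<le> x" "large (9 * M + 8) X" for X f
    proof (rule ccontr)
      assume neg: "\<not> ?thesis"
      obtain x J Y where Y: "x \<in> X" "blocks X J Y" "card J = 2 ^ (x + x)" "\<And>i. i \<in> J \<Longrightarrow> large M (Y i)"
        "\<And>i j. i \<in> J \<Longrightarrow> j \<in> J \<Longrightarrow> i < j \<Longrightarrow> \<exists>c. \<forall>a\<in>Y i. \<forall>b\<in>Y j. f a b = c"
      proof (rule grouping[OF X(2), of f])
        show "2 \<le> x" if "x \<in> X" for x
          using X(1) that by blast
      qed (rule that)
      have YX: "Y i \<subseteq> X" if "i \<in> J" for i
        using Y(2) that unfolding blocks_def by blast
      have st': "cs f True s' (Y i)" "cs f False t' (Y i)" if "i \<in> J" for i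
      proof -
        have "\<forall>x\<in>Y i. 2 \<le> x" "large N1 (Y i)" "large N2 (Y i)"
          using YX[OF that] X(1) Y(4)[OF that] by (auto simp: M_def intro: large_le)
        moreover have "\<not> cs f True s (Y i)" "\<not> cs f False t (Y i)"
          using neg cs_mono[OF _ YX[OF that]] by auto
        ultimately show "cs f True s' (Y i)" "cs f False t' (Y i)"
          using N1[of "Y i" f] N2[of "Y i" f] by auto
      qed
      define g where "g i j = (SOME c. \<forall>a\<in>Y i. \<forall>b\<in>Y j. f a b = c)" for i j
      have g: "f a b = g i j" if "i \<in> J" "j \<in> J" "i < j" "a \<in> Y i" "b \<in> Y j" for i j a b
        using someI_ex[OF Y(5)[OF that(1-3)]] that(4,5) unfolding g_def by blast
      have "finite J" "2 ^ (x + x) \<le> card J"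
        using Y(2,3) by (auto simp: blocks_def)
      then obtain H where H: "H \<subseteq> J" "x \<le> card H"
        "(\<forall>i\<in>H. \<forall>j\<in>H. i < j \<longrightarrow> g i j) \<or> (\<forall>i\<in>H. \<forall>j\<in>H. i < j \<longrightarrow> \<not> g i j)"
        using ramsey_pairs[of J x x g] by blast
      have bl: "blocks X H Y"
        by (rule blocks_mono[OF Y(2) H(1)]) simp
      from H(3) show False
      proof
        assume gH: "\<forall>i\<in>H. \<forall>j\<in>H. i < j \<longrightarrow> g i j"
        have "\<forall>i\<in>H. \<forall>j\<in>H. i < j \<longrightarrow> (\<forall>a\<in>Y i. \<forall>b\<in>Y j. f a b = True)"
          using g gH H(1) by (metis subsetD)
        then have "cs f True s X"
          unfolding st(1) cs.simps
          by (intro bexI[of _ x] exI[of _ H] exI[of _ Y] conjI) (use Y(1) bl H(1,2) st'(1) in auto)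
        with neg show False by simp
      next
        assume gH: "\<forall>i\<in>H. \<forall>j\<in>H. i < j \<longrightarrow> \<not> g i j"
        have "\<forall>i\<in>H. \<forall>j\<in>H. i < j \<longrightarrow> (\<forall>a\<in>Y i. \<forall>b\<in>Y j. f a b = False)"
          using g gH H(1) by (metis subsetD)
        then have "cs f False t X"
          unfolding st(2) cs.simps
          by (intro bexI[of _ x] exI[of _ H] exI[of _ Y] conjI) (use Y(1) bl H(1,2) st'(2) in auto)
        with neg show False by simp
      qed
    qed
    then show ?thesis by blast
  qed
qed

definition homogeneous :: "(nat \<Rightarrow> nat \<Rightarrow> bool) \<Rightarrow> nat set \<Rightarrow> bool" where
  "homogeneous f X \<longleftrightarrow> (\<exists>c. \<forall>a\<in>X. \<forall>b\<in>X. a < b \<longrightarrow> f a b = c)"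

lemma ramsey_large:
  "\<exists>N. \<forall>X f. (\<forall>x\<in>X. 2 \<le> x) \<longrightarrow> large N X \<longrightarrow> (\<exists>Y\<subseteq>X. large n Y \<and> homogeneous f Y)"
proof -
  obtain N where N: "\<And>X f. \<forall>x\<in>X. 2 \<le> x \<Longrightarrow> large N X \<Longrightarrow> cs f True (2 * n) X \<or> cs f False (2 * n) X"
    using ramsey_structured by metis
  show ?thesis
  proof (intro exI[of _ N] allI impI)
    fix X f assume X: "\<forall>x\<in>X. 2 \<le> x" "large N X"
    obtain c where "cs f c (2 * n) X"
      using N[OF X, of f] by blast
    then obtain Y where "Y \<subseteq> X" "large n Y" "\<forall>a\<in>Y. \<forall>b\<in>Y. a < b \<longrightarrow> f a b = c"
      using cs_large[of f c n X] X(1) by auto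
    then show "\<exists>Y\<subseteq>X. large n Y \<and> homogeneous f Y"
      unfolding homogeneous_def by (intro exI[of _ Y] conjI exI[of _ c])
  qed
qed

text \<open>
  \<open>refines f E X Y\<close>: one step of the construction of a cut that is closed under
  multiplication, semiregular, and satisfies Ramsey's theorem.
\<close>

definition refines :: "(nat \<Rightarrow> nat \<Rightarrow> bool) \<Rightarrow> nat set \<Rightarrow> nat set \<Rightarrow> nat set \<Rightarrow> bool" where
  "refines f E X Y \<longleftrightarrow> Y \<subseteq> X \<and> homogeneous f Y \<and> (\<forall>x\<in>X. \<forall>y\<in>Y. Min X * Min X < y) \<and>
    (Suc (card E) < Min X \<longrightarrow> (\<forall>a\<in>Y. \<forall>b\<in>Y. \<forall>e\<in>E. e \<le> a \<or> b < e))"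

text \<open>The level \<open>N\<close> depends on \<open>n\<close> alone, neither on the colouring
  nor on the gap set. So refinement can be repeated on an internal set that is large at all standard
  levels.\<close>

lemma refinement:
  "\<exists>N. \<forall>X f E. (\<forall>x\<in>X. 4 \<le> x) \<longrightarrow> finite X \<longrightarrow> finite E \<longrightarrow> large N X \<longrightarrow> (\<exists>Y. refines f E X Y \<and> large n Y)"
proof -
  obtain N where N: "\<And>X f. \<forall>x\<in>X. 2 \<le> x \<Longrightarrow> large N X \<Longrightarrow> \<exists>Y\<subseteq>X. large n Y \<and> homogeneous f Y"
    using ramsey_large by metis
  have "\<exists>Y. refines f E X Y \<and> large n Y"
    if X: "\<forall>x\<in>X. 4 \<le> x" "finite X" "finite E" "large (Suc (Suc (Suc (3 * N)))) X" for X f E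
  proof -
    have "X \<noteq> {}"
      using X(4) large_nonempty by blast
    then have m: "Min X \<in> X" "\<And>x. x \<in> X \<Longrightarrow> Min X \<le> x"
      using X(2) by auto
    have "4 \<le> Min X"
      using m(1) X(1) by blast
    then have "2 \<le> Min X" by simp
    then obtain X1 where X1: "X1 \<subseteq> X" "large (Suc (Suc (3 * N))) X1" "\<And>y. y \<in> X1 \<Longrightarrow> 2 ^ Min X < y"
      using large_pass[OF X(4) m(2)] by blast
    \<comment> \<open>From 4 on a power of two dominates the square, so an exponential pass also
      clears \<open>Min X * Min X\<close>. This is where the lower bound 4 on the elements comes
      from.\<close>
    have "k * k \<le> 2 ^ k" if "4 \<le> k" for k :: nat
      using that
    proof (induction k rule: dec_induct)
      case (step k)
      have "4 * k \<le> k * k"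
        using step.hyps(1) by (rule mult_le_mono1)
      then have "Suc k * Suc k \<le> 2 * (k * k)"
        using step.hyps(1) by (simp only: mult_Suc mult_Suc_right)
      with step.IH show ?case by simp
    qed simp
    with X1(3) \<open>4 \<le> Min X\<close> have sq: "Min X * Min X < y" if "y \<in> X1" for y
      using that le_less_trans by blast
    have l1: "large (3 * N) X1"
      by (rule large_le[OF X1(2)]) simp
    obtain X2 where X2: "X2 \<subseteq> X1" "large N X2" "Suc (card E) < Min X \<longrightarrow> (\<forall>a\<in>X2. \<forall>b\<in>X2. \<forall>e\<in>E. e \<le> a \<or> b < e)"
    proof (cases "Suc (card E) < Min X")
      case False
      then show thesis
        using that[of X1] large_le[OF l1] by simp
    next
      case True
      \<comment> \<open>Counting the elements of \<open>E\<close> up to \<open>y\<close> uses at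
        most \<open>card E + 1\<close> colours, and no element of \<open>E\<close> separates two
        numbers of the same colour.\<close>
      define c where "c y = card {e\<in>E. e \<le> y}" for y
      have sub: "c ` X1 \<subseteq> {..card E}"
        using X(3) by (auto simp: c_def intro: card_mono)
      then have fin: "finite (c ` X1)" and "card (c ` X1) \<le> Suc (card E)"
        using finite_subset card_mono[OF _ sub] by auto
      then have "card (c ` X1) < x" if "x \<in> X1" for x
        using True m(2)[of x] X1(1) that by auto
      from large_pigeonhole[OF l1 fin this] obtain Y d where Y: "Y \<subseteq> X1" "large N Y" "c ` Y = {d}"
        by blast
      have "e \<le> a \<or> b < e" if "a \<in> Y" "b \<in> Y" "e \<in> E" for a b e
      proof (rule ccontr)
        assume "\<not> ?thesis"
        then have "a < e" "e \<le> b" by auto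
        then have "e \<in> {e\<in>E. e \<le> b}" "e \<notin> {e\<in>E. e \<le> a}" "{e\<in>E. e \<le> a} \<subseteq> {e\<in>E. e \<le> b}"
          using that(3) by auto
        then have "{e\<in>E. e \<le> a} \<subset> {e\<in>E. e \<le> b}"
          by blast
        then have "c a < c b"
          unfolding c_def using X(3) by (intro psubset_card_mono) auto
        moreover have "c a = c b"
          using Y(3) that(1,2) by (metis imageI singletonD)
        ultimately show False by simp
      qed
      with Y that show thesis by blast
    qed
    have "\<forall>x\<in>X2. 2 \<le> x"
      using X1(1) X2(1) X(1) by fastforce
    then obtain Y where Y: "Y \<subseteq> X2" "large n Y" "homogeneous f Y"
      using N X2(2) by metis
    have "refines f E X Y"
      unfolding refines_def using Y X1(1) X2(1,3) sq by blast
    with Y(2) show ?thesis by blast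
  qed
  then show ?thesis by blast
qed

section \<open>Comparison with the Hardy hierarchy\<close>

lemma hardy_empty [simp]: "hardy {#} x = x"
  by (simp add: hardy.simps)

lemma hardy_add_0: "hardy (add_mset 0 \<beta>) x = hardy \<beta> (Suc x)"
proof -
  have "Min (set_mset (add_mset 0 \<beta>)) = 0"
    by (intro Min_eqI) auto
  then show ?thesis
    by (subst hardy.simps) (simp add: Let_def)
qed

lemma hardy_add_Suc:
  assumes "\<And>i. i \<in># \<beta> \<Longrightarrow> Suc j \<le> i"
  shows "hardy (add_mset (Suc j) \<beta>) x = hardy (\<beta> + replicate_mset x j) x"
proof -
  have "Min (set_mset (add_mset (Suc j) \<beta>)) = Suc j"
    using assms by (intro Min_eqI) auto
  then show ?thesis
    by (subst hardy.simps) (simp add: Let_def)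
qed

lemma cnf_cases:
  fixes \<alpha> :: cnf
  obtains "\<alpha> = {#}" | \<beta> where "\<alpha> = add_mset 0 \<beta>"
  | \<beta> j where "\<alpha> = add_mset (Suc j) \<beta>" "\<And>i. i \<in># \<beta> \<Longrightarrow> Suc j \<le> i"
proof (cases "\<alpha> = {#}")
  case False
  define j where "j = Min (set_mset \<alpha>)"
  have "j \<in># \<alpha>" "\<And>i. i \<in># \<alpha> \<Longrightarrow> j \<le> i"
    using False by (auto simp: j_def)
  then have "\<alpha> = add_mset j (\<alpha> - {#j#})" "\<And>i. i \<in># \<alpha> - {#j#} \<Longrightarrow> j \<le> i"
    by (auto dest: in_diffD)
  then show thesis
    using that by (cases j) metis+
qed (use that in blast)

text \<open>Induction along the descent of \<open>hardy\<close>, in which the argument changes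
  together with the ordinal.\<close>

lemma cnf_induct [case_names empty zero Suc]:
  fixes \<alpha> :: cnf
  assumes "\<And>x. P {#} x" "\<And>\<beta> x. P \<beta> (Suc x) \<Longrightarrow> P (add_mset 0 \<beta>) x"
    "\<And>j \<beta> x. (\<And>i. i \<in># \<beta> \<Longrightarrow> Suc j \<le> i) \<Longrightarrow> P (\<beta> + replicate_mset x j) x \<Longrightarrow> P (add_mset (Suc j) \<beta>) x"
  shows "P \<alpha> x"
proof (induction \<alpha> arbitrary: x rule: wf_induct_rule[OF wf_less_multiset])
  case (1 \<alpha>)
  show ?case
  proof (cases \<alpha> rule: cnf_cases)
    case (2 \<beta>)
    then have "(\<beta>, \<alpha>) \<in> {(M, N). M < N}"
      using fundamental_less[of "{#}" 0 \<beta>] by simp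
    with 1 assms(2) 2 show ?thesis by blast
  next
    case (3 \<beta> j)
    then have "(\<beta> + replicate_mset x j, \<alpha>) \<in> {(M, N). M < N}"
      using fundamental_less[of "replicate_mset x j" "Suc j" \<beta>] by (simp add: in_replicate_mset)
    with 1 assms(3) 3 show ?thesis by blast
  qed (use assms(1) in auto)
qed

text \<open>The descent acts on the least exponent, so \<open>\<gamma>\<close> is used up before
  \<open>\<beta>\<close> is touched as long as no exponent of \<open>\<gamma>\<close> exceeds one of
  \<open>\<beta>\<close>.\<close>

lemma hardy_plus:
  assumes "\<And>b c. b \<in># \<beta> \<Longrightarrow> c \<in># \<gamma> \<Longrightarrow> c \<le> b"
  shows "hardy (\<beta> + \<gamma>) x = hardy \<beta> (hardy \<gamma> x)"
  using assms
proof (induction \<gamma> x rule: cnf_induct)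
  case (zero \<gamma> x)
  then show ?case
    by (simp add: hardy_add_0)
next
  case (Suc j \<gamma> x)
  have "hardy (add_mset (Suc j) (\<beta> + \<gamma>)) x = hardy (\<beta> + \<gamma> + replicate_mset x j) x"
    by (rule hardy_add_Suc) (use Suc in auto)
  also have "\<dots> = hardy \<beta> (hardy (\<gamma> + replicate_mset x j) x)"
    using Suc.IH Suc.prems by (force simp: add.assoc in_replicate_mset split: if_splits)
  finally show ?case
    using hardy_add_Suc[of \<gamma> j x] Suc.hyps by simp
qed simp

lemma hardy_replicate: "hardy (replicate_mset k j) x = (hardy {#j#} ^^ k) x"
proof (induction k arbitrary: x)
  case (Suc k)
  have "hardy (replicate_mset (Suc k) j) x = hardy ({#j#} + replicate_mset k j) x"
    by simp
  also have "\<dots> = hardy {#j#} (hardy (replicate_mset k j) x)"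
    by (rule hardy_plus) (auto simp: in_replicate_mset split: if_splits)
  finally show ?case
    using Suc by simp
qed simp

lemma hardy_single_0: "hardy {#0#} x = Suc x"
  using hardy_add_0[of "{#}" x] by simp

lemma hardy_single_Suc: "hardy {#Suc j#} x = (hardy {#j#} ^^ x) x"
  using hardy_add_Suc[of "{#}" j x] by (simp add: hardy_replicate)

text \<open>Strict growth is stated at successors because \<open>hardy {#j#} 0 = 0\<close> for
  \<open>j > 0\<close>.\<close>

lemma hardy_single:
  shows mono_hardy_single: "mono (hardy {#j#})"
    and le_hardy_single: "x \<le> hardy {#j#} x"
    and less_hardy_single: "Suc x < hardy {#j#} (Suc x)"
proof -
  have "mono (hardy {#j#}) \<and> (\<forall>x. x \<le> hardy {#j#} x) \<and> (\<forall>x. Suc x < hardy {#j#} (Suc x))"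
  proof (induction j)
    case 0
    show ?case
      by (simp add: hardy_single_0 mono_def)
  next
    case (Suc j)
    have "mono (hardy {#Suc j#})"
      by (intro monoI) (simp add: hardy_single_Suc funpow_mono2 Suc)
    moreover have "x \<le> hardy {#Suc j#} x" for x
      using funpow_mono2[of "hardy {#j#}" 0 x x x] Suc by (simp add: hardy_single_Suc)
    moreover have "Suc x < hardy {#Suc j#} (Suc x)" for x
    proof -
      have "Suc x < (hardy {#j#} ^^ 1) (Suc x)"
        using Suc by simp
      also have "\<dots> \<le> (hardy {#j#} ^^ Suc x) (Suc x)"
        by (rule funpow_mono2) (use Suc in auto)
      finally show ?thesis
        by (simp add: hardy_single_Suc)
    qed
    ultimately show ?case by blast
  qed
  then show "mono (hardy {#j#})" "x \<le> hardy {#j#} x" "Suc x < hardy {#j#} (Suc x)"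
    by auto
qed

text \<open>The ordinal is \<open>\<omega>^n + 1\<close>: the extra successor shifts the argument to
  \<open>Suc x\<close>, which makes up for the start at \<open>Suc x\<close> in
  \<open>fast\<close>.\<close>

lemma fast_less_hardy: "fast n x < hardy {#0, n#} x"
proof -
  have "Suc (fast n x) \<le> hardy {#n#} (Suc x)"
  proof (induction n arbitrary: x)
    case (Suc n)
    note IH = Suc.IH
    have "Suc ((fast n ^^ k) z) \<le> (hardy {#n#} ^^ k) (Suc z)" for k z
    proof (induction k)
      case (Suc k)
      have "Suc (fast n ((fast n ^^ k) z)) \<le> hardy {#n#} (Suc ((fast n ^^ k) z))"
        by (rule IH)
      also have "\<dots> \<le> hardy {#n#} ((hardy {#n#} ^^ k) (Suc z))"
        using Suc hardy_single(1) by (auto dest: monoD)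
      finally show ?case by simp
    qed simp
    then have "Suc (fast (Suc n) x) \<le> (hardy {#n#} ^^ x) (Suc (Suc x))"
      by simp
    also have "\<dots> \<le> (hardy {#n#} ^^ x) (hardy {#n#} (Suc x))"
      using hardy_single by (intro funpow_mono) (auto simp: Suc_le_eq)
    also have "\<dots> = hardy {#Suc n#} (Suc x)"
      by (simp add: hardy_single_Suc funpow_swap1)
    finally show ?case .
  qed (simp add: hardy_single_0)
  then show ?thesis
    by (simp add: hardy_add_0)
qed

lemma fast_index_mono: "m \<le> n \<Longrightarrow> fast m x \<le> fast n x"
proof (induction n rule: dec_induct)
  case (step n)
  have "fast n x \<le> fast (Suc n) x"
  proof (cases x)
    case 0
    have "fast k 0 = Suc 0" for k
      by (cases k) auto
    with 0 show ?thesis by simp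
  next
    case (Suc y)
    have "(fast n ^^ 1) x \<le> (fast n ^^ x) (Suc x)"
      using fast_gt Suc by (intro funpow_mono2 fast_mono) (auto intro: less_imp_le)
    then show ?thesis by simp
  qed
  with step show ?case by simp
qed simp

lemma fold_fast_mono: "x \<le> y \<Longrightarrow> fold fast js x \<le> fold fast js y"
proof (induction js arbitrary: x y)
  case (Cons j js)
  then show ?case
    using fast_mono[of j] by (auto dest: monoD)
qed simp

text \<open>Replacing the last summand by \<open>x\<close> copies of the next smaller power is one
  unfolding of \<open>fast\<close>, except that \<open>fast\<close> starts at \<open>Suc x\<close>;
  monotonicity absorbs the difference. The sorted list lets the smallest exponent act first, as the
  descent does.\<close>

lemma hardy_le_fold_fast: "hardy \<alpha> x \<le> fold fast (sorted_list_of_multiset \<alpha>) x"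
proof (induction \<alpha> x rule: cnf_induct)
  case (zero \<beta> x)
  have "sorted_list_of_multiset (add_mset 0 \<beta>) = 0 # sorted_list_of_multiset \<beta>"
    by (cases "sorted_list_of_multiset \<beta>") auto
  with zero show ?case
    by (simp add: hardy_add_0)
next
  case (Suc j \<beta> x)
  let ?b = "sorted_list_of_multiset \<beta>"
  have sort: "sorted_list_of_multiset (mset xs) = xs" if "sorted xs" for xs :: "nat list"
    using that by (metis mset_sorted_list_of_multiset sorted_list_of_multiset_mset sorted_sort_id)
  have s1: "sorted_list_of_multiset (add_mset (Suc j) \<beta>) = Suc j # ?b"
    using sort[of "Suc j # ?b"] Suc.hyps by simp
  have s2: "sorted_list_of_multiset (\<beta> + replicate_mset x j) = replicate x j @ ?b"
    using sort[of "replicate x j @ ?b"] Suc.hyps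
    by (force simp: sorted_append add.commute)
  have "hardy (add_mset (Suc j) \<beta>) x \<le> fold fast ?b ((fast j ^^ x) x)"
    using Suc.IH by (simp add: hardy_add_Suc Suc.hyps s2)
  also have "\<dots> \<le> fold fast ?b ((fast j ^^ x) (Suc x))"
    by (intro fold_fast_mono funpow_mono fast_mono) auto
  also have "\<dots> = fold fast (Suc j # ?b) x"
    by simp
  finally show ?case
    unfolding s1 .
qed simp

text \<open>Each summand costs at most one application of \<open>fast m\<close>, and
  \<open>fast (Suc m)\<close> performs \<open>x\<close> of them.\<close>

lemma hardy_le_fast:
  assumes "\<And>j. j \<in># \<beta> \<Longrightarrow> j \<le> m" "size \<beta> \<le> x"
  shows "hardy \<beta> x \<le> fast (Suc m) x"
proof -
  have "fold fast js x \<le> (fast m ^^ length js) x" if "\<forall>j\<in>set js. j \<le> m" for js x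
    using that
  proof (induction js arbitrary: x)
    case (Cons j js)
    have "fold fast js (fast j x) \<le> fold fast js (fast m x)"
      using Cons.prems by (intro fold_fast_mono fast_index_mono) auto
    also have "\<dots> \<le> (fast m ^^ length js) (fast m x)"
      using Cons by auto
    finally show ?case
      by (simp add: funpow_swap1)
  qed simp
  from this[of "sorted_list_of_multiset \<beta>" x] assms(1)
  have "hardy \<beta> x \<le> (fast m ^^ size \<beta>) x"
    using hardy_le_fold_fast[of \<beta> x] by (simp flip: size_mset)
  also have "\<dots> \<le> (fast m ^^ x) (Suc x)"
    using assms(2) fast_gt by (intro funpow_mono2 fast_mono) (auto intro: less_imp_le)
  finally show ?thesis by simp
qed

section \<open>Structures and soundness\<close>

text \<open>Equality belongs to the structure and the domains are sets, so that the cut model can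
  consist of functions compared modulo the ultrafilter, without a quotient.\<close>

record ('a, 's) struct =
  domM :: "'a set"
  setsM :: "'s set"
  zeroM :: 'a
  oneM :: 'a
  addM :: "'a \<Rightarrow> 'a \<Rightarrow> 'a"
  mulM :: "'a \<Rightarrow> 'a \<Rightarrow> 'a"
  eqM :: "'a \<Rightarrow> 'a \<Rightarrow> bool"
  ltM :: "'a \<Rightarrow> 'a \<Rightarrow> bool"
  memM :: "'a \<Rightarrow> 's \<Rightarrow> bool"

primrec evM :: "('a, 's) struct \<Rightarrow> (nat \<Rightarrow> 'a) \<Rightarrow> tm \<Rightarrow> 'a" where
  "evM M e (Var i) = e i"
| "evM M e \<^bold>0 = zeroM M"
| "evM M e \<^bold>1 = oneM M"
| "evM M e (s \<^bold>+ t) = addM M (evM M e s) (evM M e t)"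
| "evM M e (s \<^bold>* t) = mulM M (evM M e s) (evM M e t)"

primrec satM :: "('a, 's) struct \<Rightarrow> (nat \<Rightarrow> 'a) \<Rightarrow> (nat \<Rightarrow> 's) \<Rightarrow> fm \<Rightarrow> bool" where
  "satM M e v \<^bold>\<bottom> \<longleftrightarrow> False"
| "satM M e v (s \<^bold>= t) \<longleftrightarrow> eqM M (evM M e s) (evM M e t)"
| "satM M e v (s \<^bold>< t) \<longleftrightarrow> ltM M (evM M e s) (evM M e t)"
| "satM M e v (t \<^bold>\<in> X) \<longleftrightarrow> memM M (evM M e t) (v X)"
| "satM M e v (\<phi> \<^bold>\<longrightarrow> \<psi>) \<longleftrightarrow> (satM M e v \<phi> \<longrightarrow> satM M e v \<psi>)"
| "satM M e v (\<phi> \<^bold>\<and> \<psi>) \<longleftrightarrow> satM M e v \<phi> \<and> satM M e v \<psi>"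
| "satM M e v (\<phi> \<^bold>\<or> \<psi>) \<longleftrightarrow> satM M e v \<phi> \<or> satM M e v \<psi>"
| "satM M e v (AllN \<phi>) \<longleftrightarrow> (\<forall>x\<in>domM M. satM M (case_nat x e) v \<phi>)"
| "satM M e v (ExN \<phi>) \<longleftrightarrow> (\<exists>x\<in>domM M. satM M (case_nat x e) v \<phi>)"
| "satM M e v (AllS \<phi>) \<longleftrightarrow> (\<forall>A\<in>setsM M. satM M e (case_nat A v) \<phi>)"
| "satM M e v (ExS \<phi>) \<longleftrightarrow> (\<exists>A\<in>setsM M. satM M e (case_nat A v) \<phi>)"

lemma evM_subst: "evM M e (subst_tm \<sigma> t) = evM M (\<lambda>i. evM M e (\<sigma> i)) t"
  by (induction t) auto

lemma satM_subst:
  "satM M e v (subst \<sigma> \<rho> \<phi>) \<longleftrightarrow> satM M (\<lambda>i. evM M e (\<sigma> i)) (\<lambda>i. v (\<rho> i)) \<phi>"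
proof (induction \<phi> arbitrary: e v \<sigma> \<rho>)
  case (AllN \<phi>)
  have "(\<lambda>i. evM M (case_nat x e) (upN \<sigma> i)) = case_nat x (\<lambda>i. evM M e (\<sigma> i))" for x
    by (auto simp: upN_def evM_subst split: nat.splits)
  then show ?case using AllN by simp
next
  case (ExN \<phi>)
  have "(\<lambda>i. evM M (case_nat x e) (upN \<sigma> i)) = case_nat x (\<lambda>i. evM M e (\<sigma> i))" for x
    by (auto simp: upN_def evM_subst split: nat.splits)
  then show ?case using ExN by simp
next
  case (AllS \<phi>)
  have "(\<lambda>i. case_nat A v (upS \<rho> i)) = case_nat A (\<lambda>i. v (\<rho> i))" for A
    by (auto simp: upS_def split: nat.splits)
  then show ?case using AllS by simp
next
  case (ExS \<phi>)
  have "(\<lambda>i. case_nat A v (upS \<rho> i)) = case_nat A (\<lambda>i. v (\<rho> i))" for A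
    by (auto simp: upS_def split: nat.splits)
  then show ?case using ExS by simp
qed (auto simp: evM_subst)

lemma evM_below: "below_tm n t \<Longrightarrow> (\<And>i. i < n \<Longrightarrow> e i = e' i) \<Longrightarrow> evM M e t = evM M e' t"
  by (induction t) auto

lemma satM_below:
  "below n m \<phi> \<Longrightarrow> (\<And>i. i < n \<Longrightarrow> e i = e' i) \<Longrightarrow> (\<And>i. i < m \<Longrightarrow> v i = v' i) \<Longrightarrow>
   satM M e v \<phi> \<longleftrightarrow> satM M e' v' \<phi>"
proof (induction \<phi> arbitrary: n m e e' v v')
  case (AllN \<phi>)
  have "satM M (case_nat x e) v \<phi> \<longleftrightarrow> satM M (case_nat x e') v' \<phi>" for x
    using AllN.prems by (intro AllN.IH[of "Suc n" m]) (auto split: nat.splits)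
  then show ?case by simp
next
  case (ExN \<phi>)
  have "satM M (case_nat x e) v \<phi> \<longleftrightarrow> satM M (case_nat x e') v' \<phi>" for x
    using ExN.prems by (intro ExN.IH[of "Suc n" m]) (auto split: nat.splits)
  then show ?case by simp
next
  case (AllS \<phi>)
  have "satM M e (case_nat A v) \<phi> \<longleftrightarrow> satM M e' (case_nat A v') \<phi>" for A
    using AllS.prems by (intro AllS.IH[of n "Suc m"]) (auto split: nat.splits)
  then show ?case by simp
next
  case (ExS \<phi>)
  have "satM M e (case_nat A v) \<phi> \<longleftrightarrow> satM M e' (case_nat A v') \<phi>" for A
    using ExS.prems by (intro ExS.IH[of n "Suc m"]) (auto split: nat.splits)
  then show ?case by simp
next
  case (Imp \<phi> \<psi>)
  from Imp.IH(1)[of n m e e' v v'] Imp.IH(2)[of n m e e' v v'] Imp.prems show ?case by simp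
next
  case (And \<phi> \<psi>)
  from And.IH(1)[of n m e e' v v'] And.IH(2)[of n m e e' v v'] And.prems show ?case by simp
next
  case (Or \<phi> \<psi>)
  from Or.IH(1)[of n m e e' v v'] Or.IH(2)[of n m e e' v v'] Or.prems show ?case by simp
next
  case (Eq s t)
  then show ?case using evM_below[of n s e e' M] evM_below[of n t e e' M] by simp
next
  case (Lt s t)
  then show ?case using evM_below[of n s e e' M] evM_below[of n t e e' M] by simp
next
  case (Mem t X)
  then show ?case using evM_below[of n t e e' M] by simp
qed simp

lemma below_tm_mono: "below_tm n t \<Longrightarrow> n \<le> n' \<Longrightarrow> below_tm n' t"
  by (induction t) auto

lemma below_mono: "below n m \<phi> \<Longrightarrow> n \<le> n' \<Longrightarrow> m \<le> m' \<Longrightarrow> below n' m' \<phi>"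
  by (induction \<phi> arbitrary: n m n' m') (auto intro: below_tm_mono)

lemma ex_below_tm: "\<exists>n. below_tm n t"
proof (induction t)
  case (Add s t)
  then obtain n n' where "below_tm n s" "below_tm n' t" by auto
  then have "below_tm (max n n') (s \<^bold>+ t)"
    using below_tm_mono max.cobounded1 max.cobounded2 by (metis below_tm.simps(4))
  then show ?case ..
next
  case (Mul s t)
  then obtain n n' where "below_tm n s" "below_tm n' t" by auto
  then have "below_tm (max n n') (s \<^bold>* t)"
    using below_tm_mono max.cobounded1 max.cobounded2 by (metis below_tm.simps(5))
  then show ?case ..
qed auto

lemma ex_below: "\<exists>n. below n n \<phi>"
proof (induction \<phi>)
  case (Eq s t)
  obtain n where "below_tm n (s \<^bold>+ t)" using ex_below_tm by blast
  then show ?case by auto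
next
  case (Lt s t)
  obtain n where "below_tm n (s \<^bold>+ t)" using ex_below_tm by blast
  then show ?case by auto
next
  case (Mem t X)
  obtain n where "below_tm n t" using ex_below_tm by blast
  then show ?case
    by (intro exI[of _ "max n (Suc X)"]) (auto intro: below_tm_mono)
next
  case (Imp \<phi> \<psi>)
  then obtain n n' where "below n n \<phi>" "below n' n' \<psi>" by auto
  then show ?case
    by (intro exI[of _ "max n n'"]) (auto intro: below_mono)
next
  case (And \<phi> \<psi>)
  then obtain n n' where "below n n \<phi>" "below n' n' \<psi>" by auto
  then show ?case
    by (intro exI[of _ "max n n'"]) (auto intro: below_mono)
next
  case (Or \<phi> \<psi>)
  then obtain n n' where "below n n \<phi>" "below n' n' \<psi>" by auto
  then show ?case
    by (intro exI[of _ "max n n'"]) (auto intro: below_mono)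
next
  case (AllN \<phi>)
  then obtain n where "below n n \<phi>" by auto
  then show ?case by (intro exI[of _ n]) (auto intro: below_mono)
next
  case (ExN \<phi>)
  then obtain n where "below n n \<phi>" by auto
  then show ?case by (intro exI[of _ n]) (auto intro: below_mono)
next
  case (AllS \<phi>)
  then obtain n where "below n n \<phi>" by auto
  then show ?case by (intro exI[of _ n]) (auto intro: below_mono)
next
  case (ExS \<phi>)
  then obtain n where "below n n \<phi>" by auto
  then show ?case by (intro exI[of _ n]) (auto intro: below_mono)
qed auto

definition env :: "('a, 's) struct \<Rightarrow> (nat \<Rightarrow> 'a) \<Rightarrow> (nat \<Rightarrow> 's) \<Rightarrow> bool" where
  "env M e v \<longleftrightarrow> (\<forall>i. e i \<in> domM M) \<and> (\<forall>i. v i \<in> setsM M)"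

locale model =
  fixes M :: "('a, 's) struct"
  assumes dom_closed: "zeroM M \<in> domM M" "oneM M \<in> domM M"
      "x \<in> domM M \<Longrightarrow> y \<in> domM M \<Longrightarrow> addM M x y \<in> domM M"
      "x \<in> domM M \<Longrightarrow> y \<in> domM M \<Longrightarrow> mulM M x y \<in> domM M"
    and eq_refl: "eqM M x x"
    and eq_sym: "eqM M x y \<Longrightarrow> eqM M y x"
    and eq_add: "eqM M x x' \<Longrightarrow> eqM M y y' \<Longrightarrow> eqM M (addM M x y) (addM M x' y')"
    and eq_mul: "eqM M x x' \<Longrightarrow> eqM M y y' \<Longrightarrow> eqM M (mulM M x y) (mulM M x' y')"
    and eq_eq: "eqM M x x' \<Longrightarrow> eqM M y y' \<Longrightarrow> eqM M x y \<Longrightarrow> eqM M x' y'"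
    and eq_lt: "eqM M x x' \<Longrightarrow> eqM M y y' \<Longrightarrow> ltM M x y \<Longrightarrow> ltM M x' y'"
    and eq_mem: "eqM M x x' \<Longrightarrow> memM M x A \<Longrightarrow> memM M x' A"
begin

lemma ev_dom: "env M e v \<Longrightarrow> evM M e t \<in> domM M"
  by (induction t) (auto simp: env_def dom_closed)

lemma env_case_nat [intro]:
  "env M e v \<Longrightarrow> x \<in> domM M \<Longrightarrow> env M (case_nat x e) v"
  "env M e v \<Longrightarrow> A \<in> setsM M \<Longrightarrow> env M e (case_nat A v)"
  by (auto simp: env_def split: nat.splits)

lemma ev_cong: "(\<And>i. eqM M (e i) (e' i)) \<Longrightarrow> eqM M (evM M e t) (evM M e' t)"
  by (induction t) (auto intro: eq_refl eq_add eq_mul)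

lemma sat_cong: "(\<And>i. eqM M (e i) (e' i)) \<Longrightarrow> satM M e v \<phi> \<longleftrightarrow> satM M e' v \<phi>"
proof (induction \<phi> arbitrary: e e' v)
  case (Eq s t)
  have 1: "eqM M (evM M e u) (evM M e' u)" for u
    using Eq.prems by (rule ev_cong)
  show ?case
    using eq_eq[OF 1[of s] 1[of t]] eq_eq[OF eq_sym[OF 1[of s]] eq_sym[OF 1[of t]]] by auto
next
  case (Lt s t)
  have 1: "eqM M (evM M e u) (evM M e' u)" for u
    using Lt.prems by (rule ev_cong)
  show ?case
    using eq_lt[OF 1[of s] 1[of t]] eq_lt[OF eq_sym[OF 1[of s]] eq_sym[OF 1[of t]]] by auto
next
  case (Mem t X)
  have 1: "eqM M (evM M e u) (evM M e' u)" for u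
    using Mem.prems by (rule ev_cong)
  show ?case
    using eq_mem[OF 1[of t]] eq_mem[OF eq_sym[OF 1[of t]]] by auto
next
  case (Imp \<phi> \<psi>)
  show ?case
    using Imp.IH(1)[OF Imp.prems] Imp.IH(2)[OF Imp.prems] by simp
next
  case (And \<phi> \<psi>)
  show ?case
    using And.IH(1)[OF And.prems] And.IH(2)[OF And.prems] by simp
next
  case (Or \<phi> \<psi>)
  show ?case
    using Or.IH(1)[OF Or.prems] Or.IH(2)[OF Or.prems] by simp
next
  case (AllN \<phi>)
  have "satM M (case_nat x e) v \<phi> \<longleftrightarrow> satM M (case_nat x e') v \<phi>" for x
    using AllN.prems by (intro AllN.IH) (auto simp: eq_refl split: nat.splits)
  then show ?case by simp
next
  case (ExN \<phi>)
  have "satM M (case_nat x e) v \<phi> \<longleftrightarrow> satM M (case_nat x e') v \<phi>" for x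
    using ExN.prems by (intro ExN.IH) (auto simp: eq_refl split: nat.splits)
  then show ?case by simp
next
  case (AllS \<phi>)
  have "satM M e (case_nat A v) \<phi> \<longleftrightarrow> satM M e' (case_nat A v) \<phi>" for A
    using AllS.prems by (intro AllS.IH)
  then show ?case by simp
next
  case (ExS \<phi>)
  have "satM M e (case_nat A v) \<phi> \<longleftrightarrow> satM M e' (case_nat A v) \<phi>" for A
    using ExS.prems by (intro ExS.IH)
  then show ?case by simp
qed simp

lemma sat_instN: "satM M e v (instN t \<phi>) \<longleftrightarrow> satM M (case_nat (evM M e t) e) v \<phi>"
proof -
  have "(\<lambda>i. evM M e (case_nat t Var i)) = case_nat (evM M e t) e"
    by (auto split: nat.splits)
  then show ?thesis by (simp add: satM_subst)
qed

lemma sat_instS: "satM M e v (instS X \<phi>) \<longleftrightarrow> satM M e (case_nat (v X) v) \<phi>"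
proof -
  have "(\<lambda>i. v (case_nat X id i)) = case_nat (v X) v"
    by (auto split: nat.splits)
  then show ?thesis by (simp add: satM_subst)
qed

lemma sat_liftN [simp]: "satM M (case_nat x e) v (liftN \<phi>) \<longleftrightarrow> satM M e v \<phi>"
  by (simp add: satM_subst)

lemma sat_liftS [simp]: "satM M e (case_nat A v) (liftS \<phi>) \<longleftrightarrow> satM M e v \<phi>"
  by (simp add: satM_subst)

theorem soundness:
  "\<Gamma> \<turnstile> \<phi> \<Longrightarrow> env M e v \<Longrightarrow> (\<And>\<psi>. \<psi> \<in> \<Gamma> \<Longrightarrow> satM M e v \<psi>) \<Longrightarrow> satM M e v \<phi>"
proof (induction arbitrary: e v rule: derives.induct)
  case (Contr \<phi> \<Gamma>)
  show ?case
  proof (rule ccontr)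
    assume "\<not> satM M e v \<phi>"
    then have "satM M e v \<^bold>\<bottom>"
      using Contr.prems by (intro Contr.IH) auto
    then show False by simp
  qed
next
  case (ImpI \<phi> \<Gamma> \<psi>)
  have "satM M e v \<psi>" if "satM M e v \<phi>"
    using that ImpI.prems by (intro ImpI.IH) auto
  then show ?case by simp
next
  case (ImpE \<Gamma> \<phi> \<psi>)
  from ImpE.IH(1)[OF ImpE.prems] ImpE.IH(2)[OF ImpE.prems] show ?case by simp
next
  case (AndI \<Gamma> \<phi> \<psi>)
  from AndI.IH(1)[OF AndI.prems] AndI.IH(2)[OF AndI.prems] show ?case by simp
next
  case (AndE1 \<Gamma> \<phi> \<psi>)
  from AndE1.IH[OF AndE1.prems] show ?case by simp
next
  case (AndE2 \<Gamma> \<phi> \<psi>)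
  from AndE2.IH[OF AndE2.prems] show ?case by simp
next
  case (OrI1 \<Gamma> \<phi> \<psi>)
  from OrI1.IH[OF OrI1.prems] show ?case by simp
next
  case (OrI2 \<Gamma> \<psi> \<phi>)
  from OrI2.IH[OF OrI2.prems] show ?case by simp
next
  case (OrE \<Gamma> \<phi> \<psi> \<chi>)
  from OrE.IH(1)[OF OrE.prems] have "satM M e v \<phi> \<or> satM M e v \<psi>" by simp
  then show ?case
  proof
    assume "satM M e v \<phi>"
    then show ?thesis using OrE.prems by (intro OrE.IH(2)) auto
  next
    assume "satM M e v \<psi>"
    then show ?thesis using OrE.prems by (intro OrE.IH(3)) auto
  qed
next
  case (AllNI \<Gamma> \<phi>)
  have "satM M (case_nat x e) v \<phi>" if "x \<in> domM M" for x
    using that AllNI.prems by (intro AllNI.IH) auto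
  then show ?case by simp
next
  case (AllNE \<Gamma> \<phi> t)
  from AllNE.IH[OF AllNE.prems] ev_dom[OF AllNE.prems(1)] show ?case by (simp add: sat_instN)
next
  case (ExNI \<Gamma> t \<phi>)
  from ExNI.IH[OF ExNI.prems] ev_dom[OF ExNI.prems(1), of t] show ?case by (auto simp: sat_instN)
next
  case (ExNE \<Gamma> \<phi> \<chi>)
  from ExNE.IH(1)[OF ExNE.prems] obtain x where x: "x \<in> domM M" "satM M (case_nat x e) v \<phi>"
    by auto
  then have "satM M (case_nat x e) v (liftN \<chi>)"
    using ExNE.prems by (intro ExNE.IH(2)) auto
  then show ?case by simp
next
  case (AllSI \<Gamma> \<phi>)
  have "satM M e (case_nat A v) \<phi>" if "A \<in> setsM M" for A
    using that AllSI.prems by (intro AllSI.IH) auto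
  then show ?case by simp
next
  case (AllSE \<Gamma> \<phi> X)
  from AllSE.IH[OF AllSE.prems] AllSE.prems(1) show ?case by (simp add: sat_instS env_def)
next
  case (ExSI \<Gamma> X \<phi>)
  have "v X \<in> setsM M"
    using ExSI.prems(1) by (simp add: env_def)
  with ExSI.IH[OF ExSI.prems] show ?case by (auto simp: sat_instS)
next
  case (ExSE \<Gamma> \<phi> \<chi>)
  from ExSE.IH(1)[OF ExSE.prems] obtain A where A: "A \<in> setsM M" "satM M e (case_nat A v) \<phi>"
    by auto
  then have "satM M e (case_nat A v) (liftS \<chi>)"
    using ExSE.prems by (intro ExSE.IH(2)) auto
  then show ?case by simp
next
  case (EqI \<Gamma> t)
  show ?case by (simp add: eq_refl)
next
  case (EqE \<Gamma> s t \<phi>)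
  have "eqM M (evM M e s) (evM M e t)"
    using EqE.IH(1)[OF EqE.prems] by simp
  then have "satM M (case_nat (evM M e s) e) v \<phi> \<longleftrightarrow> satM M (case_nat (evM M e t) e) v \<phi>"
    by (intro sat_cong) (auto simp: eq_refl split: nat.splits)
  with EqE.IH(2)[OF EqE.prems] show ?case by (simp add: sat_instN)
qed auto

lemma sat_AllN_funpow:
  "(\<forall>e v. env M e v \<longrightarrow> satM M e v ((AllN ^^ n) \<phi>)) \<longleftrightarrow> (\<forall>e v. env M e v \<longrightarrow> satM M e v \<phi>)" (is "?l \<longleftrightarrow> ?r")
proof (induction n)
  case (Suc n)
  have "(\<forall>e v. env M e v \<longrightarrow> satM M e v (AllN \<psi>)) \<longleftrightarrow> (\<forall>e v. env M e v \<longrightarrow> satM M e v \<psi>)" for \<psi>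
  proof (intro iffI allI impI)
    fix e v assume *: "\<forall>e v. env M e v \<longrightarrow> satM M e v (AllN \<psi>)" "env M e v"
    then have "env M (\<lambda>i. e (Suc i)) v" "e 0 \<in> domM M"
      by (auto simp: env_def)
    with *(1) have "satM M (case_nat (e 0) (\<lambda>i. e (Suc i))) v \<psi>"
      by auto
    moreover have "case_nat (e 0) (\<lambda>i. e (Suc i)) = e"
      by (auto split: nat.splits)
    ultimately show "satM M e v \<psi>" by simp
  qed auto
  then show ?case using Suc by simp
qed simp

lemma sat_AllS_funpow:
  "(\<forall>e v. env M e v \<longrightarrow> satM M e v ((AllS ^^ n) \<phi>)) \<longleftrightarrow> (\<forall>e v. env M e v \<longrightarrow> satM M e v \<phi>)" (is "?l \<longleftrightarrow> ?r")
proof (induction n)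
  case (Suc n)
  have "(\<forall>e v. env M e v \<longrightarrow> satM M e v (AllS \<psi>)) \<longleftrightarrow> (\<forall>e v. env M e v \<longrightarrow> satM M e v \<psi>)" for \<psi>
  proof (intro iffI allI impI)
    fix e v assume *: "\<forall>e v. env M e v \<longrightarrow> satM M e v (AllS \<psi>)" "env M e v"
    then have "env M e (\<lambda>i. v (Suc i))" "v 0 \<in> setsM M"
      by (auto simp: env_def)
    with *(1) have "satM M e (case_nat (v 0) (\<lambda>i. v (Suc i))) \<psi>"
      by auto
    moreover have "case_nat (v 0) (\<lambda>i. v (Suc i)) = v"
      by (auto split: nat.splits)
    ultimately show "satM M e v \<psi>" by simp
  qed auto
  then show ?case using Suc by simp
qed simp

text \<open>Stated for validity in all environments, where it does not matter how many quantifiers a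
  closure has.\<close>

lemma sat_closures:
  assumes "\<psi> \<in> closures \<phi>"
  shows "(\<forall>e v. env M e v \<longrightarrow> satM M e v \<psi>) \<longleftrightarrow> (\<forall>e v. env M e v \<longrightarrow> satM M e v \<phi>)"
proof -
  obtain n m where "\<psi> = (AllS ^^ m) ((AllN ^^ n) \<phi>)"
    using assms by (auto simp: closures_def)
  then show ?thesis
    by (simp only: sat_AllN_funpow sat_AllS_funpow)
qed

end

lemma closed_AllN: "below n m \<phi> \<Longrightarrow> below (n - k) m ((AllN ^^ k) \<phi>)"
proof (induction k)
  case (Suc k)
  have "below (Suc (n - Suc k)) m ((AllN ^^ k) \<phi>)"
    by (rule below_mono[OF Suc.IH[OF Suc.prems]]) auto
  then show ?case by simp
qed simp

lemma closed_AllS: "below n m \<phi> \<Longrightarrow> below n (m - k) ((AllS ^^ k) \<phi>)"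
proof (induction k)
  case (Suc k)
  have "below n (Suc (m - Suc k)) ((AllS ^^ k) \<phi>)"
    by (rule below_mono[OF Suc.IH[OF Suc.prems]]) auto
  then show ?case by simp
qed simp

lemma closures_closed:
  assumes "\<psi> \<in> closures \<phi>"
  shows "below 0 0 \<psi>"
proof -
  obtain n m where \<psi>: "\<psi> = (AllS ^^ m) ((AllN ^^ n) \<phi>)" and "below n m \<phi>"
    using assms by (auto simp: closures_def)
  then have "below 0 m ((AllN ^^ n) \<phi>)"
    using closed_AllN[of n m \<phi> n] by simp
  then show ?thesis
    using closed_AllS[of 0 m _ m] by (simp add: \<psi>)
qed

lemma closures_nonempty: "closures \<phi> \<noteq> {}"
  using ex_below[of \<phi>] unfolding closures_def by blast

section \<open>Countable ultrapowers and cuts\<close>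

locale ultrafilter =
  fixes U :: "nat filter"
  assumes not_bot: "U \<noteq> bot"
    and ultra: "eventually P U \<or> eventually (\<lambda>i. \<not> P i) U"
begin

lemma ev_not: "eventually (\<lambda>i. \<not> P i) U \<longleftrightarrow> \<not> eventually P U"
proof
  assume *: "eventually (\<lambda>i. \<not> P i) U"
  show "\<not> eventually P U"
  proof
    assume "eventually P U"
    with * have "eventually (\<lambda>_. False) U"
      by eventually_elim simp
    with not_bot show False
      by (simp add: eventually_False)
  qed
qed (use ultra in blast)

lemma ev_imp: "eventually (\<lambda>i. P i \<longrightarrow> Q i) U \<longleftrightarrow> (eventually P U \<longrightarrow> eventually Q U)"
proof (cases "eventually P U")
  case True
  then show ?thesis
    by (auto elim: eventually_mp eventually_mono)
next
  case False
  then have "eventually (\<lambda>i. \<not> P i) U"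
    by (simp add: ev_not)
  with False show ?thesis
    by (auto elim: eventually_mono)
qed

lemma ev_disj: "eventually (\<lambda>i. P i \<or> Q i) U \<longleftrightarrow> eventually P U \<or> eventually Q U"
  using ev_imp[of "\<lambda>i. \<not> P i" Q] by (auto simp: ev_not disj_imp)

end

text \<open>Zorn's lemma for families of infinite sets that are closed under intersection and
  contain all tails. Maximality gives upward closure and decides every set; the tails put the filter
  below \<open>sequentially\<close>.\<close>

lemma ex_ultrafilter: "\<exists>U. ultrafilter U \<and> U \<le> sequentially"
proof -
  define A where "A = {S :: nat set set. (\<forall>B\<in>S. infinite B) \<and> (\<forall>B\<in>S. \<forall>C\<in>S. B \<inter> C \<in> S) \<and> (\<forall>n. {n..} \<in> S)}"
  have "range (\<lambda>n::nat. {n..}) \<in> A"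
  proof -
    have "{m..} \<inter> {n..} = {max m n..}" for m n :: nat
      by auto
    then show ?thesis
      by (auto simp: A_def infinite_Ici)
  qed
  then have ne: "A \<noteq> {}" by auto
  have ch: "\<Union>C \<in> A" if "C \<noteq> {}" "subset.chain A C" for C
  proof -
    have C: "C \<subseteq> A" "\<And>S T. S \<in> C \<Longrightarrow> T \<in> C \<Longrightarrow> S \<subseteq> T \<or> T \<subseteq> S"
      using that(2) by (auto simp: subset.chain_def)
    have 1: "B \<inter> D \<in> \<Union>C" if BD: "B \<in> S" "S \<in> C" "D \<in> T" "T \<in> C" for B D S T
    proof -
      obtain W where W: "W \<in> C" "B \<in> W" "D \<in> W"
        using C(2)[OF BD(2,4)] BD by blast
      then have "W \<in> A"
        using C(1) by blast
      with W show ?thesis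
        by (auto simp: A_def)
    qed
    have 2: "{n..} \<in> \<Union>C" for n
    proof -
      obtain W where "W \<in> C" "W \<in> A"
        using \<open>C \<noteq> {}\<close> C(1) by blast
      then show ?thesis
        by (auto simp: A_def)
    qed
    have 3: "infinite B" if "B \<in> S" "S \<in> C" for B S
    proof -
      have "S \<in> A"
        using that C(1) by blast
      with that show ?thesis
        by (auto simp: A_def)
    qed
    show ?thesis
      unfolding A_def
    proof (intro CollectI conjI ballI allI)
      show "infinite B" if "B \<in> \<Union>C" for B
        using that 3 by (elim UnionE)
      show "B \<inter> D \<in> \<Union>C" if "B \<in> \<Union>C" "D \<in> \<Union>C" for B D
        using that by (elim UnionE) (rule 1)
    qed (rule 2)
  qed
  obtain M where M: "M \<in> A" "\<And>S. S \<in> A \<Longrightarrow> M \<subseteq> S \<Longrightarrow> S = M"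
  proof -
    have "\<exists>M\<in>A. \<forall>S\<in>A. M \<subseteq> S \<longrightarrow> S = M"
      by (rule subset_Zorn_nonempty[OF ne]) (rule ch)
    then show thesis
      using that by blast
  qed
  have MA: "\<forall>B\<in>M. infinite B" "\<forall>B\<in>M. \<forall>C\<in>M. B \<inter> C \<in> M" "\<forall>n. {n..} \<in> M"
    using M(1) by (simp_all add: A_def)
  have inf: "infinite B" if "B \<in> M" for B
    using MA(1) that by blast
  have int: "B \<inter> C \<in> M" if "B \<in> M" "C \<in> M" for B C
    using MA(2) that by blast
  have ici: "{n..} \<in> M" for n
    using MA(3) by blast
  have UNIV_M: "UNIV \<in> M"
    using ici[of 0] by simp
  \<comment> \<open>A set with infinite trace on every member could be adjoined together with these
    traces, so by maximality it already belongs.\<close>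
  have add: "B \<in> M" if B: "\<And>C. C \<in> M \<Longrightarrow> infinite (B \<inter> C)" for B
  proof -
    define S where "S = M \<union> (\<lambda>C. B \<inter> C) ` M"
    have "S \<in> A"
      unfolding A_def
    proof (intro CollectI conjI ballI allI)
      show "infinite C" if "C \<in> S" for C
        using that inf B by (auto simp: S_def)
      show "C \<inter> D \<in> S" if "C \<in> S" "D \<in> S" for C D
      proof -
        obtain C' D' where *: "C' \<in> M" "C = C' \<or> C = B \<inter> C'" "D' \<in> M" "D = D' \<or> D = B \<inter> D'"
          using \<open>C \<in> S\<close> \<open>D \<in> S\<close> unfolding S_def by blast
        then have "C \<inter> D = C' \<inter> D' \<or> C \<inter> D = B \<inter> (C' \<inter> D')"
          by blast
        then show ?thesis
          using int[OF *(1,3)] by (elim disjE) (simp_all add: S_def)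
      qed
      show "{n..} \<in> S" for n
        using ici by (simp add: S_def)
    qed
    then have "S = M"
      by (rule M(2)) (simp add: S_def)
    moreover have "B \<inter> UNIV \<in> S"
      using UNIV_M by (auto simp: S_def)
    ultimately show ?thesis by simp
  qed
  have mono: "C \<in> M" if "B \<in> M" "B \<subseteq> C" for B C
  proof (rule add)
    show "infinite (C \<inter> D)" if "D \<in> M" for D
    proof (rule infinite_super)
      show "B \<inter> D \<subseteq> C \<inter> D"
        using \<open>B \<subseteq> C\<close> by blast
      show "infinite (B \<inter> D)"
        by (rule inf[OF int[OF \<open>B \<in> M\<close> that]])
    qed
  qed
  have ultra: "B \<in> M \<or> - B \<in> M" for B
  proof (cases "\<forall>C\<in>M. infinite (B \<inter> C)")
    case True
    then show ?thesis using add by blast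
  next
    case False
    then obtain C where C: "C \<in> M" "finite (B \<inter> C)" by blast
    have "- B \<in> M"
    proof (rule add)
      fix D assume D: "D \<in> M"
      have "infinite (C \<inter> D)"
        by (rule inf[OF int[OF C(1) D]])
      moreover have "C \<inter> D \<subseteq> (- B \<inter> D) \<union> (B \<inter> C)" by blast
      ultimately show "infinite (- B \<inter> D)"
        using C(2) by (meson finite_UnI finite_subset)
    qed
    then show ?thesis ..
  qed
  define U where "U = Abs_filter (\<lambda>P. {i. P i} \<in> M)"
  have "is_filter (\<lambda>P. {i. P i} \<in> M)"
  proof
    show "{i. P i \<and> Q i} \<in> M" if "{i. P i} \<in> M" "{i. Q i} \<in> M" for P Q :: "nat \<Rightarrow> bool"
      using int[OF that] by (simp add: Collect_conj_eq)
    show "{i. Q i} \<in> M" if "\<forall>i. P i \<longrightarrow> Q i" "{i. P i} \<in> M" for P Q :: "nat \<Rightarrow> bool"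
      by (rule mono[OF that(2)]) (use that(1) in auto)
  qed (use UNIV_M in auto)
  then have ev: "eventually P U \<longleftrightarrow> {i. P i} \<in> M" for P
    by (simp add: U_def eventually_Abs_filter)
  have "ultrafilter U"
  proof
    show "U \<noteq> bot"
      unfolding trivial_limit_def ev using inf UNIV_M by (metis Collect_empty_eq finite.emptyI)
    show "eventually P U \<or> eventually (\<lambda>i. \<not> P i) U" for P
      using ultra[of "{i. P i}"] by (simp add: ev Collect_neg_eq)
  qed
  moreover have "U \<le> sequentially"
    unfolding le_filter_def ev eventually_sequentially
  proof (intro allI impI)
    fix P :: "nat \<Rightarrow> bool" assume "\<exists>N. \<forall>n\<ge>N. P n"
    then obtain N where "{N..} \<subseteq> {i. P i}" by auto
    then show "{i. P i} \<in> M"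
      using mono[OF ici] by blast
  qed
  ultimately show ?thesis by blast
qed

text \<open>Names for the functions generated from the identity by countably many operations.
  Argument lists are finite, which keeps the names countable.\<close>

datatype op_term = Point | App nat "op_term list"

instance op_term :: countable
  by countable_datatype

primrec op_eval :: "(nat \<Rightarrow> (nat \<Rightarrow> nat) \<Rightarrow> nat) \<Rightarrow> op_term \<Rightarrow> nat \<Rightarrow> nat" where
  "op_eval ops Point i = i"
| "op_eval ops (App k ts) i = ops k (\<lambda>j. if j < length ts then map (\<lambda>t. op_eval ops t i) ts ! j else 0)"

definition finitary :: "((nat \<Rightarrow> nat) \<Rightarrow> nat) \<Rightarrow> bool" where
  "finitary p \<longleftrightarrow> (\<exists>n. \<forall>e e'. (\<forall>j<n. e j = e' j) \<longrightarrow> p e = p e')"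

text \<open>Operations take infinite argument sequences but look at finitely many entries. The other
  entries can be replaced by the default 0 of \<open>op_eval\<close>, so that a finite list of names
  denotes every value.\<close>

lemma countable_closure:
  assumes "countable Q" "\<And>p. p \<in> Q \<Longrightarrow> finitary p"
  shows "\<exists>FF :: (nat \<Rightarrow> nat) set. countable FF \<and> (\<lambda>i. i) \<in> FF \<and>
    (\<forall>p\<in>Q. \<forall>E. (\<forall>j. E j \<in> FF) \<longrightarrow> (\<lambda>i. p (\<lambda>j. E j i)) \<in> FF)"
proof -
  define ops where "ops = from_nat_into Q"
  define FF where "FF = range (op_eval ops)"
  have "(\<lambda>i. p (\<lambda>j. E j i)) \<in> FF" if p: "p \<in> Q" and E: "\<forall>j. E j \<in> FF" for p E
  proof -
    obtain k where k: "ops k = p"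
      using p assms(1) unfolding ops_def by (metis from_nat_into_surj)
    obtain n where n: "\<And>e e'. (\<forall>j<n. e j = e' j) \<Longrightarrow> p e = p e'"
      using assms(2)[OF p] unfolding finitary_def by blast
    have "\<forall>j. \<exists>t. E j = op_eval ops t"
      using E by (simp add: FF_def image_iff)
    then obtain T where T: "\<And>j. E j = op_eval ops (T j)"
      by (auto dest: choice)
    have "(\<lambda>i. p (\<lambda>j. E j i)) = op_eval ops (App k (map T [0..<n]))"
      by (rule ext) (auto simp: k T intro!: n)
    then show ?thesis
      unfolding FF_def by (metis rangeI)
  qed
  moreover have "(\<lambda>i. i) = op_eval ops Point"
    by (rule ext) simp
  then have "(\<lambda>i. i) \<in> FF"
    unfolding FF_def by (metis rangeI)
  moreover have "countable FF"
    by (simp add: FF_def)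
  ultimately show ?thesis
    by (intro exI[of _ FF]) simp
qed

definition stdM :: "(nat, nat set) struct" where
  "stdM = \<lparr>domM = UNIV, setsM = UNIV, zeroM = 0, oneM = 1, addM = (+), mulM = (*),
    eqM = (=), ltM = (<), memM = (\<in>)\<rparr>"

lemma evM_std: "evM stdM e t = eval e t"
  by (induction t) (auto simp: stdM_def)

lemma satM_std: "satM stdM e v \<phi> \<longleftrightarrow> sat e v \<phi>"
  by (induction \<phi> arbitrary: e v) (auto simp: evM_std, auto simp: stdM_def)

interpretation std: model stdM
  by unfold_locales (auto simp: stdM_def)

lemma sat_below:
  "below n m \<phi> \<Longrightarrow> (\<And>i. i < n \<Longrightarrow> e i = e' i) \<Longrightarrow> (\<And>i. i < m \<Longrightarrow> v i = v' i) \<Longrightarrow>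
   sat e v \<phi> \<longleftrightarrow> sat e' v' \<phi>"
  unfolding satM_std[symmetric] by (rule satM_below)

lemma eval_subst: "eval e (subst_tm \<sigma> t) = eval (\<lambda>i. eval e (\<sigma> i)) t"
  unfolding evM_std[symmetric] by (rule evM_subst)

lemma sat_subst: "sat e v (subst \<sigma> \<rho> \<phi>) \<longleftrightarrow> sat (\<lambda>i. eval e (\<sigma> i)) (\<lambda>i. v (\<rho> i)) \<phi>"
  unfolding satM_std[symmetric] evM_std[symmetric] by (rule satM_subst)

definition pair_nat :: "nat \<Rightarrow> nat \<Rightarrow> nat" where
  "pair_nat a b = (a + b) * (a + b) + a"

text \<open>Any internal set is read as a colouring by asking only for the value 0. For a colouring
  in the sense of the model the negative answer means the value 1.\<close>

definition colour :: "nat \<Rightarrow> nat \<Rightarrow> nat \<Rightarrow> bool" where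
  "colour g x y \<longleftrightarrow> pair_nat (pair_nat x y) 0 \<in> set_decode g"

text \<open>Above the cut an internal set need not be closed under prefixes even if it is a tree
  inside the cut, hence the condition on all prefixes.\<close>

definition good :: "nat \<Rightarrow> nat \<Rightarrow> bool" where
  "good t s \<longleftrightarrow> s > 0 \<and> (\<forall>j. s div 2 ^ j > 0 \<longrightarrow> s div 2 ^ j \<in> set_decode t)"

text \<open>The longest prefix outside \<open>t\<close>. If \<open>s\<close> is in \<open>t\<close>,
  then so is the child of this prefix on the way to \<open>s\<close>, which violates the tree
  condition.\<close>

definition missing_prefix :: "nat \<Rightarrow> nat \<Rightarrow> nat" where
  "missing_prefix t s = s div 2 ^ (LEAST j. s div 2 ^ j > 0 \<and> s div 2 ^ j \<notin> set_decode t)"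

text \<open>The numerically largest good node will do: only its position above the cut
  matters.\<close>

definition top_node :: "nat \<Rightarrow> nat" where
  "top_node t = Max {s. good t s}"

definition prefixes :: "nat \<Rightarrow> nat" where
  "prefixes s = set_encode {u. u > 0 \<and> (\<exists>j. u = s div 2 ^ j)}"

text \<open>
  \<open>FF\<close> is the underlying set of the ultrapower; an element also codes an internal set through
  \<^const>\<open>set_decode\<close>. The sequence \<open>X k\<close> of internal sets is generic for \<open>FF\<close>, and the cut is
  the set of elements below the minimum of some \<open>X k\<close>.
\<close>

locale cut = ultrafilter +
  fixes FF :: "(nat \<Rightarrow> nat) set" and X :: "nat \<Rightarrow> nat \<Rightarrow> nat set"
  assumes FF_0: "(\<lambda>i. 0) \<in> FF" and FF_1: "(\<lambda>i. 1) \<in> FF"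
    and FF_add: "f \<in> FF \<Longrightarrow> g \<in> FF \<Longrightarrow> (\<lambda>i. f i + g i) \<in> FF"
    and FF_mul: "f \<in> FF \<Longrightarrow> g \<in> FF \<Longrightarrow> (\<lambda>i. f i * g i) \<in> FF"
    and FF_diff: "f \<in> FF \<Longrightarrow> g \<in> FF \<Longrightarrow> (\<lambda>i. f i - g i) \<in> FF"
    and FF_least: "\<forall>j. e j \<in> FF \<Longrightarrow> \<forall>j. v j \<in> FF \<Longrightarrow>
      (\<lambda>i. LEAST y. sat (case_nat y (\<lambda>j. e j i)) (\<lambda>j. set_decode (v j i)) \<theta>) \<in> FF"
    and FF_image: "c \<in> FF \<Longrightarrow> \<forall>j. e j \<in> FF \<Longrightarrow> \<forall>j. v j \<in> FF \<Longrightarrow>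
      (\<lambda>i. set_encode ((\<lambda>x. LEAST y. sat (case_nat y (case_nat x (\<lambda>j. e j i))) (\<lambda>j. set_decode (v j i)) \<theta>) ` {..c i})) \<in> FF"
    and FF_fail: "c \<in> FF \<Longrightarrow> \<forall>j. e j \<in> FF \<Longrightarrow> \<forall>j. v j \<in> FF \<Longrightarrow>
      (\<lambda>i. LEAST x. \<not> (\<exists>y\<le>c i. sat (case_nat y (case_nat x (\<lambda>j. e j i))) (\<lambda>j. set_decode (v j i)) \<theta>)) \<in> FF"
    and FF_compr: "c \<in> FF \<Longrightarrow> \<forall>j. e j \<in> FF \<Longrightarrow> \<forall>j. v j \<in> FF \<Longrightarrow>
      (\<lambda>i. set_encode {x \<in> {..c i}. sat (case_nat
        (LEAST y. sat (case_nat y (case_nat x (\<lambda>j. e j i))) (\<lambda>j. set_decode (v j i)) \<theta> \<or>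
          \<not> sat (case_nat y (case_nat x (\<lambda>j. e j i))) (\<lambda>j. set_decode (v j i)) \<eta>)
        (case_nat x (\<lambda>j. e j i))) (\<lambda>j. set_decode (v j i)) \<theta>}) \<in> FF"
    and FF_missing: "t \<in> FF \<Longrightarrow> s \<in> FF \<Longrightarrow> (\<lambda>i. missing_prefix (t i) (s i)) \<in> FF"
    and FF_top: "t \<in> FF \<Longrightarrow> (\<lambda>i. top_node (t i)) \<in> FF"
    and FF_prefixes: "s \<in> FF \<Longrightarrow> (\<lambda>i. prefixes (s i)) \<in> FF"
    and FF_X: "(\<lambda>i. set_encode (X k i)) \<in> FF"
    and FF_Min: "(\<lambda>i. Min (X k i)) \<in> FF"
    and FF_Max: "(\<lambda>i. Max (X k i)) \<in> FF"
    and X_finite: "finite (X k i)"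
    and X_nonempty: "eventually (\<lambda>i. X k i \<noteq> {}) U"
    and X_ge: "eventually (\<lambda>i. \<forall>x\<in>X k i. 4 \<le> x) U"
    and X_Suc: "eventually (\<lambda>i. X (Suc k) i \<subseteq> X k i) U"
    and X_square: "eventually (\<lambda>i. \<forall>y\<in>X (Suc k) i. Min (X k i) * Min (X k i) < y) U"
    and X_homogeneous: "g \<in> FF \<Longrightarrow> \<exists>k. eventually (\<lambda>i. homogeneous (colour (g i)) (X k i)) U"
    and X_gap: "g \<in> FF \<Longrightarrow> eventually (\<lambda>i. c i < Min (X l i)) U \<Longrightarrow>
      eventually (\<lambda>i. card (set_decode (g i)) \<le> Suc (c i)) U \<Longrightarrow>
      \<exists>k. eventually (\<lambda>i. \<forall>a\<in>X k i. \<forall>b\<in>X k i. \<forall>e\<in>set_decode (g i). e \<le> a \<or> b < e) U"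
begin

lemma X_antimono: "k \<le> l \<Longrightarrow> eventually (\<lambda>i. X l i \<subseteq> X k i) U"
proof (induction l rule: dec_induct)
  case (step l)
  from step.IH X_Suc[of l] show ?case
    by eventually_elim blast
qed simp

lemma Min_X: "eventually (\<lambda>i. Min (X k i) \<in> X k i) U"
  using X_nonempty[of k] by eventually_elim (simp add: X_finite)

lemma Min_mono: "k \<le> l \<Longrightarrow> eventually (\<lambda>i. Min (X k i) \<le> Min (X l i)) U"
proof -
  assume "k \<le> l"
  from X_antimono[OF this] Min_X[of l] show ?thesis
    by eventually_elim (meson Min_le X_finite subsetD)
qed

definition I :: "(nat \<Rightarrow> nat) set" where
  "I = {f \<in> FF. \<exists>k. eventually (\<lambda>i. f i < Min (X k i)) U}"

lemma I_FF: "f \<in> I \<Longrightarrow> f \<in> FF"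
  by (simp add: I_def)

lemma I_downward: "g \<in> FF \<Longrightarrow> f \<in> I \<Longrightarrow> eventually (\<lambda>i. g i \<le> f i) U \<Longrightarrow> g \<in> I"
proof -
  assume *: "g \<in> FF" "f \<in> I" "eventually (\<lambda>i. g i \<le> f i) U"
  then obtain k where "eventually (\<lambda>i. f i < Min (X k i)) U"
    by (auto simp: I_def)
  with *(3) have "eventually (\<lambda>i. g i < Min (X k i)) U"
    by eventually_elim simp
  with *(1) show ?thesis
    by (auto simp: I_def)
qed

lemma Min_less_Suc: "eventually (\<lambda>i. Min (X k i) * Min (X k i) < Min (X (Suc k) i) \<and> 4 \<le> Min (X k i)) U"
  using X_square[of k] Min_X[of "Suc k"] Min_X[of k] X_ge[of k] by eventually_elim blast

lemma Min_I: "(\<lambda>i. Min (X k i)) \<in> I"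
proof -
  have "eventually (\<lambda>i. Min (X k i) < Min (X (Suc k) i)) U"
    using Min_less_Suc[of k]
  proof eventually_elim
    case (elim i)
    have "Min (X k i) * 1 \<le> Min (X k i) * Min (X k i)"
      using elim by (intro mult_le_mono2) simp
    with elim show ?case by linarith
  qed
  then show ?thesis
    using FF_Min by (auto simp: I_def)
qed

lemma I_bound2:
  assumes "f \<in> I" "g \<in> I"
  obtains k where "eventually (\<lambda>i. f i < Min (X k i) \<and> g i < Min (X k i)) U"
proof -
  obtain k l where *: "eventually (\<lambda>i. f i < Min (X k i)) U" "eventually (\<lambda>i. g i < Min (X l i)) U"
    using assms by (auto simp: I_def)
  have "eventually (\<lambda>i. f i < Min (X (max k l) i) \<and> g i < Min (X (max k l) i)) U"
    using * Min_mono[OF max.cobounded1[of k l]] Min_mono[OF max.cobounded2[of l k]]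
    by eventually_elim simp
  with that show thesis by blast
qed

lemma I_add: assumes "f \<in> I" "g \<in> I" shows "(\<lambda>i. f i + g i) \<in> I"
proof -
  obtain k where "eventually (\<lambda>i. f i < Min (X k i) \<and> g i < Min (X k i)) U"
    using I_bound2[OF assms] by blast
  then have "eventually (\<lambda>i. f i + g i < Min (X (Suc k) i)) U"
    using Min_less_Suc[of k]
  proof eventually_elim
    case (elim i)
    then have "4 * Min (X k i) \<le> Min (X k i) * Min (X k i)"
      by (intro mult_le_mono1) simp
    with elim show ?case by linarith
  qed
  then show ?thesis
    using FF_add assms by (auto simp: I_def)
qed

lemma I_mul: assumes "f \<in> I" "g \<in> I" shows "(\<lambda>i. f i * g i) \<in> I"
proof -
  obtain k where "eventually (\<lambda>i. f i < Min (X k i) \<and> g i < Min (X k i)) U"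
    using I_bound2[OF assms] by blast
  then have "eventually (\<lambda>i. f i * g i < Min (X (Suc k) i)) U"
    using Min_less_Suc[of k]
  proof eventually_elim
    case (elim i)
    then have "f i * g i \<le> Min (X k i) * Min (X k i)"
      by (intro mult_le_mono) auto
    with elim show ?case by linarith
  qed
  then show ?thesis
    using FF_mul assms by (auto simp: I_def)
qed

lemma I_0: "(\<lambda>i. 0) \<in> I"
  by (rule I_downward[OF FF_0 Min_I[of 0]]) simp

lemma I_1: "(\<lambda>i. 1) \<in> I"
  by (rule I_downward[OF FF_1 Min_I[of 0]]) (use Min_less_Suc[of 0] in \<open>auto elim: eventually_mono\<close>)

text \<open>The later sets are contained in \<open>X k\<close>, so their minima, which are cofinal
  in the cut, stay below \<open>Max (X k i)\<close>: the cut is bounded in the ultrapower.\<close>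

lemma I_below_Max: "f \<in> I \<Longrightarrow> eventually (\<lambda>i. f i < Max (X k i)) U"
proof -
  assume "f \<in> I"
  then obtain l where l: "eventually (\<lambda>i. f i < Min (X l i)) U"
    by (auto simp: I_def)
  have "eventually (\<lambda>i. X (max k l) i \<subseteq> X k i) U"
    by (rule X_antimono) simp
  moreover have "eventually (\<lambda>i. Min (X l i) \<le> Min (X (max k l) i)) U"
    by (rule Min_mono) simp
  ultimately show ?thesis
    using l Min_X[of "max k l"]
  proof eventually_elim
    case (elim i)
    then have "Min (X (max k l) i) \<le> Max (X k i)"
      by (intro Max_ge) (auto simp: X_finite)
    with elim show ?case by linarith
  qed
qed

definition MM :: "(nat \<Rightarrow> nat, nat \<Rightarrow> nat) struct" where
  "MM = \<lparr>domM = I, setsM = FF, zeroM = (\<lambda>i. 0), oneM = (\<lambda>i. 1),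
    addM = (\<lambda>f g i. f i + g i), mulM = (\<lambda>f g i. f i * g i),
    eqM = (\<lambda>f g. eventually (\<lambda>i. f i = g i) U), ltM = (\<lambda>f g. eventually (\<lambda>i. f i < g i) U),
    memM = (\<lambda>f a. eventually (\<lambda>i. f i \<in> set_decode (a i)) U)\<rparr>"

lemma MM_simps [simp]:
  "domM MM = I" "setsM MM = FF" "zeroM MM = (\<lambda>i. 0)" "oneM MM = (\<lambda>i. 1)"
  "addM MM f g = (\<lambda>i. f i + g i)" "mulM MM f g = (\<lambda>i. f i * g i)"
  "eqM MM f g \<longleftrightarrow> eventually (\<lambda>i. f i = g i) U" "ltM MM f g \<longleftrightarrow> eventually (\<lambda>i. f i < g i) U"
  "memM MM f a \<longleftrightarrow> eventually (\<lambda>i. f i \<in> set_decode (a i)) U"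
  by (simp_all add: MM_def)

sublocale MM: model MM
proof
  fix f f' g g' a :: "nat \<Rightarrow> nat"
  show "eqM MM f f' \<Longrightarrow> eqM MM f' f"
    by (auto elim: eventually_mono)
  assume 1: "eqM MM f f'"
  then show "memM MM f a \<Longrightarrow> memM MM f' a"
    by (auto elim: eventually_elim2)
  assume 2: "eqM MM g g'"
  from 1 2 show "eqM MM (addM MM f g) (addM MM f' g')" "eqM MM (mulM MM f g) (mulM MM f' g')"
    by (auto elim: eventually_elim2)
  have 12: "eventually (\<lambda>i. f i = f' i \<and> g i = g' i) U"
    using 1 2 by (simp add: eventually_conj_iff)
  show "eqM MM f' g'" if "eqM MM f g"
    using 12 that unfolding MM_simps by eventually_elim simp
  show "ltM MM f' g'" if "ltM MM f g"
    using 12 that unfolding MM_simps by eventually_elim simp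
qed (simp_all add: I_0 I_1[simplified] I_add I_mul)

lemma ev_MM: "evM MM e t i = eval (\<lambda>j. e j i) t"
  by (induction t) auto

lemma case_nat_app: "(\<lambda>j. case_nat x e j i) = case_nat (x i) (\<lambda>j. e j i)"
  by (auto split: nat.splits)

lemma env_MM: "env MM e v \<longleftrightarrow> (\<forall>j. e j \<in> I) \<and> (\<forall>j. v j \<in> FF)"
  by (simp add: env_def)

lemma ex_witness:
  assumes "\<forall>j. e j \<in> FF" "\<forall>j. v j \<in> FF" "b \<in> I"
    and "eventually (\<lambda>i. \<exists>y\<le>b i. sat (case_nat y (\<lambda>j. e j i)) (\<lambda>j. set_decode (v j i)) \<theta>) U"
  obtains w where "w \<in> I" "eventually (\<lambda>i. sat (case_nat (w i) (\<lambda>j. e j i)) (\<lambda>j. set_decode (v j i)) \<theta>) U"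
proof -
  define w where "w i = (LEAST y. sat (case_nat y (\<lambda>j. e j i)) (\<lambda>j. set_decode (v j i)) \<theta>)" for i
  have "w \<in> FF"
    unfolding w_def by (rule FF_least[OF assms(1,2)])
  moreover have "eventually (\<lambda>i. w i \<le> b i) U"
    using assms(4) unfolding w_def by eventually_elim (meson Least_le le_trans)
  ultimately have "w \<in> I"
    using assms(3) I_downward by blast
  moreover have "eventually (\<lambda>i. sat (case_nat (w i) (\<lambda>j. e j i)) (\<lambda>j. set_decode (v j i)) \<theta>) U"
    using assms(4) unfolding w_def by eventually_elim (metis LeastI)
  ultimately show thesis
    using that by blast
qed

text \<open>Restricted to bounded formulas, since the domain is the cut and not the whole
  ultrapower: least witnesses form a function of \<open>FF\<close>, and a bound in the cut puts that
  function into the cut.\<close>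

lemma los:
  "bounded_fm \<theta> \<Longrightarrow> env MM e v \<Longrightarrow>
    satM MM e v \<theta> \<longleftrightarrow> eventually (\<lambda>i. sat (\<lambda>j. e j i) (\<lambda>j. set_decode (v j i)) \<theta>) U"
proof (induction arbitrary: e v rule: bounded_fm.induct)
  case (9 \<phi> t)
  show ?case
  proof
    assume "satM MM e v (ExN (Var 0 \<^bold>< lift_tm t \<^bold>\<and> \<phi>))"
    then obtain x where x: "x \<in> I" "satM MM (case_nat x e) v (Var 0 \<^bold>< lift_tm t \<^bold>\<and> \<phi>)"
      by auto
    then have "env MM (case_nat x e) v"
      using "9.prems" by auto
    from "9.IH"[OF this] x(2) "9.prems"
    have "eventually (\<lambda>i. x i < eval (\<lambda>j. e j i) t) U"
      "eventually (\<lambda>i. sat (case_nat (x i) (\<lambda>j. e j i)) (\<lambda>j. set_decode (v j i)) \<phi>) U"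
      by (simp_all add: case_nat_app ev_MM evM_subst)
    then show "eventually (\<lambda>i. sat (\<lambda>j. e j i) (\<lambda>j. set_decode (v j i)) (ExN (Var 0 \<^bold>< lift_tm t \<^bold>\<and> \<phi>))) U"
      by eventually_elim (auto simp: eval_subst)
  next
    let ?\<theta> = "Var 0 \<^bold>< lift_tm t \<^bold>\<and> \<phi>"
    assume *: "eventually (\<lambda>i. sat (\<lambda>j. e j i) (\<lambda>j. set_decode (v j i)) (ExN ?\<theta>)) U"
    have b: "evM MM e t \<in> I" and FFe: "\<forall>j. e j \<in> FF" and FFv: "\<forall>j. v j \<in> FF"
      using MM.ev_dom[OF "9.prems"] "9.prems" I_FF by (auto simp: env_MM)
    have "eventually (\<lambda>i. \<exists>y\<le>evM MM e t i. sat (case_nat y (\<lambda>j. e j i)) (\<lambda>j. set_decode (v j i)) ?\<theta>) U"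
      using * by eventually_elim (auto simp: eval_subst ev_MM intro: less_imp_le)
    then obtain w where w: "w \<in> I" "eventually (\<lambda>i. sat (case_nat (w i) (\<lambda>j. e j i)) (\<lambda>j. set_decode (v j i)) ?\<theta>) U"
      using ex_witness[OF FFe FFv b] by blast
    then have "env MM (case_nat w e) v"
      using "9.prems" by auto
    from "9.IH"[OF this] w have "satM MM (case_nat w e) v ?\<theta>"
      by (simp add: case_nat_app ev_MM evM_subst eval_subst eventually_conj_iff)
    with w(1) show "satM MM e v (ExN ?\<theta>)" by auto
  qed
next
  case (8 \<phi> t)
  let ?\<theta> = "Var 0 \<^bold>< lift_tm t \<^bold>\<longrightarrow> \<phi>"
  show ?case
  proof (rule iffI, rule ccontr)
    assume L: "satM MM e v (AllN ?\<theta>)"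
      and R: "\<not> eventually (\<lambda>i. sat (\<lambda>j. e j i) (\<lambda>j. set_decode (v j i)) (AllN ?\<theta>)) U"
    have b: "evM MM e t \<in> I" and FFe: "\<forall>j. e j \<in> FF" and FFv: "\<forall>j. v j \<in> FF"
      using MM.ev_dom[OF "8.prems"] "8.prems" I_FF by (auto simp: env_MM)
    have "eventually (\<lambda>i. \<not> sat (\<lambda>j. e j i) (\<lambda>j. set_decode (v j i)) (AllN ?\<theta>)) U"
      by (subst ev_not) (fact R)
    then have "eventually (\<lambda>i. \<exists>y\<le>evM MM e t i. sat (case_nat y (\<lambda>j. e j i)) (\<lambda>j. set_decode (v j i)) (\<^bold>\<not> ?\<theta>)) U"
      by eventually_elim (auto simp: eval_subst ev_MM intro: less_imp_le)
    then obtain w where w: "w \<in> I" "eventually (\<lambda>i. sat (case_nat (w i) (\<lambda>j. e j i)) (\<lambda>j. set_decode (v j i)) (\<^bold>\<not> ?\<theta>)) U"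
      using ex_witness[OF FFe FFv b] by blast
    then have "env MM (case_nat w e) v"
      using "8.prems" by auto
    from "8.IH"[OF this] w L[simplified, rule_format, OF w(1)] show False
      by (simp add: case_nat_app ev_MM evM_subst eval_subst eventually_conj_iff ev_not)
  next
    assume R: "eventually (\<lambda>i. sat (\<lambda>j. e j i) (\<lambda>j. set_decode (v j i)) (AllN ?\<theta>)) U"
    have "satM MM (case_nat x e) v ?\<theta>" if x: "x \<in> I" for x
    proof -
      have "env MM (case_nat x e) v"
        using "8.prems" x by auto
      note IH = "8.IH"[OF this]
      have "eventually (\<lambda>i. x i < eval (\<lambda>j. e j i) t \<longrightarrow> sat (case_nat (x i) (\<lambda>j. e j i)) (\<lambda>j. set_decode (v j i)) \<phi>) U"
        using R by eventually_elim (simp add: eval_subst)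
      then show ?thesis
        by (simp add: IH case_nat_app ev_MM evM_subst ev_imp)
    qed
    then show "satM MM e v (AllN ?\<theta>)" by simp
  qed
qed (simp_all add: ev_MM ev_imp ev_disj eventually_conj_iff eventually_False not_bot)

end

\<comment> \<open>The axioms of the base theory in the cut\<close>
inductive_simps bounded_fm_simps [simp]:
  "bounded_fm \<^bold>\<bottom>" "bounded_fm (s \<^bold>= t)" "bounded_fm (s \<^bold>< t)" "bounded_fm (t \<^bold>\<in> X)"
  "bounded_fm (\<phi> \<^bold>\<longrightarrow> \<psi>)" "bounded_fm (\<phi> \<^bold>\<and> \<psi>)" "bounded_fm (\<phi> \<^bold>\<or> \<psi>)"

text \<open>The existence of differences is the only axiom with an unbounded quantifier; the others
  transfer from the standard model by \<open>los\<close>.\<close>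

lemma semiring_axiom_cases:
  assumes "\<phi> \<in> discrete_ordered_semiring"
  shows "bounded_fm \<phi> \<and> (\<forall>e v. sat e v \<phi>) \<or>
    \<phi> = (Var 0 \<^bold>< Var 1 \<^bold>\<longrightarrow> ExN (lift_tm (Var 0) \<^bold>+ Var 0 \<^bold>= lift_tm (Var 1)))"
  using assms unfolding discrete_ordered_semiring_def Let_def
  by (elim insertE emptyE) (simp_all add: algebra_simps, auto)

context cut
begin

lemma los_valid:
  assumes "bounded_fm \<theta>" "\<And>e v. sat e v \<theta>" "env MM e v"
  shows "satM MM e v \<theta>"
  using los[OF assms(1,3)] assms(2) by simp

lemma MM_semiring:
  assumes "\<phi> \<in> discrete_ordered_semiring" "env MM e v"
  shows "satM MM e v \<phi>"
proof -
  consider "bounded_fm \<phi>" "\<And>e v. sat e v \<phi>"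
    | "\<phi> = (Var 0 \<^bold>< Var 1 \<^bold>\<longrightarrow> ExN (lift_tm (Var 0) \<^bold>+ Var 0 \<^bold>= lift_tm (Var 1)))"
    using semiring_axiom_cases[OF assms(1)] by blast
  then show ?thesis
  proof cases
    case 2
    let ?f = "\<lambda>i. e 1 i - e 0 i"
    have e: "e 0 \<in> FF" "e 1 \<in> FF" "e 1 \<in> I"
      using assms(2) I_FF by (auto simp: env_MM)
    then have "?f \<in> I"
      using FF_diff by (intro I_downward[OF _ e(3)]) auto
    moreover have "eventually (\<lambda>i. e 0 i + ?f i = e 1 i) U" if "eventually (\<lambda>i. e 0 i < e 1 i) U"
      using that by eventually_elim simp
    ultimately show ?thesis
      unfolding 2 by (auto intro!: bexI[of _ ?f])
  qed (rule los_valid[OF _ _ assms(2)])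
qed

abbreviation "W \<theta> e v i y x \<equiv> sat (case_nat y (case_nat x (\<lambda>j. e j i))) (\<lambda>j. set_decode (v j i)) \<theta>"

lemma sat_ExN_iff:
  assumes "bounded_fm \<theta>" "env MM e v" "x \<in> I"
  shows "satM MM (case_nat x e) v (ExN \<theta>) \<longleftrightarrow> (\<exists>y\<in>I. eventually (\<lambda>i. W \<theta> e v i (y i) (x i)) U)"
proof -
  have "satM MM (case_nat y (case_nat x e)) v \<theta> \<longleftrightarrow> eventually (\<lambda>i. W \<theta> e v i (y i) (x i)) U" if "y \<in> I" for y
  proof -
    have "env MM (case_nat y (case_nat x e)) v"
      using assms(2,3) that by (intro MM.env_case_nat) auto
    from los[OF assms(1) this] show ?thesis
      by (simp add: case_nat_app)
  qed
  then show ?thesis by auto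
qed

lemma env_FF: "env MM e v \<Longrightarrow> \<forall>j. e j \<in> FF" "env MM e v \<Longrightarrow> \<forall>j. v j \<in> FF"
  "env MM e v \<Longrightarrow> x \<in> I \<Longrightarrow> \<forall>j. case_nat x e j \<in> FF"
  using I_FF by (auto simp: env_MM split: nat.splits)

text \<open>
  By the gap property there is \<open>d \<in> I\<close> such that every \<open>x \<le> c\<close> with a witness in the cut
  has one below \<open>d\<close>. Hence \<open>\<Sigma>\<^sub>1\<close> formulas define internal sets below \<open>c\<close>.
\<close>

lemma Sigma1_bound:
  assumes \<theta>: "bounded_fm \<theta>" and env: "env MM e v" and c: "c \<in> I"
  obtains d where "d \<in> I" "\<And>x. x \<in> I \<Longrightarrow> eventually (\<lambda>i. x i \<le> c i) U \<Longrightarrow>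
    satM MM (case_nat x e) v (ExN \<theta>) \<longleftrightarrow> eventually (\<lambda>i. \<exists>y\<le>d i. W \<theta> e v i y (x i)) U"
proof -
  define w where "w x i = (LEAST y. W \<theta> e v i y x)" for x i
  \<comment> \<open>\<open>g\<close> codes the least witnesses for all \<open>x\<close> up to
    \<open>c\<close>, at most \<open>c + 1\<close> numbers. With a gap of \<open>X k\<close> for
    this set, a least witness is either at most \<open>Min (X k i)\<close> or above all of
    \<open>X k i\<close>, hence above the cut.\<close>
  define g where "g i = set_encode ((\<lambda>x. w x i) ` {..c i})" for i
  have g: "g \<in> FF"
    unfolding g_def w_def using FF_image[OF I_FF[OF c] env_FF(1,2)[OF env]] .
  have dec: "set_decode (g i) = (\<lambda>x. w x i) ` {..c i}" for i
    by (simp add: g_def)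
  have card: "card (set_decode (g i)) \<le> Suc (c i)" for i
    unfolding dec using card_image_le[of "{..c i}" "\<lambda>x. w x i"] by simp
  obtain l where "eventually (\<lambda>i. c i < Min (X l i)) U"
    using c by (auto simp: I_def)
  then obtain k where k: "eventually (\<lambda>i. \<forall>a\<in>X k i. \<forall>b\<in>X k i. \<forall>e\<in>set_decode (g i). e \<le> a \<or> b < e) U"
    using X_gap[OF g, of c l] card by (auto simp: always_eventually)
  show thesis
  proof (rule that[of "\<lambda>i. Min (X k i)"])
    fix x assume x: "x \<in> I" "eventually (\<lambda>i. x i \<le> c i) U"
    show "satM MM (case_nat x e) v (ExN \<theta>) \<longleftrightarrow> eventually (\<lambda>i. \<exists>y\<le>Min (X k i). W \<theta> e v i y (x i)) U"
    proof
      assume "satM MM (case_nat x e) v (ExN \<theta>)"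
      then obtain y where y: "y \<in> I" "eventually (\<lambda>i. W \<theta> e v i (y i) (x i)) U"
        using sat_ExN_iff[OF \<theta> env x(1)] by blast
      obtain l where l: "eventually (\<lambda>i. y i < Min (X l i)) U"
        using y(1) by (auto simp: I_def)
      have "eventually (\<lambda>i. X (max k l) i \<subseteq> X k i) U" "eventually (\<lambda>i. Min (X l i) \<le> Min (X (max k l) i)) U"
        by (simp_all add: X_antimono Min_mono)
      with y(2) l k x(2) Min_X[of "max k l"] Min_X[of k]
      show "eventually (\<lambda>i. \<exists>y\<le>Min (X k i). W \<theta> e v i y (x i)) U"
      proof eventually_elim
        case (elim i)
        have "W \<theta> e v i (w (x i) i) (x i)"
          unfolding w_def using elim(1) by (rule LeastI)
        moreover have "w (x i) i \<le> y i"
          unfolding w_def using elim(1) by (rule Least_le)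
        moreover have "w (x i) i \<in> set_decode (g i)"
          using elim(4) by (simp add: dec)
        moreover have "Min (X (max k l) i) \<in> X k i"
          using elim by blast
        ultimately have "W \<theta> e v i (w (x i) i) (x i)" "w (x i) i \<le> Min (X k i)"
          using elim(2,8) bspec[OF bspec[OF bspec[OF elim(3) elim(6)], of "Min (X (max k l) i)"], of "w (x i) i"]
          by auto
        then show ?case by blast
      qed
    next
      assume "eventually (\<lambda>i. \<exists>y\<le>Min (X k i). W \<theta> e v i y (x i)) U"
      then obtain y where "y \<in> I" "eventually (\<lambda>i. sat (case_nat (y i) (\<lambda>j. case_nat x e j i)) (\<lambda>j. set_decode (v j i)) \<theta>) U"
        using ex_witness[OF env_FF(3)[OF env x(1)] env_FF(2)[OF env] Min_I[of k], of \<theta>]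
        by (auto simp: case_nat_app)
      then show "satM MM (case_nat x e) v (ExN \<theta>)"
        using sat_ExN_iff[OF \<theta> env x(1)] by (auto simp: case_nat_app)
    qed
  qed (rule Min_I)
qed

text \<open>By \<open>Sigma1_bound\<close> the formula agrees below \<open>c\<close> with a
  condition that can be evaluated in the ultrapower. The least failure of that condition is at most
  \<open>c\<close>, so it lies in the cut, and its predecessor contradicts the induction
  step.\<close>

lemma MM_induction:
  assumes "Sigma01 \<phi>" "env MM e v"
  shows "satM MM e v (induction_axiom \<phi>)"
proof -
  obtain \<theta> where \<theta>: "bounded_fm \<theta>" "\<phi> = ExN \<theta>"
    using assms(1) by (auto simp: Sigma01_def)
  define P where "P x \<longleftrightarrow> satM MM (case_nat x e) v \<phi>" for x
  have P_Suc: "satM MM (case_nat x e) v (subst (case_nat (Var 0 \<^bold>+ \<^bold>1) (\<lambda>i. Var (Suc i))) id \<phi>) \<longleftrightarrow>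
    P (\<lambda>i. x i + 1)" for x
  proof -
    have "(\<lambda>i. evM MM (case_nat x e) (case_nat (Var 0 \<^bold>+ \<^bold>1) (\<lambda>i. Var (Suc i)) i)) = case_nat (\<lambda>i. x i + 1) e"
      by (auto split: nat.splits)
    then show ?thesis
      by (simp add: satM_subst P_def)
  qed
  have "P c" if c: "c \<in> I" and 0: "P (\<lambda>i. 0)" and step: "\<And>x. x \<in> I \<Longrightarrow> P x \<Longrightarrow> P (\<lambda>i. x i + 1)" for c
  proof (rule ccontr)
    assume neg: "\<not> P c"
    obtain d where d: "d \<in> I" "\<And>x. x \<in> I \<Longrightarrow> eventually (\<lambda>i. x i \<le> c i) U \<Longrightarrow>
        P x \<longleftrightarrow> eventually (\<lambda>i. \<exists>y\<le>d i. W \<theta> e v i y (x i)) U"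
      unfolding P_def \<theta>(2) using Sigma1_bound[OF \<theta>(1) assms(2) c] by blast
    define z where "z i = (LEAST x. \<not> (\<exists>y\<le>d i. W \<theta> e v i y x))" for i
    have zF: "z \<in> FF"
      unfolding z_def using FF_fail[OF I_FF[OF d(1)] env_FF(1,2)[OF assms(2)]] .
    have "\<not> eventually (\<lambda>i. \<exists>y\<le>d i. W \<theta> e v i y (c i)) U"
      using neg d(2)[OF c] by simp
    then have ev: "eventually (\<lambda>i. \<not> (\<exists>y\<le>d i. W \<theta> e v i y (c i))) U"
      by (subst ev_not)
    then have zc: "eventually (\<lambda>i. z i \<le> c i) U"
      by eventually_elim (unfold z_def, erule Least_le)
    from ev have fail: "eventually (\<lambda>i. \<not> (\<exists>y\<le>d i. W \<theta> e v i y (z i))) U"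
      by eventually_elim (unfold z_def, erule LeastI)
    have zI: "z \<in> I"
      by (rule I_downward[OF zF c zc])
    have "eventually (\<lambda>i. \<exists>y\<le>d i. W \<theta> e v i y 0) U"
      using d(2)[OF I_0] 0 by simp
    with fail have pos: "eventually (\<lambda>i. 0 < z i) U"
      by eventually_elim (metis gr0I)
    let ?p = "\<lambda>i. z i - 1"
    have pI: "?p \<in> I"
      by (rule I_downward[OF FF_diff[OF zF FF_1] zI]) simp
    have "eventually (\<lambda>i. \<exists>y\<le>d i. W \<theta> e v i y (?p i)) U"
      using pos
    proof eventually_elim
      case (elim i)
      then have "z i - 1 < z i" by simp
      then show ?case
        unfolding z_def using not_less_Least by blast
    qed
    moreover have "eventually (\<lambda>i. ?p i \<le> c i) U"
      using zc by eventually_elim simp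
    ultimately have "P (\<lambda>i. ?p i + 1)"
      using d(2)[OF pI] step[OF pI] by blast
    moreover have "(\<lambda>i. ?p i + 1) \<in> I"
      using I_add[OF pI I_1] .
    moreover have "eventually (\<lambda>i. ?p i + 1 \<le> c i) U"
      using zc pos by eventually_elim simp
    ultimately have "eventually (\<lambda>i. \<exists>y\<le>d i. W \<theta> e v i y (?p i + 1)) U"
      using d(2) by blast
    moreover have "eventually (\<lambda>i. ?p i + 1 = z i) U"
      using pos by eventually_elim simp
    ultimately have "eventually (\<lambda>i. False) U"
      using fail by eventually_elim metis
    then show False
      using not_bot by (simp add: eventually_False)
  qed
  moreover have "satM MM e v (induction_axiom \<phi>) \<longleftrightarrow>
      (P (\<lambda>i. 0) \<and> (\<forall>x\<in>I. P x \<longrightarrow> P (\<lambda>i. x i + 1)) \<longrightarrow> (\<forall>x\<in>I. P x))"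
    unfolding induction_axiom_def satM.simps(5,6,8) P_Suc MM.sat_instN unfolding P_def by simp
  ultimately show ?thesis
    by blast
qed

text \<open>Search for the least number that verifies \<open>\<theta>\<close> or refutes
  \<open>\<eta>\<close>. As both formulas agree, the search ends inside the cut, so testing
  \<open>\<theta>\<close> at its result defines the set internally; the bound
  \<open>Max (X 0 i)\<close> covers the cut.\<close>

lemma MM_comprehension:
  assumes "Sigma01 \<phi>" "Pi01 \<psi>" "env MM e v"
  shows "satM MM e v (comprehension_axiom \<phi> \<psi>)"
proof -
  obtain \<theta> where \<theta>: "bounded_fm \<theta>" "\<phi> = ExN \<theta>"
    using assms(1) by (auto simp: Sigma01_def)
  obtain \<eta> where \<eta>: "bounded_fm \<eta>" "\<psi> = AllN \<eta>"
    using assms(2) by (auto simp: Pi01_def)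
  have bn: "bounded_fm (\<^bold>\<not> \<eta>)"
    using \<eta>(1) by (auto intro: bounded_fm.intros)
  define w where "w i x = (LEAST y. W \<theta> e v i y x \<or> \<not> W \<eta> e v i y x)" for i x
  define b where "b i = Max (X 0 i)" for i
  define A where "A i = set_encode {x \<in> {..b i}. W \<theta> e v i (w i x) x}" for i
  have AF: "A \<in> FF"
    unfolding A_def w_def b_def
    using FF_compr[OF FF_Max env_FF(1,2)[OF assms(3)]] .
  have "eventually (\<lambda>i. x i \<in> set_decode (A i)) U \<longleftrightarrow> satM MM (case_nat x e) v \<phi>"
    if eq: "satM MM (case_nat x e) v \<phi> \<longleftrightarrow> satM MM (case_nat x e) v \<psi>" and x: "x \<in> I" for x
  proof -
    have xb: "eventually (\<lambda>i. x i \<le> b i) U"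
      using I_below_Max[OF x, of 0] unfolding b_def by eventually_elim simp
    have neg: "\<not> satM MM (case_nat x e) v \<psi> \<longleftrightarrow> satM MM (case_nat x e) v (ExN (\<^bold>\<not> \<eta>))"
      by (simp add: \<eta>(2))
    have "\<exists>y\<in>I. eventually (\<lambda>i. W \<theta> e v i (y i) (x i) \<or> \<not> W \<eta> e v i (y i) (x i)) U"
    proof (cases "satM MM (case_nat x e) v \<phi>")
      case True
      then obtain y where y: "y \<in> I" "eventually (\<lambda>i. W \<theta> e v i (y i) (x i)) U"
        using sat_ExN_iff[OF \<theta>(1) assms(3) x] \<theta>(2) by blast
      from y(2) have "eventually (\<lambda>i. W \<theta> e v i (y i) (x i) \<or> \<not> W \<eta> e v i (y i) (x i)) U"
        by eventually_elim simp
      with y(1) show ?thesis by blast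
    next
      case False
      then have "satM MM (case_nat x e) v (ExN (\<^bold>\<not> \<eta>))"
        using eq neg by simp
      then obtain y where y: "y \<in> I" "eventually (\<lambda>i. W (\<^bold>\<not> \<eta>) e v i (y i) (x i)) U"
        using sat_ExN_iff[OF bn assms(3) x] by blast
      from y(2) have "eventually (\<lambda>i. W \<theta> e v i (y i) (x i) \<or> \<not> W \<eta> e v i (y i) (x i)) U"
        by eventually_elim simp
      with y(1) show ?thesis by blast
    qed
    then obtain y where y: "y \<in> I" "eventually (\<lambda>i. W \<theta> e v i (y i) (x i) \<or> \<not> W \<eta> e v i (y i) (x i)) U"
      by blast
    let ?w = "\<lambda>i. w i (x i)"
    have "(\<lambda>i. LEAST y. sat (case_nat y (\<lambda>j. case_nat x e j i)) (\<lambda>j. set_decode (v j i)) (\<theta> \<^bold>\<or> \<^bold>\<not> \<eta>)) \<in> FF"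
      by (rule FF_least[OF env_FF(3)[OF assms(3) x] env_FF(2)[OF assms(3)]])
    then have wF: "?w \<in> FF"
      by (simp add: w_def case_nat_app)
    have "eventually (\<lambda>i. ?w i \<le> y i) U"
      using y(2) unfolding w_def by eventually_elim (rule Least_le)
    then have wI: "?w \<in> I"
      using I_downward[OF wF y(1)] by blast
    have w: "eventually (\<lambda>i. W \<theta> e v i (?w i) (x i) \<or> \<not> W \<eta> e v i (?w i) (x i)) U"
      using y(2) unfolding w_def by eventually_elim (rule LeastI)
    have mem: "eventually (\<lambda>i. x i \<in> set_decode (A i)) U \<longleftrightarrow> eventually (\<lambda>i. W \<theta> e v i (?w i) (x i)) U"
      by (rule eventually_subst) (use xb in \<open>eventually_elim, simp add: A_def\<close>)
    show ?thesis
    proof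
      assume "eventually (\<lambda>i. x i \<in> set_decode (A i)) U"
      then show "satM MM (case_nat x e) v \<phi>"
        using sat_ExN_iff[OF \<theta>(1) assms(3) x] \<theta>(2) wI mem by auto
    next
      assume \<phi>: "satM MM (case_nat x e) v \<phi>"
      show "eventually (\<lambda>i. x i \<in> set_decode (A i)) U"
      proof (rule ccontr)
        assume "\<not> ?thesis"
        then have "\<not> eventually (\<lambda>i. W \<theta> e v i (?w i) (x i)) U"
          by (simp add: mem)
        then have "eventually (\<lambda>i. W (\<^bold>\<not> \<eta>) e v i (?w i) (x i)) U"
          using w by (auto simp: ev_disj)
        then have "satM MM (case_nat x e) v (ExN (\<^bold>\<not> \<eta>))"
          unfolding sat_ExN_iff[OF bn assms(3) x] using wI by (intro bexI[of _ ?w])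
        with neg eq \<phi> show False by blast
      qed
    qed
  qed
  then have "satM MM e (case_nat A v) (AllN (Var 0 \<^bold>\<in> 0 \<^bold>\<longleftrightarrow> liftS \<phi>))" if "satM MM e v (AllN (\<phi> \<^bold>\<longleftrightarrow> \<psi>))"
    using that by auto
  then show ?thesis
    unfolding comprehension_axiom_def satM.simps(5) satM.simps(11) MM_simps(2) using AF by blast
qed

end

section \<open>Weak Koenig's lemma and Ramsey's theorem in the cut\<close>

declare set_decode_0 [simp del] set_decode_Suc [simp del]

lemma finite_good: "finite {s. good t s}"
proof (rule finite_subset)
  show "{s. good t s} \<subseteq> set_decode t"
    unfolding good_def by (metis (mono_tags, lifting) div_by_1 mem_Collect_eq power_0 subsetI)
qed simp

lemma prefixes_decode: "set_decode (prefixes m) = {u. u > 0 \<and> (\<exists>j. u = m div 2 ^ j)}"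
proof -
  have "{u. u > 0 \<and> (\<exists>j. u = m div 2 ^ j)} \<subseteq> {..m}"
    by auto
  then have "finite {u. u > 0 \<and> (\<exists>j. u = m div 2 ^ j)}"
    by (rule finite_subset) simp
  then show ?thesis
    by (simp add: prefixes_def)
qed

lemma div_power_Suc: "m div 2 ^ Suc j = m div 2 ^ j div (2 :: nat)"
  by (metis div_mult2_eq power_Suc2)

lemma one_in_prefixes: "0 < m \<Longrightarrow> 1 \<in> set_decode (prefixes m)"
proof (induction m rule: less_induct)
  case (less m)
  show ?case
  proof (cases "m = 1")
    case True
    then show ?thesis
      unfolding prefixes_decode by (auto intro: exI[of _ 0])
  next
    case False
    with less.prems have "0 < m div 2" "m div 2 < m" by auto
    with less.IH have "1 \<in> set_decode (prefixes (m div 2))" by blast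
    then obtain j where "1 = m div 2 div 2 ^ j"
      by (auto simp: prefixes_decode)
    then have "1 = m div 2 ^ Suc j"
      by (simp add: div_mult2_eq)
    then show ?thesis
      unfolding prefixes_decode by blast
  qed
qed

lemma prefixes_parent:
  assumes "0 < x" "2 * x \<in> set_decode (prefixes m) \<or> 2 * x + 1 \<in> set_decode (prefixes m)"
  shows "x \<in> set_decode (prefixes m)"
proof -
  obtain j where "2 * x = m div 2 ^ j \<or> 2 * x + 1 = m div 2 ^ j"
    using assms(2) by (auto simp: prefixes_decode)
  then have "x = m div 2 ^ j div 2"
    by (metis add.commute div_mult_self1_is_m less_numeral_extra(3) nonzero_mult_div_cancel_left pos2 Suc_1 Suc_eq_plus1 even_succ_div_two even_mult_iff even_numeral)
  then have "x = m div 2 ^ Suc j"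
    by (simp only: div_power_Suc)
  with assms(1) show ?thesis
    unfolding prefixes_decode by blast
qed

lemma prefixes_child:
  assumes "x \<in> set_decode (prefixes m)" "x < m"
  shows "2 * x \<in> set_decode (prefixes m) \<longleftrightarrow> 2 * x + 1 \<notin> set_decode (prefixes m)"
proof
  obtain j where j: "0 < x" "x = m div 2 ^ j"
    using assms(1) by (auto simp: prefixes_decode)
  have half: "m div 2 ^ b \<le> m div 2 ^ a div 2" if "a < b" for a b
  proof -
    have "m div 2 ^ b \<le> m div 2 ^ Suc a"
      using that by (intro div_le_mono2 power_increasing) auto
    then show ?thesis
      by (simp only: div_power_Suc)
  qed
  show "2 * x + 1 \<notin> set_decode (prefixes m)" if "2 * x \<in> set_decode (prefixes m)"
  proof
    assume "2 * x + 1 \<in> set_decode (prefixes m)"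
    with that obtain a b where ab: "2 * x = m div 2 ^ a" "2 * x + 1 = m div 2 ^ b"
      unfolding prefixes_decode by blast
    then consider "a < b" | "b < a"
      by (metis Suc_eq_plus1 linorder_neqE_nat n_not_Suc_n)
    then show False
      using half[of a b] half[of b a] ab[symmetric] j(1) by cases auto
  qed
  show "2 * x \<in> set_decode (prefixes m)" if "2 * x + 1 \<notin> set_decode (prefixes m)"
  proof -
    obtain k where k: "j = Suc k"
      using j(2) assms(2) by (cases j) auto
    define y where "y = m div 2 ^ k"
    have "x = y div 2"
      using j(2) by (simp only: k y_def div_power_Suc)
    then have "y = 2 * x \<or> y = 2 * x + 1"
      by linarith
    moreover have "y \<in> set_decode (prefixes m)"
      using calculation j(1) unfolding prefixes_decode y_def by auto
    ultimately show ?thesis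
      using that by auto
  qed
qed

lemma missing_prefix:
  assumes "0 < s" "s \<in> set_decode t" "\<not> good t s"
  defines "u \<equiv> missing_prefix t s"
  shows "0 < u" "u \<le> s" "u \<notin> set_decode t" "2 * u \<in> set_decode t \<or> 2 * u + 1 \<in> set_decode t"
proof -
  define j where "j = (LEAST j. s div 2 ^ j > 0 \<and> s div 2 ^ j \<notin> set_decode t)"
  have ex: "\<exists>j. s div 2 ^ j > 0 \<and> s div 2 ^ j \<notin> set_decode t"
    using assms(1,3) by (auto simp: good_def)
  have j: "s div 2 ^ j > 0 \<and> s div 2 ^ j \<notin> set_decode t"
    unfolding j_def using ex by (rule LeastI_ex)
  have u: "u = s div 2 ^ j"
    by (simp add: u_def missing_prefix_def j_def)
  obtain k where k: "j = Suc k"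
    using j assms(2) by (cases j) auto
  define y where "y = s div 2 ^ k"
  have uy: "u = y div 2"
    by (simp only: u k y_def div_power_Suc)
  have "\<not> (s div 2 ^ k > 0 \<and> s div 2 ^ k \<notin> set_decode t)"
    using not_less_Least[of k "\<lambda>j. s div 2 ^ j > 0 \<and> s div 2 ^ j \<notin> set_decode t"] k
    unfolding j_def by auto
  moreover have "0 < y"
    using j u uy by (cases y) auto
  ultimately have "y \<in> set_decode t"
    by (simp add: y_def)
  moreover have "y = 2 * u \<or> y = 2 * u + 1"
    using uy by linarith
  ultimately show "2 * u \<in> set_decode t \<or> 2 * u + 1 \<in> set_decode t"
    by auto
  show "0 < u" "u \<le> s" "u \<notin> set_decode t"
    using j by (auto simp: u)
qed

context cut
begin

lemma ev_const [simp]: "eventually (\<lambda>i. Q) U \<longleftrightarrow> Q"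
  using not_bot by (simp add: eventually_const)

text \<open>A node of the tree inside the cut is good at almost all indices, for otherwise its
  missing prefix would violate the tree condition. Such nodes are cofinal in the cut, so the largest
  good node lies above the cut, and its prefixes form a path.\<close>

lemma MM_weak_koenig: "satM MM e v weak_koenig"
proof -
  have "\<exists>P\<in>FF. satM MM e (case_nat P (case_nat t v)) (path_fm 0 1)"
    if t: "t \<in> FF" and tree: "satM MM e (case_nat t v) (binary_tree_fm 0)"
      and inf: "satM MM e (case_nat t v) (infinite_fm 0)" for t
  proof -
    have T1: "eventually (\<lambda>i. 0 < x i) U" if "x \<in> I" "eventually (\<lambda>i. x i \<in> set_decode (t i)) U" for x
      using tree that by (simp add: binary_tree_fm_def)
    have T2: "eventually (\<lambda>i. x i \<in> set_decode (t i)) U" if "x \<in> I" "eventually (\<lambda>i. 0 < x i) U"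
      "eventually (\<lambda>i. 2 * x i \<in> set_decode (t i) \<or> 2 * x i + 1 \<in> set_decode (t i)) U" for x
      using tree that by (simp add: binary_tree_fm_def ev_disj numeral_2_eq_2)
    have Inf: "\<exists>y\<in>I. eventually (\<lambda>i. x i < y i) U \<and> eventually (\<lambda>i. y i \<in> set_decode (t i)) U" if "x \<in> I" for x
      using inf that by (simp add: infinite_fm_def)
    have good: "eventually (\<lambda>i. good (t i) (s i)) U" if s: "s \<in> I" "eventually (\<lambda>i. s i \<in> set_decode (t i)) U" for s
    proof (rule ccontr)
      assume "\<not> ?thesis"
      then have "eventually (\<lambda>i. \<not> good (t i) (s i)) U"
        by (subst ev_not)
      with s(2) T1[OF s] have ev: "eventually (\<lambda>i. 0 < s i \<and> s i \<in> set_decode (t i) \<and> \<not> good (t i) (s i)) U"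
        by eventually_elim simp
      let ?u = "\<lambda>i. missing_prefix (t i) (s i)"
      have "eventually (\<lambda>i. ?u i \<le> s i) U"
        using ev by eventually_elim (simp add: missing_prefix)
      then have "?u \<in> I"
        by (rule I_downward[OF FF_missing[OF t I_FF[OF s(1)]] s(1)])
      moreover have "eventually (\<lambda>i. 0 < ?u i) U"
        using ev by eventually_elim (simp add: missing_prefix)
      moreover have "eventually (\<lambda>i. 2 * ?u i \<in> set_decode (t i) \<or> 2 * ?u i + 1 \<in> set_decode (t i)) U"
        using ev by eventually_elim (rule missing_prefix(4), auto)
      ultimately have "eventually (\<lambda>i. ?u i \<in> set_decode (t i)) U"
        by (rule T2)
      moreover have "eventually (\<lambda>i. ?u i \<notin> set_decode (t i)) U"
        using ev by eventually_elim (simp add: missing_prefix)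
      ultimately show False
        by (simp add: ev_not)
    qed
    define m where "m i = top_node (t i)" for i
    have mF: "m \<in> FF"
      unfolding m_def by (rule FF_top[OF t])
    have top: "s \<le> m i" if "good (t i) s" for s i
      unfolding m_def top_node_def using that finite_good by (intro Max_ge) auto
    have xm: "eventually (\<lambda>i. x i < m i \<and> good (t i) (m i)) U" if x: "x \<in> I" for x
    proof -
      obtain y where y: "y \<in> I" "eventually (\<lambda>i. x i < y i) U" "eventually (\<lambda>i. y i \<in> set_decode (t i)) U"
        using Inf[OF x] by blast
      from y(2) good[OF y(1,3)] show ?thesis
      proof eventually_elim
        case (elim i)
        have "m i \<in> {s. good (t i) s}"
          unfolding m_def top_node_def using elim(2) finite_good by (intro Max_in) auto
        with elim top[OF elim(2)] show ?case by simp
      qed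
    qed
    define P where "P i = prefixes (m i)" for i
    have PF: "P \<in> FF"
      unfolding P_def by (rule FF_prefixes[OF mF])
    have "satM MM e (case_nat P (case_nat t v)) (path_fm 0 1)"
    proof -
      have 1: "eventually (\<lambda>i. x i \<in> set_decode (t i)) U"
        if "x \<in> I" "eventually (\<lambda>i. x i \<in> set_decode (P i)) U" for x
        using that(2) xm[OF that(1)] by eventually_elim (auto simp: P_def prefixes_decode good_def)
      have 2: "eventually (\<lambda>i. 0 < x i) U"
        if "x \<in> I" "eventually (\<lambda>i. x i \<in> set_decode (P i)) U" for x
        using that(2) by eventually_elim (auto simp: P_def prefixes_decode)
      have 3: "eventually (\<lambda>i. x i \<in> set_decode (P i)) U"
        if "x \<in> I" "eventually (\<lambda>i. 0 < x i) U"
          "eventually (\<lambda>i. 2 * x i \<in> set_decode (P i) \<or> 2 * x i + 1 \<in> set_decode (P i)) U" for x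
        using that(2,3) unfolding P_def by eventually_elim (rule prefixes_parent)
      have 4: "eventually (\<lambda>i. 1 \<in> set_decode (P i)) U"
        using xm[OF I_0] unfolding P_def by eventually_elim (simp only: one_in_prefixes)
      have 5: "eventually (\<lambda>i. 2 * x i \<in> set_decode (P i)) U \<longleftrightarrow>
          \<not> eventually (\<lambda>i. 2 * x i + 1 \<in> set_decode (P i)) U"
        if "x \<in> I" "eventually (\<lambda>i. x i \<in> set_decode (P i)) U" for x
      proof -
        have "eventually (\<lambda>i. 2 * x i \<in> set_decode (P i) \<longleftrightarrow> 2 * x i + 1 \<notin> set_decode (P i)) U"
          using that(2) xm[OF that(1)] unfolding P_def by eventually_elim (intro prefixes_child, auto)
        then show ?thesis
          unfolding ev_not[symmetric] by (rule eventually_subst)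
      qed
      show ?thesis
        using 1 2 3 4 5 by (auto simp: path_fm_def binary_tree_fm_def ev_disj numeral_2_eq_2)
    qed
    with PF show ?thesis by blast
  qed
  then show ?thesis
    by (simp add: weak_koenig_def)
qed

text \<open>Some \<open>X k\<close> is homogeneous for the colouring, and it is unbounded in the cut
  because it contains the minima of the later sets. If the value 0 does not occur on its pairs, the
  colouring property leaves only the value 1.\<close>

lemma MM_RT22: "satM MM e v RT22"
proof -
  have "\<exists>H\<in>FF. satM MM e (case_nat H (case_nat a v)) (infinite_fm 0 \<^bold>\<and> homogeneous_fm 0 1)"
    if a: "a \<in> FF" and col: "satM MM e (case_nat a v) (colouring_fm 0)" for a
  proof -
    have C: "\<exists>c\<in>I. eventually (\<lambda>i. c i < 2) U \<and> (\<forall>z\<in>I.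
        eventually (\<lambda>i. pair_nat (pair_nat (x i) (y i)) (z i) \<in> set_decode (a i)) U \<longleftrightarrow> eventually (\<lambda>i. z i = c i) U)"
      if "x \<in> I" "y \<in> I" "eventually (\<lambda>i. x i < y i) U" for x y
      using col that by (simp add: colouring_fm_def pair_tm_def pair_nat_def eval_nat_numeral iff_conv_conj_imp)
    obtain k where "eventually (\<lambda>i. homogeneous (colour (a i)) (X k i)) U"
      using X_homogeneous[OF a] by blast
    then have "eventually (\<lambda>i. (\<forall>x\<in>X k i. \<forall>y\<in>X k i. x < y \<longrightarrow> colour (a i) x y) \<or>
        (\<forall>x\<in>X k i. \<forall>y\<in>X k i. x < y \<longrightarrow> \<not> colour (a i) x y)) U"
      by eventually_elim (auto simp: homogeneous_def)
    then have hom: "eventually (\<lambda>i. \<forall>x\<in>X k i. \<forall>y\<in>X k i. x < y \<longrightarrow> colour (a i) x y) U \<or>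
        eventually (\<lambda>i. \<forall>x\<in>X k i. \<forall>y\<in>X k i. x < y \<longrightarrow> \<not> colour (a i) x y) U"
      by (simp add: ev_disj)
    define H where "H i = set_encode (X k i)" for i
    have HF: "H \<in> FF"
      unfolding H_def by (rule FF_X)
    have H: "set_decode (H i) = X k i" for i
      by (simp add: H_def X_finite)
    have inf: "\<exists>y\<in>I. eventually (\<lambda>i. x i < y i) U \<and> eventually (\<lambda>i. y i \<in> X k i) U" if x: "x \<in> I" for x
    proof -
      obtain l where l: "eventually (\<lambda>i. x i < Min (X l i)) U"
        using x by (auto simp: I_def)
      let ?y = "\<lambda>i. Min (X (max k l) i)"
      have "eventually (\<lambda>i. X (max k l) i \<subseteq> X k i) U" "eventually (\<lambda>i. Min (X l i) \<le> ?y i) U"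
        by (simp_all add: X_antimono Min_mono)
      with l Min_X[of "max k l"] have "eventually (\<lambda>i. x i < ?y i \<and> ?y i \<in> X k i) U"
        by eventually_elim auto
      then show ?thesis
        using Min_I[of "max k l"] by (intro bexI[of _ ?y]) (auto simp: eventually_conj_iff)
    qed
    have hom': "\<exists>c\<in>I. eventually (\<lambda>i. c i < 2) U \<and> (\<forall>x\<in>I. \<forall>y\<in>I.
        eventually (\<lambda>i. x i \<in> X k i) U \<and> eventually (\<lambda>i. y i \<in> X k i) U \<and> eventually (\<lambda>i. x i < y i) U \<longrightarrow>
        eventually (\<lambda>i. pair_nat (pair_nat (x i) (y i)) (c i) \<in> set_decode (a i)) U)"
      using hom
    proof
      assume h: "eventually (\<lambda>i. \<forall>x\<in>X k i. \<forall>y\<in>X k i. x < y \<longrightarrow> colour (a i) x y) U"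
      show ?thesis
      proof (intro bexI[of _ "\<lambda>i. 0"] conjI ballI impI; (elim conjE)?)
        fix x y assume "eventually (\<lambda>i. x i \<in> X k i) U" "eventually (\<lambda>i. y i \<in> X k i) U"
          "eventually (\<lambda>i. x i < y i) U"
        with h show "eventually (\<lambda>i. pair_nat (pair_nat (x i) (y i)) 0 \<in> set_decode (a i)) U"
          by eventually_elim (simp add: colour_def)
      qed (simp_all add: I_0)
    next
      assume h: "eventually (\<lambda>i. \<forall>x\<in>X k i. \<forall>y\<in>X k i. x < y \<longrightarrow> \<not> colour (a i) x y) U"
      show ?thesis
      proof (intro bexI[of _ "\<lambda>i. 1"] conjI ballI impI; (elim conjE)?)
        fix x y assume xy: "x \<in> I" "y \<in> I" and *: "eventually (\<lambda>i. x i \<in> X k i) U" "eventually (\<lambda>i. y i \<in> X k i) U"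
          "eventually (\<lambda>i. x i < y i) U"
        obtain c where c: "c \<in> I" "eventually (\<lambda>i. c i < 2) U" "\<And>z. z \<in> I \<Longrightarrow>
            eventually (\<lambda>i. pair_nat (pair_nat (x i) (y i)) (z i) \<in> set_decode (a i)) U \<longleftrightarrow> eventually (\<lambda>i. z i = c i) U"
          using C[OF xy *(3)] by blast
        from h * have "eventually (\<lambda>i. \<not> pair_nat (pair_nat (x i) (y i)) 0 \<in> set_decode (a i)) U"
          by eventually_elim (simp add: colour_def)
        then have "\<not> eventually (\<lambda>i. 0 = c i) U"
          using c(3)[OF I_0] by (simp add: ev_not)
        then have "eventually (\<lambda>i. \<not> 0 = c i) U"
          by (subst ev_not)
        with c(2) have "eventually (\<lambda>i. 1 = c i) U"
          by eventually_elim linarith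
        then show "eventually (\<lambda>i. pair_nat (pair_nat (x i) (y i)) 1 \<in> set_decode (a i)) U"
          using c(3)[OF I_1] by simp
      qed (use I_1 in simp_all)
    qed
    have "satM MM e (case_nat H (case_nat a v)) (infinite_fm 0)"
      using inf by (simp add: infinite_fm_def H)
    moreover have "satM MM e (case_nat H (case_nat a v)) (homogeneous_fm 0 1)"
      using hom' by (simp add: homogeneous_fm_def H pair_tm_def pair_nat_def eval_nat_numeral)
    ultimately show ?thesis
      using HF by auto
  qed
  then show ?thesis
    unfolding RT22_def satM.simps(5,10,11) MM_simps(2) by blast
qed

lemma MM_models:
  assumes "\<psi> \<in> insert RT22 WKL0" "env MM e v"
  shows "satM MM e v \<psi>"
proof -
  consider "\<psi> = RT22" | "\<psi> = weak_koenig" | "\<psi> \<in> RCA0"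
    using assms(1) by (auto simp: WKL0_def)
  then show ?thesis
  proof cases
    case 3
    then obtain \<phi> where \<phi>: "\<psi> \<in> closures \<phi>" "\<phi> \<in> discrete_ordered_semiring \<union> {induction_axiom \<phi> | \<phi>. Sigma01 \<phi>}
      \<union> {comprehension_axiom \<phi> \<psi> | \<phi> \<psi>. Sigma01 \<phi> \<and> Pi01 \<psi>}"
      unfolding RCA0_def by blast
    have "\<forall>e v. env MM e v \<longrightarrow> satM MM e v \<phi>"
      using \<phi>(2) MM_semiring MM_induction MM_comprehension by blast
    then show ?thesis
      using MM.sat_closures[OF \<phi>(1)] assms(2) by blast
  qed (simp_all add: MM_RT22 MM_weak_koenig)
qed

end

section \<open>Construction of the ultrapower and of the generic sequence\<close>

instance tm :: countable
  by countable_datatype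

instance fm :: countable
  by countable_datatype

text \<open>A single sequence carries all arguments, as \<open>countable_closure\<close> requires:
  the bound at position 0, number parameters at odd positions, set parameters at positive even
  ones.\<close>

definition nenv :: "(nat \<Rightarrow> nat) \<Rightarrow> nat \<Rightarrow> nat" where
  "nenv e j = e (2 * j + 1)"

definition senv :: "(nat \<Rightarrow> nat) \<Rightarrow> nat \<Rightarrow> nat set" where
  "senv e j = set_decode (e (2 * j + 2))"

definition join_env :: "'a \<Rightarrow> (nat \<Rightarrow> 'a) \<Rightarrow> (nat \<Rightarrow> 'a) \<Rightarrow> nat \<Rightarrow> 'a" where
  "join_env c e v j = (if j = 0 then c else if odd j then e (j div 2) else v (j div 2 - 1))"

definition op_least :: "fm \<Rightarrow> (nat \<Rightarrow> nat) \<Rightarrow> nat" where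
  "op_least \<theta> e = (LEAST y. sat (case_nat y (nenv e)) (senv e) \<theta>)"

definition op_image :: "fm \<Rightarrow> (nat \<Rightarrow> nat) \<Rightarrow> nat" where
  "op_image \<theta> e = set_encode ((\<lambda>x. LEAST y. sat (case_nat y (case_nat x (nenv e))) (senv e) \<theta>) ` {..e 0})"

definition op_fail :: "fm \<Rightarrow> (nat \<Rightarrow> nat) \<Rightarrow> nat" where
  "op_fail \<theta> e = (LEAST x. \<not> (\<exists>y\<le>e 0. sat (case_nat y (case_nat x (nenv e))) (senv e) \<theta>))"

definition op_compr :: "fm \<times> fm \<Rightarrow> (nat \<Rightarrow> nat) \<Rightarrow> nat" where
  "op_compr = (\<lambda>(\<theta>, \<eta>) e. set_encode {x \<in> {..e 0}. sat (case_nat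
     (LEAST y. sat (case_nat y (case_nat x (nenv e))) (senv e) \<theta> \<or>
       \<not> sat (case_nat y (case_nat x (nenv e))) (senv e) \<eta>)
     (case_nat x (nenv e))) (senv e) \<theta>})"

lemma sat_env_finitary:
  obtains n where
    "\<And>e e' :: nat \<Rightarrow> nat. \<forall>j<n. e j = e' j \<Longrightarrow> e 0 = e' 0"
    "\<And>e e' y. \<forall>j<n. e j = e' j \<Longrightarrow>
      sat (case_nat y (nenv e)) (senv e) \<theta> \<longleftrightarrow> sat (case_nat y (nenv e')) (senv e') \<theta>"
    "\<And>e e' y x. \<forall>j<n. e j = e' j \<Longrightarrow>
      sat (case_nat y (case_nat x (nenv e))) (senv e) \<theta> \<longleftrightarrow> sat (case_nat y (case_nat x (nenv e'))) (senv e') \<theta>"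
proof -
  obtain n where n: "below n n \<theta>"
    using ex_below by blast
  show thesis
  proof (rule that[of "2 * n + 3"])
    fix e e' :: "nat \<Rightarrow> nat" and y x :: nat
    assume eq: "\<forall>j<2 * n + 3. e j = e' j"
    then show "e 0 = e' 0" by simp
    have "nenv e i = nenv e' i" "senv e i = senv e' i" if "i < n" for i
      using eq that by (simp_all add: nenv_def senv_def)
    then show "sat (case_nat y (nenv e)) (senv e) \<theta> \<longleftrightarrow> sat (case_nat y (nenv e')) (senv e') \<theta>"
      "sat (case_nat y (case_nat x (nenv e))) (senv e) \<theta> \<longleftrightarrow>
      sat (case_nat y (case_nat x (nenv e'))) (senv e') \<theta>"
      by (intro sat_below[OF n]; auto split: nat.splits)+
  qed
qed

lemma finitary_op_least: "finitary (op_least \<theta>)"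
proof (rule sat_env_finitary)
  fix n assume n: "\<And>e e' y. \<forall>j<n. e j = e' j \<Longrightarrow>
      sat (case_nat y (nenv e)) (senv e) \<theta> \<longleftrightarrow> sat (case_nat y (nenv e')) (senv e') \<theta>"
  have "op_least \<theta> e = op_least \<theta> e'" if "\<forall>j<n. e j = e' j" for e e'
    by (simp add: op_least_def n[OF that])
  then show ?thesis
    unfolding finitary_def by blast
qed

lemma finitary_op_image: "finitary (op_image \<theta>)"
proof (rule sat_env_finitary)
  fix n assume n: "\<And>e e' :: nat \<Rightarrow> nat. \<forall>j<n. e j = e' j \<Longrightarrow> e 0 = e' 0"
    "\<And>e e' y x. \<forall>j<n. e j = e' j \<Longrightarrow>
      sat (case_nat y (case_nat x (nenv e))) (senv e) \<theta> \<longleftrightarrow> sat (case_nat y (case_nat x (nenv e'))) (senv e') \<theta>"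
  have "op_image \<theta> e = op_image \<theta> e'" if "\<forall>j<n. e j = e' j" for e e'
    by (simp add: op_image_def n[OF that])
  then show ?thesis
    unfolding finitary_def by blast
qed

lemma finitary_op_fail: "finitary (op_fail \<theta>)"
proof (rule sat_env_finitary)
  fix n assume n: "\<And>e e' :: nat \<Rightarrow> nat. \<forall>j<n. e j = e' j \<Longrightarrow> e 0 = e' 0"
    "\<And>e e' y x. \<forall>j<n. e j = e' j \<Longrightarrow>
      sat (case_nat y (case_nat x (nenv e))) (senv e) \<theta> \<longleftrightarrow> sat (case_nat y (case_nat x (nenv e'))) (senv e') \<theta>"
  have "op_fail \<theta> e = op_fail \<theta> e'" if "\<forall>j<n. e j = e' j" for e e'
    by (simp add: op_fail_def n[OF that])
  then show ?thesis
    unfolding finitary_def by blast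
qed

lemma finitary_op_compr: "finitary (op_compr (\<theta>, \<eta>))"
proof (rule sat_env_finitary)
  fix n assume n: "\<And>e e' :: nat \<Rightarrow> nat. \<forall>j<n. e j = e' j \<Longrightarrow> e 0 = e' 0"
    "\<And>e e' y x. \<forall>j<n. e j = e' j \<Longrightarrow>
      sat (case_nat y (case_nat x (nenv e))) (senv e) \<theta> \<longleftrightarrow> sat (case_nat y (case_nat x (nenv e'))) (senv e') \<theta>"
  show ?thesis
  proof (rule sat_env_finitary)
    fix m assume m: "\<And>e e' y x. \<forall>j<m. e j = e' j \<Longrightarrow>
        sat (case_nat y (case_nat x (nenv e))) (senv e) \<eta> \<longleftrightarrow> sat (case_nat y (case_nat x (nenv e'))) (senv e') \<eta>"
    have "op_compr (\<theta>, \<eta>) e = op_compr (\<theta>, \<eta>) e'" if "\<forall>j<max m n. e j = e' j" for e e'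
    proof -
      have eq: "\<forall>j<m. e j = e' j" "\<forall>j<n. e j = e' j"
        using that by auto
      show ?thesis
        by (simp add: op_compr_def n[OF eq(2)] m[OF eq(1)])
    qed
    then show ?thesis
      unfolding finitary_def by blast
  qed
qed

text \<open>Bounds the levels of a given finite set, so that among its refinements there is a best
  one.\<close>

lemma large_less_card:
  assumes "large n Y" "finite Y" "\<And>y. y \<in> Y \<Longrightarrow> 0 < y"
  shows "n < card Y"
  using assms
proof (induction n arbitrary: Y)
  case 0
  then show ?case by (simp add: card_gt_0_iff)
next
  case (Suc n)
  obtain x J Z where Z: "x \<in> Y" "blocks Y J Z" "card J = x" "\<And>i. i \<in> J \<Longrightarrow> large n (Z i)"
    "\<And>i. i \<in> J \<Longrightarrow> {x} \<lless> Z i"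
    using large_SucE[OF Suc.prems(1)] by metis
  have "J \<noteq> {}"
    using Suc.prems(3)[OF Z(1)] Z(3) by auto
  then obtain i where i: "i \<in> J" by blast
  have sub: "Z i \<subseteq> Y - {x}"
    using Z(2) Z(5)[OF i] i unfolding blocks_def before_def by blast
  have fin: "finite (Z i)"
    using sub Suc.prems(2) by (meson Diff_subset finite_subset)
  have "n < card (Z i)"
    using Suc.IH[OF Z(4)[OF i] fin] sub Suc.prems(3) by blast
  also have "\<dots> \<le> card (Y - {x})"
    using sub Suc.prems(2) by (intro card_mono) auto
  also have "\<dots> < card Y"
    using Z(1) Suc.prems(2) by (intro psubset_card_mono) auto
  finally show ?case
    using Z(1) Suc.prems(2) \<open>n < card (Z i)\<close> \<open>card (Z i) \<le> card (Y - {x})\<close> by simp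
qed

text \<open>The chosen refinement is optimal at all levels simultaneously. The choice must not
  depend on \<open>n\<close>, because one internal set has to stay large at every standard level.
  The code \<open>g\<close> serves both as colouring and as gap set.\<close>

definition refine_step :: "nat \<Rightarrow> nat \<Rightarrow> nat" where
  "refine_step x g = set_encode (SOME Y. refines (colour g) (set_decode g) (set_decode x) Y \<and>
     (\<forall>n Y'. refines (colour g) (set_decode g) (set_decode x) Y' \<and> large n Y' \<longrightarrow> large n Y))"

lemma refine_step:
  assumes "\<And>y. y \<in> set_decode x \<Longrightarrow> 4 \<le> y"
    and "refines (colour g) (set_decode g) (set_decode x) Y" "large n Y"
  shows "refines (colour g) (set_decode g) (set_decode x) (set_decode (refine_step x g))"
    and "large n (set_decode (refine_step x g))"
proof -
  let ?R = "refines (colour g) (set_decode g) (set_decode x)"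
  define S where "S = {n. \<exists>Y. ?R Y \<and> large n Y}"
  have sub: "Y \<subseteq> set_decode x" if "?R Y" for Y
    using that by (simp add: refines_def)
  have "n \<le> card (set_decode x)" if "n \<in> S" for n
  proof -
    from \<open>n \<in> S\<close> obtain Y where Y: "?R Y" "large n Y"
      by (auto simp: S_def)
    have fin: "finite Y"
      using sub[OF Y(1)] by (rule finite_subset) simp
    have "0 < y" if "y \<in> Y" for y
      using assms(1)[of y] sub[OF Y(1)] that by auto
    then have "n < card Y"
      using large_less_card[OF Y(2) fin] by blast
    also have "\<dots> \<le> card (set_decode x)"
      using sub[OF Y(1)] by (intro card_mono) auto
    finally show ?thesis by simp
  qed
  then have finS: "finite S"
    by (meson finite_nat_set_iff_bounded_le)
  moreover have "n \<in> S"
    using assms(2,3) by (auto simp: S_def)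
  ultimately have "Max S \<in> S"
    by (intro Max_in) auto
  then obtain Y0 where Y0: "?R Y0" "large (Max S) Y0"
    by (auto simp: S_def)
  have "large n Y0" if "?R Y'" "large n Y'" for n Y'
  proof -
    have "n \<in> S"
      using that by (auto simp: S_def)
    then have "n \<le> Max S"
      using finS by simp
    with Y0(2) show ?thesis
      by (rule large_le)
  qed
  with Y0(1) have ex: "\<exists>Y. ?R Y \<and> (\<forall>n Y'. ?R Y' \<and> large n Y' \<longrightarrow> large n Y)"
    by blast
  define Z where "Z = (SOME Y. ?R Y \<and> (\<forall>n Y'. ?R Y' \<and> large n Y' \<longrightarrow> large n Y))"
  have Z: "?R Z" "\<forall>n Y'. ?R Y' \<and> large n Y' \<longrightarrow> large n Z"
    using someI_ex[OF ex] unfolding Z_def by blast+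
  have "finite Z"
    using sub[OF Z(1)] by (rule finite_subset) simp
  then have "set_decode (refine_step x g) = Z"
    by (simp add: refine_step_def Z_def)
  with Z assms(2,3) show "?R (set_decode (refine_step x g))" "large n (set_decode (refine_step x g))"
    by auto
qed

lemma unbounded_not_provably_total:
  assumes unb: "\<And>n N. \<exists>x\<ge>N. fast n x < f x"
    and T: "T \<subseteq> insert RT22 WKL0"
  shows "\<not> provably_total T f"
proof
  assume "provably_total T f"
  then obtain \<phi> where \<phi>: "Sigma1_defines \<phi> f" "T \<turnstile> AllN (Ex1N \<phi>)"
    by (auto simp: provably_total_def)
  \<comment> \<open>The lower bound keeps all elements at 4 or more, as \<open>refinement\<close>
    requires. The second condition makes the interval at index \<open>n\<close> large at level
    \<open>n\<close>, hence at every fixed level almost everywhere.\<close>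
  define a where "a n = (SOME x. n + 4 \<le> x \<and> fast n x < f x)" for n
  have "\<exists>x. n + 4 \<le> x \<and> fast n x < f x" for n
    using unb by blast
  then have a: "n + 4 \<le> a n \<and> fast n (a n) < f (a n)" for n
    unfolding a_def by (rule someI_ex)
  define X0 where "X0 n = {a n..<f (a n)}" for n
  have X0_large: "large n (X0 m)" if "n \<le> m" for n m
    unfolding X0_def using large_interval[of m "a m" "f (a m)"] a[of m] that by (auto intro: large_le)
  obtain U where U: "ultrafilter U" "U \<le> sequentially"
    using ex_ultrafilter by blast
  have ev_ge: "eventually (\<lambda>i. n \<le> i) U" for n
    using U(2) eventually_ge_at_top[of n] by (rule filter_leD)
  interpret ultrafilter U by (rule U(1))
  \<comment> \<open>Operations of fewer than two arguments ignore the others.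
    \<open>refine_step\<close> is included so that the generic sequence stays in \<open>FF\<close>,
    although it is defined by recursion along an enumeration of \<open>FF\<close>.\<close>
  define G where "G = {\<lambda>x y. 0, \<lambda>x y. 1, (+), (*), (-), \<lambda>x y. a x, \<lambda>x y. set_encode (X0 x), refine_step,
    missing_prefix, \<lambda>x y. top_node x, \<lambda>x y. prefixes x, \<lambda>x y. Min (set_decode x), \<lambda>x y. Max (set_decode x)}"
  define Q where "Q = (\<lambda>g e. g (e 0) (e 1)) ` G \<union> range op_least \<union> range op_image \<union> range op_fail \<union> range op_compr"
  have Q1: "countable Q"
    unfolding Q_def by (auto simp: G_def)
  have Q2: "finitary p" if "p \<in> Q" for p
  proof -
    have "finitary (\<lambda>e. g (e 0) (e 1))" for g
      unfolding finitary_def by (intro exI[of _ 2]) auto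
    with that show ?thesis
      unfolding Q_def using finitary_op_least finitary_op_image finitary_op_fail finitary_op_compr by auto
  qed
  obtain FF where FF0: "countable FF \<and> (\<lambda>i. i) \<in> FF \<and>
      (\<forall>p\<in>Q. \<forall>E. (\<forall>j. E j \<in> FF) \<longrightarrow> (\<lambda>i. p (\<lambda>j. E j i)) \<in> FF)"
    using exE[OF countable_closure[OF Q1 Q2]] by metis
  then have FF: "countable FF" "(\<lambda>i. i) \<in> FF"
    by simp_all
  have FF_Q: "(\<lambda>i. p (\<lambda>j. E j i)) \<in> FF" if "p \<in> Q" "\<forall>j. E j \<in> FF" for p E
    using FF0 that by simp
  have FF_G: "(\<lambda>i. g (s i) (t i)) \<in> FF" if g: "g \<in> G" and st: "s \<in> FF" "t \<in> FF" for g s t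
  proof -
    have "(\<lambda>e. g (e 0) (e 1)) \<in> Q"
      unfolding Q_def using g by (intro UnI1 imageI)
    from FF_Q[OF this, of "\<lambda>j. if j = 0 then s else t"] st show ?thesis
      by simp
  qed
  have join: "join_env c e v 0 = c" "(\<lambda>i. nenv (\<lambda>j. join_env c e v j i)) = (\<lambda>i j. e j i)"
    "(\<lambda>i. senv (\<lambda>j. join_env c e v j i)) = (\<lambda>i j. set_decode (v j i))" for c and e v :: "nat \<Rightarrow> nat \<Rightarrow> nat"
    by (auto simp: join_env_def nenv_def senv_def fun_eq_iff)
  have FF_join: "(\<lambda>i. p (\<lambda>j. join_env c e v j i)) \<in> FF"
    if "p \<in> Q" "c \<in> FF" "\<forall>j. e j \<in> FF" "\<forall>j. v j \<in> FF" for p c e v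
    using FF_Q[OF that(1), of "join_env c e v"] that(2-4) by (simp add: join_env_def)
  \<comment> \<open>Pairing repeats each function at arbitrarily late stages: a gap is guaranteed
    only once the minimum has outgrown the cardinality of the set to be avoided.\<close>
  define gs where "gs k = from_nat_into FF (fst (prod_decode k))" for k
  define C where "C = rec_nat (\<lambda>i. set_encode (X0 i)) (\<lambda>k c i. refine_step (c i) (gs k i))"
  have C: "C 0 = (\<lambda>i. set_encode (X0 i))" "C (Suc k) = (\<lambda>i. refine_step (C k i) (gs k i))" for k
    by (simp_all add: C_def)
  define X where "X k i = set_decode (C k i)" for k i
  have X_0: "X 0 i = X0 i" for i
    by (simp add: X_def C X0_def)
  have gsF: "gs k \<in> FF" for k
    unfolding gs_def using FF(2) by (intro from_nat_into) auto
  have gs: "\<exists>k\<ge>l. gs k = g" if g: "g \<in> FF" for g l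
  proof -
    obtain j where "from_nat_into FF j = g"
      using from_nat_into_surj[OF FF(1) g] by blast
    then have "gs (prod_encode (j, l)) = g"
      by (simp add: gs_def)
    moreover have "l \<le> prod_encode (j, l)"
      by (rule le_prod_encode_2)
    ultimately show ?thesis by blast
  qed
  have CF: "C k \<in> FF" for k
  proof (induction k)
    case 0
    show ?case
      using FF_G[of "\<lambda>x y. set_encode (X0 x)", OF _ FF(2) FF(2)] by (simp add: C G_def)
  next
    case (Suc k)
    show ?case
      using FF_G[of refine_step, OF _ Suc gsF[of k]] by (simp add: C G_def)
  qed
  have ge: "eventually (\<lambda>i. \<forall>x\<in>X k i. 4 \<le> x) U" and lrg: "\<And>n. eventually (\<lambda>i. large n (X k i)) U" for k
  proof (induction k)
    case 0
    show "eventually (\<lambda>i. \<forall>x\<in>X 0 i. 4 \<le> x) U"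
    proof (intro always_eventually allI ballI)
      fix i x assume "x \<in> X 0 i"
      then have "a i \<le> x" by (simp add: X_0 X0_def)
      with a[of i] show "4 \<le> x" by linarith
    qed
    show "eventually (\<lambda>i. large n (X 0 i)) U" for n
      using ev_ge[of n] by eventually_elim (simp add: X_0 X0_large)
  next
    case (Suc k)
    show "eventually (\<lambda>i. large n (X (Suc k) i)) U" for n
    proof -
      obtain N where N: "\<And>X f E. \<forall>x\<in>X. 4 \<le> x \<Longrightarrow> finite X \<Longrightarrow> finite E \<Longrightarrow> large N X \<Longrightarrow> \<exists>Y. refines f E X Y \<and> large n Y"
        using refinement[of n] by blast
      from Suc.IH(1) Suc.IH(2)[of N] show ?thesis
      proof eventually_elim
        case (elim i)
        obtain Y where Y: "refines (colour (gs k i)) (set_decode (gs k i)) (X k i) Y" "large n Y"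
          using N[OF elim(1) _ _ elim(2), of "set_decode (gs k i)" "colour (gs k i)"] by (auto simp: X_def)
        have "4 \<le> y" if "y \<in> set_decode (C k i)" for y
          using elim(1) that by (simp add: X_def)
        from refine_step(2)[OF this Y[unfolded X_def]] show ?case
          by (simp add: X_def C)
      qed
    qed
    obtain N where N: "\<And>X f E. \<forall>x\<in>X. 4 \<le> x \<Longrightarrow> finite X \<Longrightarrow> finite E \<Longrightarrow> large N X \<Longrightarrow> \<exists>Y. refines f E X Y \<and> large 0 Y"
      using refinement[of 0] by blast
    from Suc.IH(1) Suc.IH(2)[of N] show "eventually (\<lambda>i. \<forall>x\<in>X (Suc k) i. 4 \<le> x) U"
    proof eventually_elim
      case (elim i)
      obtain Y where Y: "refines (colour (gs k i)) (set_decode (gs k i)) (X k i) Y" "large 0 Y"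
        using N[OF elim(1) _ _ elim(2), of "set_decode (gs k i)" "colour (gs k i)"] by (auto simp: X_def)
      have "4 \<le> y" if "y \<in> set_decode (C k i)" for y
        using elim(1) that by (simp add: X_def)
      from refine_step(1)[OF this Y[unfolded X_def]] have "refines (colour (gs k i)) (set_decode (gs k i)) (X k i) (X (Suc k) i)"
        by (simp add: X_def C)
      with elim(1) show ?case
        by (auto simp: refines_def)
    qed
  qed
  have ref: "eventually (\<lambda>i. refines (colour (gs k i)) (set_decode (gs k i)) (X k i) (X (Suc k) i)) U" for k
  proof -
    obtain N where N: "\<And>X f E. \<forall>x\<in>X. 4 \<le> x \<Longrightarrow> finite X \<Longrightarrow> finite E \<Longrightarrow> large N X \<Longrightarrow> \<exists>Y. refines f E X Y \<and> large 0 Y"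
      using refinement[of 0] by blast
    from ge[of k] lrg[of N k] show ?thesis
    proof eventually_elim
      case (elim i)
      obtain Y where Y: "refines (colour (gs k i)) (set_decode (gs k i)) (X k i) Y" "large 0 Y"
        using N[OF elim(1) _ _ elim(2), of "set_decode (gs k i)" "colour (gs k i)"] by (auto simp: X_def)
      have "4 \<le> y" if "y \<in> set_decode (C k i)" for y
        using elim(1) that by (simp add: X_def)
      from refine_step(1)[OF this Y[unfolded X_def]] show ?case
        by (simp add: X_def C)
    qed
  qed
  have fin: "finite (X k i)" for k i
    by (simp add: X_def)
  have nonempty: "eventually (\<lambda>i. X k i \<noteq> {}) U" for k
    using lrg[of 0 k] by simp
  have Min_Suc: "eventually (\<lambda>i. 4 * Min (X k i) < Min (X (Suc k) i) \<and> 4 \<le> Min (X k i)) U" for k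
    using ref[of k] ge[of k] nonempty[of k] nonempty[of "Suc k"]
  proof eventually_elim
    case (elim i)
    then have 1: "4 \<le> Min (X k i)" "Min (X k i) \<in> X k i" "Min (X (Suc k) i) \<in> X (Suc k) i"
      using fin by simp_all
    then have "Min (X k i) * Min (X k i) < Min (X (Suc k) i)"
      using elim(1) unfolding refines_def by blast
    moreover have "4 * Min (X k i) \<le> Min (X k i) * Min (X k i)"
      using 1(1) by (rule mult_le_mono1)
    ultimately show ?case
      using 1(1) by linarith
  qed
  have Min_mono': "eventually (\<lambda>i. Min (X k i) \<le> Min (X l i)) U" if "k \<le> l" for k l
    using that
  proof (induction l rule: dec_induct)
    case (step l)
    from step.IH Min_Suc[of l] show ?case
      by eventually_elim linarith
  qed simp
  have cut: "cut U FF X"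
  proof
    show "(\<lambda>i. 0) \<in> FF"
      using FF_G[of "\<lambda>x y. 0", OF _ FF(2) FF(2)] by (simp add: G_def)
    show "(\<lambda>i. 1) \<in> FF"
      using FF_G[of "\<lambda>x y. 1", OF _ FF(2) FF(2)] by (simp add: G_def)
    show "(\<lambda>i. f i + g i) \<in> FF" "(\<lambda>i. f i * g i) \<in> FF" "(\<lambda>i. f i - g i) \<in> FF"
      "(\<lambda>i. missing_prefix (f i) (g i)) \<in> FF"
      if "f \<in> FF" "g \<in> FF" for f g
      using FF_G[OF _ that] by (simp_all add: G_def)
    show "(\<lambda>i. top_node (t i)) \<in> FF" "(\<lambda>i. prefixes (t i)) \<in> FF" if "t \<in> FF" for t
      using FF_G[OF _ that that, of "\<lambda>x y. top_node x"] FF_G[OF _ that that, of "\<lambda>x y. prefixes x"]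
      by (simp_all add: G_def)
    show "(\<lambda>i. Min (X k i)) \<in> FF" "(\<lambda>i. Max (X k i)) \<in> FF" for k
      using FF_G[OF _ CF CF, of "\<lambda>x y. Min (set_decode x)" k k] FF_G[OF _ CF CF, of "\<lambda>x y. Max (set_decode x)" k k]
      by (simp_all add: G_def X_def)
    show "(\<lambda>i. set_encode (X k i)) \<in> FF" for k
      using CF[of k] by (simp add: X_def)
    fix \<theta> \<eta> and c and e v :: "nat \<Rightarrow> nat \<Rightarrow> nat"
    assume ev: "\<forall>j. e j \<in> FF" "\<forall>j. v j \<in> FF"
    have Qs: "op_least \<theta> \<in> Q" "op_image \<theta> \<in> Q" "op_fail \<theta> \<in> Q" "op_compr (\<theta>, \<eta>) \<in> Q"
      unfolding Q_def by blast+
    note join' = join(2)[THEN fun_cong] join(3)[THEN fun_cong]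
    show "(\<lambda>i. LEAST y. sat (case_nat y (\<lambda>j. e j i)) (\<lambda>j. set_decode (v j i)) \<theta>) \<in> FF"
      using FF_join[OF Qs(1) FF(2) ev] by (simp add: op_least_def join')
    assume c: "c \<in> FF"
    show "(\<lambda>i. set_encode ((\<lambda>x. LEAST y. sat (case_nat y (case_nat x (\<lambda>j. e j i))) (\<lambda>j. set_decode (v j i)) \<theta>) ` {..c i})) \<in> FF"
      using FF_join[OF Qs(2) c ev] by (simp add: op_image_def join' join(1))
    show "(\<lambda>i. LEAST x. \<not> (\<exists>y\<le>c i. sat (case_nat y (case_nat x (\<lambda>j. e j i))) (\<lambda>j. set_decode (v j i)) \<theta>)) \<in> FF"
      using FF_join[OF Qs(3) c ev] by (simp add: op_fail_def join' join(1))
    show "(\<lambda>i. set_encode {x \<in> {..c i}. sat (case_nat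
        (LEAST y. sat (case_nat y (case_nat x (\<lambda>j. e j i))) (\<lambda>j. set_decode (v j i)) \<theta> \<or>
          \<not> sat (case_nat y (case_nat x (\<lambda>j. e j i))) (\<lambda>j. set_decode (v j i)) \<eta>)
        (case_nat x (\<lambda>j. e j i))) (\<lambda>j. set_decode (v j i)) \<theta>}) \<in> FF"
      using FF_join[OF Qs(4) c ev] by (simp add: op_compr_def join' join(1))
  next
    fix k i
    show "finite (X k i)" by (rule fin)
    show "eventually (\<lambda>i. X k i \<noteq> {}) U" by (rule nonempty)
    show "eventually (\<lambda>i. \<forall>x\<in>X k i. 4 \<le> x) U" by (rule ge)
    show "eventually (\<lambda>i. X (Suc k) i \<subseteq> X k i) U"
      using ref[of k] by eventually_elim (simp add: refines_def)
    show "eventually (\<lambda>i. \<forall>y\<in>X (Suc k) i. Min (X k i) * Min (X k i) < y) U"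
      using ref[of k] nonempty[of k] by eventually_elim (auto simp: refines_def)
  next
    fix g assume "g \<in> FF"
    then obtain k where "gs k = g"
      using gs by blast
    then show "\<exists>k. eventually (\<lambda>i. homogeneous (colour (g i)) (X k i)) U"
      using ref[of k] by (intro exI[of _ "Suc k"]) (auto simp: refines_def elim: eventually_mono)
  next
    fix g c l
    assume g: "g \<in> FF" and c: "eventually (\<lambda>i. c i < Min (X l i)) U"
      and card: "eventually (\<lambda>i. card (set_decode (g i)) \<le> Suc (c i)) U"
    obtain k where k: "Suc l \<le> k" "gs k = g"
      using gs[OF g] by blast
    from ref[of k] c card Min_mono'[OF k(1)] Min_Suc[of l]
    have "eventually (\<lambda>i. \<forall>a\<in>X (Suc k) i. \<forall>b\<in>X (Suc k) i. \<forall>e\<in>set_decode (g i). e \<le> a \<or> b < e) U"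
    proof eventually_elim
      case (elim i)
      then have "Suc (card (set_decode (g i))) < Min (X k i)"
        by linarith
      with elim(1) k(2) show ?case
        by (simp add: refines_def)
    qed
    then show "\<exists>k. eventually (\<lambda>i. \<forall>a\<in>X k i. \<forall>b\<in>X k i. \<forall>e\<in>set_decode (g i). e \<le> a \<or> b < e) U"
      by blast
  qed
  interpret cut U FF X by (rule cut)
  have aF: "a \<in> FF"
    using FF_G[of "\<lambda>x y. a x", OF _ FF(2) FF(2)] by (simp add: G_def)
  have a_less: "a i < f (a i)" for i
    using a[of i] fast_gt[of "a i" i] by linarith
  have "Min (X 0 i) = a i" for i
    unfolding X_0 X0_def using a_less[of i] by (intro Min_eqI) auto
  then have aI: "a \<in> I"
    using Min_I[of 0] by simp
  define e v :: "nat \<Rightarrow> nat \<Rightarrow> nat" where "e = (\<lambda>j i. 0)" and "v = (\<lambda>j i. 0)"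
  have env: "env MM e v"
    using I_0 FF_0 by (simp add: env_MM e_def v_def)
  have "satM MM e v (AllN (Ex1N \<phi>))"
    using MM.soundness[OF \<phi>(2) env] MM_models[OF _ env] T by blast
  then obtain y where y: "y \<in> I" "satM MM (case_nat y (case_nat a e)) v \<phi>"
    using aI by (auto simp: Ex1N_def)
  obtain \<theta> where \<theta>: "bounded_fm \<theta>" "\<phi> = ExN \<theta>"
    using \<phi>(1) by (auto simp: Sigma1_defines_def Sigma01_def)
  have env': "env MM (case_nat a e) v"
    using env aI by auto
  obtain z where z: "eventually (\<lambda>i. sat (case_nat (z i) (case_nat (y i) (\<lambda>j. case_nat a e j i))) (\<lambda>j. set_decode (v j i)) \<theta>) U"
    using y(2) sat_ExN_iff[OF \<theta>(1) env' y(1)] unfolding \<theta>(2) by blast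
  \<comment> \<open>At almost every index the witness is a true one, so the meaning of
    \<open>\<phi>\<close> in the standard model determines the value. But all elements of the cut
    are below \<open>Max (X 0 i)\<close>, which is below \<open>f (a i)\<close>.\<close>
  have "eventually (\<lambda>i. y i = f (a i)) U"
    using z
  proof eventually_elim
    case (elim i)
    then have "sat (case_nat (y i) (case_nat (a i) (\<lambda>j. e j i))) (\<lambda>j. set_decode (v j i)) \<phi>"
      unfolding \<theta>(2) by (auto simp: case_nat_app)
    then show ?case
      using \<phi>(1) by (simp add: Sigma1_defines_def)
  qed
  moreover have "eventually (\<lambda>i. y i < Max (X 0 i)) U"
    by (rule I_below_Max[OF y(1)])
  ultimately have "eventually (\<lambda>i. False) U"
  proof eventually_elim
    case (elim i)
    have "Max (X 0 i) < f (a i)"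
      unfolding X_0 X0_def using a_less[of i] by (subst Max_less_iff) auto
    with elim show ?case by simp
  qed
  then show False by simp
qed

section \<open>Substitution, weakening and compactness for derivations\<close>

lemma subst_tm_subst_tm: "subst_tm \<sigma> (subst_tm \<tau> t) = subst_tm (\<lambda>i. subst_tm \<sigma> (\<tau> i)) t"
  by (induction t) auto

lemma subst_tm_Var [simp]: "subst_tm Var t = t"
  by (induction t) auto

lemma upN_comp: "(\<lambda>i. subst_tm (upN \<sigma>) (upN \<tau> i)) = upN (\<lambda>i. subst_tm \<sigma> (\<tau> i))"
  by (auto simp: upN_def subst_tm_subst_tm split: nat.splits)

lemma upS_comp: "(\<lambda>i. upS \<rho> (upS \<pi> i)) = upS (\<lambda>i. \<rho> (\<pi> i))"
  by (auto simp: upS_def split: nat.splits)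

lemma subst_subst: "subst \<sigma> \<rho> (subst \<tau> \<pi> \<phi>) = subst (\<lambda>i. subst_tm \<sigma> (\<tau> i)) (\<lambda>i. \<rho> (\<pi> i)) \<phi>"
  by (induction \<phi> arbitrary: \<sigma> \<rho> \<tau> \<pi>) (auto simp: subst_tm_subst_tm upN_comp upS_comp)

lemma upN_Var [simp]: "upN Var = Var"
  by (auto simp: upN_def split: nat.splits)

lemma upS_id [simp]: "upS (\<lambda>i. i) = (\<lambda>i. i)" "upS id = id"
  by (auto simp: upS_def split: nat.splits)

lemma subst_Var [simp]: "subst Var id \<phi> = \<phi>" "subst Var (\<lambda>i. i) \<phi> = \<phi>"
  by (induction \<phi>) (auto simp: id_def)

lemma subst_tm_below: "below_tm n t \<Longrightarrow> (\<And>i. i < n \<Longrightarrow> \<sigma> i = \<sigma>' i) \<Longrightarrow> subst_tm \<sigma> t = subst_tm \<sigma>' t"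
  by (induction t) auto

lemma subst_below:
  "below n m \<phi> \<Longrightarrow> (\<And>i. i < n \<Longrightarrow> \<sigma> i = \<sigma>' i) \<Longrightarrow> (\<And>i. i < m \<Longrightarrow> \<rho> i = \<rho>' i) \<Longrightarrow> subst \<sigma> \<rho> \<phi> = subst \<sigma>' \<rho>' \<phi>"
proof (induction \<phi> arbitrary: n m \<sigma> \<sigma>' \<rho> \<rho>')
  case (AllN \<phi>)
  have "subst (upN \<sigma>) \<rho> \<phi> = subst (upN \<sigma>') \<rho>' \<phi>"
    using AllN.prems by (intro AllN.IH[of "Suc n" m]) (auto simp: upN_def split: nat.splits)
  then show ?case by simp
next
  case (ExN \<phi>)
  have "subst (upN \<sigma>) \<rho> \<phi> = subst (upN \<sigma>') \<rho>' \<phi>"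
    using ExN.prems by (intro ExN.IH[of "Suc n" m]) (auto simp: upN_def split: nat.splits)
  then show ?case by simp
next
  case (AllS \<phi>)
  have "subst \<sigma> (upS \<rho>) \<phi> = subst \<sigma>' (upS \<rho>') \<phi>"
    using AllS.prems by (intro AllS.IH[of n "Suc m"]) (auto simp: upS_def split: nat.splits)
  then show ?case by simp
next
  case (ExS \<phi>)
  have "subst \<sigma> (upS \<rho>) \<phi> = subst \<sigma>' (upS \<rho>') \<phi>"
    using ExS.prems by (intro ExS.IH[of n "Suc m"]) (auto simp: upS_def split: nat.splits)
  then show ?case by simp
next
  case (Imp \<phi> \<psi>)
  from Imp.IH(1)[of n m \<sigma> \<sigma>' \<rho> \<rho>'] Imp.IH(2)[of n m \<sigma> \<sigma>' \<rho> \<rho>'] Imp.prems show ?case by simp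
next
  case (And \<phi> \<psi>)
  from And.IH(1)[of n m \<sigma> \<sigma>' \<rho> \<rho>'] And.IH(2)[of n m \<sigma> \<sigma>' \<rho> \<rho>'] And.prems show ?case by simp
next
  case (Or \<phi> \<psi>)
  from Or.IH(1)[of n m \<sigma> \<sigma>' \<rho> \<rho>'] Or.IH(2)[of n m \<sigma> \<sigma>' \<rho> \<rho>'] Or.prems show ?case by simp
next
  case (Eq s t)
  then show ?case using subst_tm_below[of n s \<sigma> \<sigma>'] subst_tm_below[of n t \<sigma> \<sigma>'] by simp
next
  case (Lt s t)
  then show ?case using subst_tm_below[of n s \<sigma> \<sigma>'] subst_tm_below[of n t \<sigma> \<sigma>'] by simp
next
  case (Mem t X)
  then show ?case using subst_tm_below[of n t \<sigma> \<sigma>'] by simp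
qed simp

lemma subst_liftN: "subst (upN \<sigma>) \<rho> (liftN \<phi>) = liftN (subst \<sigma> \<rho> \<phi>)"
  by (simp add: subst_subst upN_def)

lemma subst_liftS: "subst \<sigma> (upS \<rho>) (liftS \<phi>) = liftS (subst \<sigma> \<rho> \<phi>)"
  by (simp add: subst_subst upS_def)

lemma subst_instN: "subst \<sigma> \<rho> (instN t \<phi>) = instN (subst_tm \<sigma> t) (subst (upN \<sigma>) \<rho> \<phi>)"
proof -
  have "(\<lambda>i. subst_tm \<sigma> (case_nat t Var i)) = (\<lambda>i. subst_tm (case_nat (subst_tm \<sigma> t) Var) (upN \<sigma> i))"
    by (auto simp: upN_def subst_tm_subst_tm split: nat.splits)
  then show ?thesis
    by (simp add: subst_subst)
qed

lemma subst_instS: "subst \<sigma> \<rho> (instS X \<phi>) = instS (\<rho> X) (subst \<sigma> (upS \<rho>) \<phi>)"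
proof -
  have "(\<lambda>i. \<rho> (case_nat X id i)) = (\<lambda>i. case_nat (\<rho> X) id (upS \<rho> i))"
    by (auto simp: upS_def split: nat.splits)
  then show ?thesis
    by (simp add: subst_subst)
qed

lemma derives_mono: "\<Gamma> \<turnstile> \<phi> \<Longrightarrow> \<Gamma> \<subseteq> \<Delta> \<Longrightarrow> \<Delta> \<turnstile> \<phi>"
proof (induction arbitrary: \<Delta> rule: derives.induct)
  case (Hyp \<phi> \<Gamma>)
  then show ?case by (auto intro: derives.Hyp)
next
  case (Contr \<phi> \<Gamma>)
  show ?case by (rule derives.Contr[OF Contr.IH]) (use Contr.prems in auto)
next
  case (ImpI \<phi> \<Gamma> \<psi>)
  show ?case by (rule derives.ImpI[OF ImpI.IH]) (use ImpI.prems in auto)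
next
  case (ImpE \<Gamma> \<phi> \<psi>)
  show ?case by (rule derives.ImpE[OF ImpE.IH]) (use ImpE.prems in auto)
next
  case (OrE \<Gamma> \<phi> \<psi> \<chi>)
  show ?case
    by (rule derives.OrE[OF OrE.IH(1) OrE.IH(2) OrE.IH(3)]) (use OrE.prems in auto)
next
  case (AllNI \<Gamma> \<phi>)
  show ?case by (rule derives.AllNI[OF AllNI.IH]) (use AllNI.prems in auto)
next
  case (ExNE \<Gamma> \<phi> \<chi>)
  show ?case
    by (rule derives.ExNE[OF ExNE.IH(1) ExNE.IH(2)]) (use ExNE.prems in auto)
next
  case (AllSI \<Gamma> \<phi>)
  show ?case by (rule derives.AllSI[OF AllSI.IH]) (use AllSI.prems in auto)
next
  case (ExSE \<Gamma> \<phi> \<chi>)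
  show ?case
    by (rule derives.ExSE[OF ExSE.IH(1) ExSE.IH(2)]) (use ExSE.prems in auto)
next
  case (EqE \<Gamma> s t \<phi>)
  show ?case
    by (rule derives.EqE[OF EqE.IH]) (use EqE.prems in auto)
next
  case (AndE1 \<Gamma> \<phi> \<psi>)
  show ?case
    by (rule derives.AndE1[OF AndE1.IH[OF AndE1.prems]])
next
  case (AndE2 \<Gamma> \<phi> \<psi>)
  show ?case
    by (rule derives.AndE2[OF AndE2.IH[OF AndE2.prems]])
next
  case (AllNE \<Gamma> \<phi> t)
  show ?case
    by (rule derives.AllNE[OF AllNE.IH[OF AllNE.prems]])
next
  case (AllSE \<Gamma> \<phi> X)
  show ?case
    by (rule derives.AllSE[OF AllSE.IH[OF AllSE.prems]])
next
  case (ExNI \<Gamma> t \<phi>)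
  show ?case
    by (rule derives.ExNI[OF ExNI.IH[OF ExNI.prems]])
next
  case (ExSI \<Gamma> X \<phi>)
  show ?case
    by (rule derives.ExSI[OF ExSI.IH[OF ExSI.prems]])
qed (simp_all add: derives.AndI derives.OrI1 derives.OrI2 derives.EqI)

lemma derives_subst: "\<Gamma> \<turnstile> \<phi> \<Longrightarrow> subst \<sigma> \<rho> ` \<Gamma> \<turnstile> subst \<sigma> \<rho> \<phi>"
proof (induction arbitrary: \<sigma> \<rho> rule: derives.induct)
  case (Hyp \<phi> \<Gamma>)
  then show ?case by (auto intro: derives.Hyp)
next
  case (Contr \<phi> \<Gamma>)
  from Contr.IH[of \<sigma> \<rho>] show ?case by (intro derives.Contr[of "subst \<sigma> \<rho> \<phi>"]) simp
next
  case (ImpI \<phi> \<Gamma> \<psi>)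
  from ImpI.IH[of \<sigma> \<rho>] show ?case by (simp add: derives.ImpI)
next
  case (ImpE \<Gamma> \<phi> \<psi>)
  from derives.ImpE[OF ImpE.IH(1)[of \<sigma> \<rho>, simplified] ImpE.IH(2)[of \<sigma> \<rho>]] show ?case .
next
  case (AndI \<Gamma> \<phi> \<psi>)
  from AndI.IH(1)[of \<sigma> \<rho>] AndI.IH(2)[of \<sigma> \<rho>] show ?case by (simp add: derives.AndI)
next
  case (AndE1 \<Gamma> \<phi> \<psi>)
  from derives.AndE1[OF AndE1.IH[of \<sigma> \<rho>, simplified]] show ?case .
next
  case (AndE2 \<Gamma> \<phi> \<psi>)
  from derives.AndE2[OF AndE2.IH[of \<sigma> \<rho>, simplified]] show ?case .
next
  case (OrI1 \<Gamma> \<phi> \<psi>)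
  from OrI1.IH[of \<sigma> \<rho>] show ?case by (simp add: derives.OrI1)
next
  case (OrI2 \<Gamma> \<psi> \<phi>)
  from OrI2.IH[of \<sigma> \<rho>] show ?case by (simp add: derives.OrI2)
next
  case (OrE \<Gamma> \<phi> \<psi> \<chi>)
  from derives.OrE[OF OrE.IH(1)[of \<sigma> \<rho>, simplified] OrE.IH(2)[of \<sigma> \<rho>, simplified]
      OrE.IH(3)[of \<sigma> \<rho>, simplified]] show ?case .
next
  case (AllNI \<Gamma> \<phi>)
  from AllNI.IH[of "upN \<sigma>" \<rho>] show ?case
    by (simp add: image_image subst_liftN derives.AllNI)
next
  case (AllNE \<Gamma> \<phi> t)
  from derives.AllNE[OF AllNE.IH[of \<sigma> \<rho>, simplified]] show ?case
    by (simp add: subst_instN)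
next
  case (ExNI \<Gamma> t \<phi>)
  from derives.ExNI[OF ExNI.IH[of \<sigma> \<rho>, unfolded subst_instN]] show ?case
    by simp
next
  case (ExNE \<Gamma> \<phi> \<chi>)
  have "insert (subst (upN \<sigma>) \<rho> \<phi>) (liftN ` subst \<sigma> \<rho> ` \<Gamma>) \<turnstile> liftN (subst \<sigma> \<rho> \<chi>)"
    using ExNE.IH(2)[of "upN \<sigma>" \<rho>] by (simp add: image_image subst_liftN)
  from derives.ExNE[OF ExNE.IH(1)[of \<sigma> \<rho>, simplified] this] show ?case .
next
  case (AllSI \<Gamma> \<phi>)
  from AllSI.IH[of \<sigma> "upS \<rho>"] show ?case
    by (simp add: image_image subst_liftS derives.AllSI)
next
  case (AllSE \<Gamma> \<phi> X)
  from derives.AllSE[OF AllSE.IH[of \<sigma> \<rho>, simplified]] show ?case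
    by (simp add: subst_instS)
next
  case (ExSI \<Gamma> X \<phi>)
  from derives.ExSI[OF ExSI.IH[of \<sigma> \<rho>, unfolded subst_instS]] show ?case
    by simp
next
  case (ExSE \<Gamma> \<phi> \<chi>)
  have "insert (subst \<sigma> (upS \<rho>) \<phi>) (liftS ` subst \<sigma> \<rho> ` \<Gamma>) \<turnstile> liftS (subst \<sigma> \<rho> \<chi>)"
    using ExSE.IH(2)[of \<sigma> "upS \<rho>"] by (simp add: image_image subst_liftS)
  from derives.ExSE[OF ExSE.IH(1)[of \<sigma> \<rho>, simplified] this] show ?case .
next
  case (EqI \<Gamma> t)
  show ?case by (simp add: derives.EqI)
next
  case (EqE \<Gamma> s t \<phi>)
  from derives.EqE[OF EqE.IH(1)[of \<sigma> \<rho>, simplified] EqE.IH(2)[of \<sigma> \<rho>, unfolded subst_instN]] show ?case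
    by (simp only: subst_instN)
qed

lemma finite_subset_insertE:
  assumes "finite F" "F \<subseteq> insert a A"
  obtains B where "finite B" "B \<subseteq> A" "F \<subseteq> insert a B"
proof
  show "finite (F - {a})" "F - {a} \<subseteq> A" "F \<subseteq> insert a (F - {a})"
    using assms by auto
qed

lemma finite_compact_insert:
  assumes "\<exists>F\<subseteq>insert \<phi> \<Gamma>. finite F \<and> (F \<turnstile> \<chi>)"
  obtains B where "finite B" "B \<subseteq> \<Gamma>" "insert \<phi> B \<turnstile> \<chi>"
proof -
  obtain F where F: "F \<subseteq> insert \<phi> \<Gamma>" "finite F" "F \<turnstile> \<chi>"
    using assms by blast
  obtain B where "finite B" "B \<subseteq> \<Gamma>" "F \<subseteq> insert \<phi> B"
    by (rule finite_subset_insertE[OF F(2,1)])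
  with that derives_mono[OF F(3)] show thesis by blast
qed

lemma derives_compact: "\<Gamma> \<turnstile> \<phi> \<Longrightarrow> \<exists>F\<subseteq>\<Gamma>. finite F \<and> (F \<turnstile> \<phi>)"
proof (induction rule: derives.induct)
  case (Hyp \<phi> \<Gamma>)
  then show ?case by (intro exI[of _ "{\<phi>}"]) (auto intro: derives.Hyp)
next
  case (Contr \<phi> \<Gamma>)
  then obtain F B where "F \<turnstile> \<^bold>\<bottom>" "finite B" "B \<subseteq> \<Gamma>" "F \<subseteq> insert (\<^bold>\<not> \<phi>) B"
    using finite_subset_insertE by metis
  then have "B \<turnstile> \<phi>"
    by (intro derives.Contr[of \<phi>]) (rule derives_mono)
  with \<open>finite B\<close> \<open>B \<subseteq> \<Gamma>\<close> show ?case by blast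
next
  case (ImpI \<phi> \<Gamma> \<psi>)
  then obtain F B where "F \<turnstile> \<psi>" "finite B" "B \<subseteq> \<Gamma>" "F \<subseteq> insert \<phi> B"
    using finite_subset_insertE by metis
  then have "B \<turnstile> \<phi> \<^bold>\<longrightarrow> \<psi>"
    by (intro derives.ImpI) (rule derives_mono)
  with \<open>finite B\<close> \<open>B \<subseteq> \<Gamma>\<close> show ?case by blast
next
  case (ImpE \<Gamma> \<phi> \<psi>)
  then obtain F G where *: "F \<subseteq> \<Gamma>" "finite F" "F \<turnstile> \<phi> \<^bold>\<longrightarrow> \<psi>" "G \<subseteq> \<Gamma>" "finite G" "G \<turnstile> \<phi>" by blast
  have "F \<union> G \<turnstile> \<psi>"
    by (rule derives.ImpE[OF derives_mono[OF *(3)] derives_mono[OF *(6)]]) auto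
  with * show ?case by (intro exI[of _ "F \<union> G"]) auto
next
  case (AndI \<Gamma> \<phi> \<psi>)
  then obtain F G where *: "F \<subseteq> \<Gamma>" "finite F" "F \<turnstile> \<phi>" "G \<subseteq> \<Gamma>" "finite G" "G \<turnstile> \<psi>" by blast
  have "F \<union> G \<turnstile> \<phi> \<^bold>\<and> \<psi>"
    by (rule derives.AndI[OF derives_mono[OF *(3)] derives_mono[OF *(6)]]) auto
  with * show ?case by (intro exI[of _ "F \<union> G"]) auto
next
  case (OrE \<Gamma> \<phi> \<psi> \<chi>)
  obtain F where F: "F \<subseteq> \<Gamma>" "finite F" "F \<turnstile> \<phi> \<^bold>\<or> \<psi>"
    using OrE.IH(1) by blast
  obtain G where G: "finite G" "G \<subseteq> \<Gamma>" "insert \<phi> G \<turnstile> \<chi>"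
    using OrE.IH(2) by (rule finite_compact_insert)
  obtain H where H: "finite H" "H \<subseteq> \<Gamma>" "insert \<psi> H \<turnstile> \<chi>"
    using OrE.IH(3) by (rule finite_compact_insert)
  have "F \<union> G \<union> H \<turnstile> \<chi>"
    by (rule derives.OrE[OF derives_mono[OF F(3)] derives_mono[OF G(3)] derives_mono[OF H(3)]]) auto
  with F G H show ?case by (intro exI[of _ "F \<union> G \<union> H"]) auto
next
  case (AllNI \<Gamma> \<phi>)
  then obtain F where "F \<subseteq> liftN ` \<Gamma>" "finite F" "F \<turnstile> \<phi>" by blast
  then obtain G where "G \<subseteq> \<Gamma>" "finite G" "F = liftN ` G"
    by (meson finite_subset_image)
  then show ?case using \<open>F \<turnstile> \<phi>\<close> derives.AllNI by blast
next
  case (ExNE \<Gamma> \<phi> \<chi>)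
  obtain F where F: "F \<subseteq> \<Gamma>" "finite F" "F \<turnstile> ExN \<phi>"
    using ExNE.IH(1) by blast
  obtain G where G: "finite G" "G \<subseteq> liftN ` \<Gamma>" "insert \<phi> G \<turnstile> liftN \<chi>"
    using ExNE.IH(2) by (rule finite_compact_insert)
  then obtain H where H: "H \<subseteq> \<Gamma>" "finite H" "G = liftN ` H"
    by (meson finite_subset_image)
  have "F \<union> H \<turnstile> \<chi>"
    by (rule derives.ExNE[OF derives_mono[OF F(3)] derives_mono[OF G(3)]]) (use H(3) in auto)
  with F H show ?case by (intro exI[of _ "F \<union> H"]) auto
next
  case (AllSI \<Gamma> \<phi>)
  then obtain F where "F \<subseteq> liftS ` \<Gamma>" "finite F" "F \<turnstile> \<phi>" by blast
  then obtain G where "G \<subseteq> \<Gamma>" "finite G" "F = liftS ` G"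
    by (meson finite_subset_image)
  then show ?case using \<open>F \<turnstile> \<phi>\<close> derives.AllSI by blast
next
  case (ExSE \<Gamma> \<phi> \<chi>)
  obtain F where F: "F \<subseteq> \<Gamma>" "finite F" "F \<turnstile> ExS \<phi>"
    using ExSE.IH(1) by blast
  obtain G where G: "finite G" "G \<subseteq> liftS ` \<Gamma>" "insert \<phi> G \<turnstile> liftS \<chi>"
    using ExSE.IH(2) by (rule finite_compact_insert)
  then obtain H where H: "H \<subseteq> \<Gamma>" "finite H" "G = liftS ` H"
    by (meson finite_subset_image)
  have "F \<union> H \<turnstile> \<chi>"
    by (rule derives.ExSE[OF derives_mono[OF F(3)] derives_mono[OF G(3)]]) (use H(3) in auto)
  with F H show ?case by (intro exI[of _ "F \<union> H"]) auto
next
  case (EqE \<Gamma> s t \<phi>)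
  then obtain F G where *: "F \<subseteq> \<Gamma>" "finite F" "F \<turnstile> s \<^bold>= t" "G \<subseteq> \<Gamma>" "finite G" "G \<turnstile> instN s \<phi>" by blast
  have "F \<union> G \<turnstile> instN t \<phi>"
    by (rule derives.EqE[OF derives_mono[OF *(3)] derives_mono[OF *(6)]]) auto
  with * show ?case by (intro exI[of _ "F \<union> G"]) auto
next
  case (EqI \<Gamma> t)
  show ?case by (intro exI[of _ "{}"]) (auto intro: derives.EqI)
next
  case (AndE1 \<Gamma> \<phi> \<psi>)
  then show ?case using derives.AndE1 by metis
next
  case (AndE2 \<Gamma> \<phi> \<psi>)
  then show ?case using derives.AndE2 by metis
next
  case (OrI1 \<Gamma> \<phi> \<psi>)
  then show ?case using derives.OrI1 by metis
next
  case (OrI2 \<Gamma> \<psi> \<phi>)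
  then show ?case using derives.OrI2 by metis
next
  case (AllNE \<Gamma> \<phi> t)
  then show ?case using derives.AllNE by metis
next
  case (ExNI \<Gamma> t \<phi>)
  then show ?case using derives.ExNI by metis
next
  case (AllSE \<Gamma> \<phi> X)
  then show ?case using derives.AllSE by metis
next
  case (ExSI \<Gamma> X \<phi>)
  then show ?case using derives.ExSI by metis
qed

section \<open>Henkin models\<close>

definition consistent :: "fm set \<Rightarrow> bool" where
  "consistent \<Gamma> \<longleftrightarrow> \<not> (\<Gamma> \<turnstile> \<^bold>\<bottom>)"

definition witness :: "nat \<Rightarrow> fm \<Rightarrow> fm set" where
  "witness n \<phi> = (case \<phi> of ExN \<psi> \<Rightarrow> {instN (Var n) \<psi>} | ExS \<psi> \<Rightarrow> {instS n \<psi>} | _ \<Rightarrow> {})"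

lemma consistent_mono: "consistent \<Delta> \<Longrightarrow> \<Gamma> \<subseteq> \<Delta> \<Longrightarrow> consistent \<Gamma>"
  unfolding consistent_def using derives_mono by blast

text \<open>A substitution sends the fresh variable \<open>n\<close> to the index 0 and shifts all
  others. It turns the theory into its lift and the witness instance back into
  \<open>\<psi>\<close>, which is the premise of the elimination rule.\<close>

lemma consistent_witness:
  assumes "consistent \<Gamma>" "\<And>\<psi>. \<psi> \<in> \<Gamma> \<Longrightarrow> below n n \<psi>" "\<phi> \<in> \<Gamma>"
  shows "consistent (\<Gamma> \<union> witness n \<phi>)"
proof -
  have "\<not> (insert (instN (Var n) \<psi>) \<Gamma> \<turnstile> \<^bold>\<bottom>)" if \<psi>: "\<phi> = ExN \<psi>" for \<psi>
  proof
    assume *: "insert (instN (Var n) \<psi>) \<Gamma> \<turnstile> \<^bold>\<bottom>"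
    define \<sigma> where "\<sigma> j = (if j = n then Var 0 else Var (Suc j))" for j
    have \<Gamma>: "subst \<sigma> id \<chi> = liftN \<chi>" if "\<chi> \<in> \<Gamma>" for \<chi>
      by (rule subst_below[OF assms(2)[OF that]]) (auto simp: \<sigma>_def)
    have "below (Suc n) n \<psi>"
      using assms(2)[OF assms(3)] \<psi> by simp
    then have "subst (\<lambda>i. subst_tm \<sigma> (case_nat (Var n) Var i)) (\<lambda>i. id (id i)) \<psi> = subst Var id \<psi>"
      by (rule subst_below) (auto simp: \<sigma>_def split: nat.splits)
    then have \<psi>': "subst \<sigma> id (instN (Var n) \<psi>) = \<psi>"
      by (simp add: subst_subst)
    have "subst \<sigma> id ` insert (instN (Var n) \<psi>) \<Gamma> \<turnstile> subst \<sigma> id \<^bold>\<bottom>"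
      using * by (rule derives_subst)
    then have "insert \<psi> (liftN ` \<Gamma>) \<turnstile> liftN \<^bold>\<bottom>"
      using \<Gamma> by (simp add: \<psi>' cong: image_cong)
    then have "\<Gamma> \<turnstile> \<^bold>\<bottom>"
      by (rule derives.ExNE[OF derives.Hyp[OF assms(3)[unfolded \<psi>]]])
    with assms(1) show False
      by (simp add: consistent_def)
  qed
  moreover have "\<not> (insert (instS n \<psi>) \<Gamma> \<turnstile> \<^bold>\<bottom>)" if \<psi>: "\<phi> = ExS \<psi>" for \<psi>
  proof
    assume *: "insert (instS n \<psi>) \<Gamma> \<turnstile> \<^bold>\<bottom>"
    define \<rho> where "\<rho> j = (if j = n then 0 else Suc j)" for j
    have \<Gamma>: "subst Var \<rho> \<chi> = liftS \<chi>" if "\<chi> \<in> \<Gamma>" for \<chi>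
      by (rule subst_below[OF assms(2)[OF that]]) (auto simp: \<rho>_def)
    have "below n (Suc n) \<psi>"
      using assms(2)[OF assms(3)] \<psi> by simp
    then have "subst (\<lambda>i. subst_tm Var (Var i)) (\<lambda>i. \<rho> (case_nat n id i)) \<psi> = subst Var id \<psi>"
      by (rule subst_below) (auto simp: \<rho>_def split: nat.splits)
    then have \<psi>': "subst Var \<rho> (instS n \<psi>) = \<psi>"
      by (simp add: subst_subst)
    have "subst Var \<rho> ` insert (instS n \<psi>) \<Gamma> \<turnstile> subst Var \<rho> \<^bold>\<bottom>"
      using * by (rule derives_subst)
    then have "insert \<psi> (liftS ` \<Gamma>) \<turnstile> liftS \<^bold>\<bottom>"
      using \<Gamma> by (simp add: \<psi>' cong: image_cong)
    then have "\<Gamma> \<turnstile> \<^bold>\<bottom>"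
      by (rule derives.ExSE[OF derives.Hyp[OF assms(3)[unfolded \<psi>]]])
    with assms(1) show False
      by (simp add: consistent_def)
  qed
  ultimately show ?thesis
    using assms(1) by (cases \<phi>) (auto simp: consistent_def witness_def)
qed

definition henkin :: "fm set \<Rightarrow> bool" where
  "henkin \<Delta> \<longleftrightarrow> consistent \<Delta> \<and> (\<forall>\<phi>. consistent (insert \<phi> \<Delta>) \<longrightarrow> \<phi> \<in> \<Delta>) \<and>
    (\<forall>\<phi>. ExN \<phi> \<in> \<Delta> \<longrightarrow> (\<exists>t. instN t \<phi> \<in> \<Delta>)) \<and> (\<forall>\<phi>. ExS \<phi> \<in> \<Delta> \<longrightarrow> (\<exists>X. instS X \<phi> \<in> \<Delta>))"

lemma ex_fresh: "finite A \<Longrightarrow> \<exists>n. \<forall>\<psi>\<in>A. below n n \<psi>"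
proof (induction rule: finite_induct)
  case (insert \<phi> A)
  then obtain n m where n: "\<forall>\<psi>\<in>A. below n n \<psi>" and m: "below m m \<phi>"
    using ex_below by blast
  have "\<forall>\<psi>\<in>insert \<phi> A. below (max n m) (max n m) \<psi>"
    using n m by (auto intro: below_mono)
  then show ?case ..
qed simp

definition fresh :: "fm set \<Rightarrow> nat" where
  "fresh A = (SOME n. \<forall>\<psi>\<in>A. below n n \<psi>)"

text \<open>\<open>T\<close> is kept out of the stages: they remain finite, so a fresh variable
  exists, while the closed formulas of \<open>T\<close> leave every variable fresh.\<close>

primrec stage :: "fm set \<Rightarrow> nat \<Rightarrow> fm set" where
  "stage T 0 = {}"
| "stage T (Suc k) = (let \<phi> = from_nat k; A = insert \<phi> (stage T k) in
     if consistent (T \<union> A) then A \<union> witness (fresh A) \<phi> else stage T k)"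

lemma henkin_extension:
  assumes "consistent T" "\<And>\<psi>. \<psi> \<in> T \<Longrightarrow> below 0 0 \<psi>"
  shows "\<exists>\<Delta>. henkin \<Delta> \<and> T \<subseteq> \<Delta>"
proof -
  have fin_wit: "finite (witness n \<phi>)" for n \<phi>
    by (auto simp: witness_def split: fm.splits)
  have fin: "finite (stage T k)" for k
    by (induction k) (auto simp: Let_def fin_wit)
  have cons: "consistent (T \<union> stage T k)" for k
  proof (induction k)
    case (Suc k)
    define A where "A = insert (from_nat k) (stage T k)"
    show ?case
    proof (cases "consistent (T \<union> A)")
      case True
      have "\<forall>\<psi>\<in>A. below (fresh A) (fresh A) \<psi>"
        unfolding fresh_def by (rule someI_ex, rule ex_fresh) (simp add: A_def fin)
      then have "consistent ((T \<union> A) \<union> witness (fresh A) (from_nat k))"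
        using assms(2) by (intro consistent_witness[OF True]) (auto simp: A_def intro: below_mono)
      with True show ?thesis
        by (simp add: A_def Let_def Un_assoc)
    next
      case False
      then show ?thesis
        using Suc by (simp add: A_def Let_def)
    qed
  qed (simp add: assms(1))
  have mono_Suc: "stage T k \<subseteq> stage T (Suc k)" for k
    by (auto simp: Let_def)
  then have mono: "stage T k \<subseteq> stage T l" if "k \<le> l" for k l
    using that by (rule lift_Suc_mono_le)
  define \<Delta> where "\<Delta> = T \<union> (\<Union>k. stage T k)"
  have "consistent \<Delta>"
  proof (rule ccontr)
    assume "\<not> consistent \<Delta>"
    then obtain F where F: "F \<subseteq> \<Delta>" "finite F" "F \<turnstile> \<^bold>\<bottom>"
      unfolding consistent_def using derives_compact by blast
    have "\<exists>k. F \<subseteq> T \<union> stage T k"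
      using F(2,1)
    proof (induction rule: finite_induct)
      case (insert \<phi> F)
      then obtain k where k: "F \<subseteq> T \<union> stage T k" by blast
      from insert.prems obtain l where "\<phi> \<in> T \<union> stage T l"
        by (auto simp: \<Delta>_def)
      with k have "insert \<phi> F \<subseteq> T \<union> stage T (max k l)"
        using mono[of k "max k l"] mono[of l "max k l"] by auto
      then show ?case ..
    qed simp
    with F(3) cons show False
      unfolding consistent_def using derives_mono by blast
  qed
  moreover have added: "\<phi> \<in> \<Delta> \<and> (\<exists>n. witness n \<phi> \<subseteq> \<Delta>)" if "consistent (insert \<phi> \<Delta>)" for \<phi>
  proof -
    define k where "k = to_nat \<phi>"
    define A where "A = insert \<phi> (stage T k)"
    have "consistent (T \<union> A)"
      by (rule consistent_mono[OF that]) (auto simp: A_def \<Delta>_def)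
    then have "stage T (Suc k) = A \<union> witness (fresh A) \<phi>"
      by (simp add: A_def Let_def k_def)
    then have "A \<union> witness (fresh A) \<phi> \<subseteq> \<Delta>"
      unfolding \<Delta>_def by blast
    then show ?thesis
      by (auto simp: A_def)
  qed
  \<comment> \<open>A member of \<open>\<Delta>\<close>, even one that comes from \<open>T\<close>,
    is enumerated at some stage and receives its witness there.\<close>
  moreover have "\<exists>n. witness n \<phi> \<subseteq> \<Delta>" if "\<phi> \<in> \<Delta>" for \<phi>
    using added[of \<phi>] that \<open>consistent \<Delta>\<close> by (simp add: insert_absorb)
  then have "\<exists>t. instN t \<phi> \<in> \<Delta>" if "ExN \<phi> \<in> \<Delta>" for \<phi>
    using that by (fastforce simp: witness_def)
  moreover have "\<exists>X. instS X \<phi> \<in> \<Delta>" if "ExS \<phi> \<in> \<Delta>" for \<phi>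
    using that \<open>\<And>\<phi>. \<phi> \<in> \<Delta> \<Longrightarrow> \<exists>n. witness n \<phi> \<subseteq> \<Delta>\<close> by (fastforce simp: witness_def)
  ultimately have "henkin \<Delta>"
    unfolding henkin_def by blast
  then show ?thesis
    unfolding \<Delta>_def by blast
qed

locale henkin_set =
  fixes \<Delta> :: "fm set"
  assumes henkin: "henkin \<Delta>"
begin

lemma cons: "\<not> (\<Delta> \<turnstile> \<^bold>\<bottom>)"
  using henkin by (simp add: henkin_def consistent_def)

lemma closed: "(\<Delta> \<turnstile> \<phi>) \<longleftrightarrow> \<phi> \<in> \<Delta>"
proof
  assume *: "\<Delta> \<turnstile> \<phi>"
  have "consistent (insert \<phi> \<Delta>)"
    unfolding consistent_def using cons derives.ImpE[OF derives.ImpI *] by blast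
  then show "\<phi> \<in> \<Delta>"
    using henkin by (simp add: henkin_def)
qed (rule derives.Hyp)

lemma neg: "(\<^bold>\<not> \<phi>) \<in> \<Delta> \<longleftrightarrow> \<phi> \<notin> \<Delta>"
proof
  show "\<phi> \<notin> \<Delta>" if "(\<^bold>\<not> \<phi>) \<in> \<Delta>"
    using that cons derives.ImpE[OF derives.Hyp derives.Hyp] by blast
  show "(\<^bold>\<not> \<phi>) \<in> \<Delta>" if "\<phi> \<notin> \<Delta>"
  proof -
    have "\<not> consistent (insert \<phi> \<Delta>)"
      using henkin that by (auto simp: henkin_def)
    then have "\<Delta> \<turnstile> \<^bold>\<not> \<phi>"
      unfolding consistent_def by (simp add: derives.ImpI)
    then show ?thesis
      by (simp add: closed)
  qed
qed

lemma imp: "(\<phi> \<^bold>\<longrightarrow> \<psi>) \<in> \<Delta> \<longleftrightarrow> (\<phi> \<in> \<Delta> \<longrightarrow> \<psi> \<in> \<Delta>)"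
proof
  show "\<phi> \<in> \<Delta> \<longrightarrow> \<psi> \<in> \<Delta>" if "(\<phi> \<^bold>\<longrightarrow> \<psi>) \<in> \<Delta>"
    using that derives.ImpE[OF derives.Hyp derives.Hyp] closed by blast
  assume *: "\<phi> \<in> \<Delta> \<longrightarrow> \<psi> \<in> \<Delta>"
  have "insert \<phi> \<Delta> \<turnstile> \<psi>"
  proof (cases "\<phi> \<in> \<Delta>")
    case True
    with * show ?thesis by (auto intro: derives.Hyp)
  next
    case False
    then have "(\<^bold>\<not> \<phi>) \<in> \<Delta>" by (simp add: neg)
    then have "insert \<phi> \<Delta> \<turnstile> \<^bold>\<bottom>"
      by (intro derives.ImpE[OF derives.Hyp derives.Hyp[of \<phi>]]) auto
    then have "insert (\<^bold>\<not> \<psi>) (insert \<phi> \<Delta>) \<turnstile> \<^bold>\<bottom>"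
      by (rule derives_mono) auto
    then show ?thesis by (rule derives.Contr)
  qed
  then have "\<Delta> \<turnstile> \<phi> \<^bold>\<longrightarrow> \<psi>" by (rule derives.ImpI)
  then show "(\<phi> \<^bold>\<longrightarrow> \<psi>) \<in> \<Delta>" by (simp add: closed)
qed

lemma conj: "(\<phi> \<^bold>\<and> \<psi>) \<in> \<Delta> \<longleftrightarrow> \<phi> \<in> \<Delta> \<and> \<psi> \<in> \<Delta>"
  using derives.AndI[of \<Delta> \<phi> \<psi>] derives.AndE1[of \<Delta> \<phi> \<psi>] derives.AndE2[of \<Delta> \<phi> \<psi>] unfolding closed by blast

lemma disj: "(\<phi> \<^bold>\<or> \<psi>) \<in> \<Delta> \<longleftrightarrow> \<phi> \<in> \<Delta> \<or> \<psi> \<in> \<Delta>"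
proof
  show "(\<phi> \<^bold>\<or> \<psi>) \<in> \<Delta>" if "\<phi> \<in> \<Delta> \<or> \<psi> \<in> \<Delta>"
    using that derives.OrI1[of \<Delta> \<phi> \<psi>] derives.OrI2[of \<Delta> \<psi> \<phi>] unfolding closed by blast
  show "\<phi> \<in> \<Delta> \<or> \<psi> \<in> \<Delta>" if "(\<phi> \<^bold>\<or> \<psi>) \<in> \<Delta>"
  proof (rule ccontr)
    assume "\<not> ?thesis"
    then have "(\<^bold>\<not> \<phi>) \<in> \<Delta>" "(\<^bold>\<not> \<psi>) \<in> \<Delta>"
      by (simp_all add: neg)
    then have "insert \<phi> \<Delta> \<turnstile> \<^bold>\<bottom>" "insert \<psi> \<Delta> \<turnstile> \<^bold>\<bottom>"
      by (auto intro: derives.ImpE[OF derives.Hyp derives.Hyp[of \<phi>]] derives.ImpE[OF derives.Hyp derives.Hyp[of \<psi>]])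
    then have "\<Delta> \<turnstile> \<^bold>\<bottom>"
      by (rule derives.OrE[OF derives.Hyp[OF that]])
    with cons show False ..
  qed
qed

lemma exN: "ExN \<phi> \<in> \<Delta> \<longleftrightarrow> (\<exists>t. instN t \<phi> \<in> \<Delta>)"
proof
  show "\<exists>t. instN t \<phi> \<in> \<Delta>" if "ExN \<phi> \<in> \<Delta>"
    using that henkin by (simp add: henkin_def)
  show "ExN \<phi> \<in> \<Delta>" if "\<exists>t. instN t \<phi> \<in> \<Delta>"
    using that derives.ExNI[of \<Delta> _ \<phi>] unfolding closed by blast
qed

lemma exS: "ExS \<phi> \<in> \<Delta> \<longleftrightarrow> (\<exists>X. instS X \<phi> \<in> \<Delta>)"
proof
  show "\<exists>X. instS X \<phi> \<in> \<Delta>" if "ExS \<phi> \<in> \<Delta>"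
    using that henkin by (simp add: henkin_def)
  show "ExS \<phi> \<in> \<Delta>" if "\<exists>X. instS X \<phi> \<in> \<Delta>"
    using that derives.ExSI[of \<Delta> _ \<phi>] unfolding closed by blast
qed

text \<open>Reduces universal quantifiers to the witness property, which \<open>henkin\<close>
  states for existential ones only.\<close>

lemma not_all_N: "insert (\<^bold>\<not> (ExN (\<^bold>\<not> \<phi>))) \<Gamma> \<turnstile> AllN \<phi>"
proof (rule derives.AllNI, rule derives.Contr)
  let ?\<Gamma> = "insert (\<^bold>\<not> \<phi>) (liftN ` insert (\<^bold>\<not> (ExN (\<^bold>\<not> \<phi>))) \<Gamma>)"
  let ?\<psi> = "subst (upN (\<lambda>i. Var (Suc i))) id \<phi>"
  have "(\<lambda>i. subst_tm (case_nat (Var 0) Var) (upN (\<lambda>i. Var (Suc i)) i)) = Var"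
    by (auto simp: upN_def split: nat.splits)
  then have "instN (Var 0) ?\<psi> = \<phi>"
    by (simp add: subst_subst)
  then have "?\<Gamma> \<turnstile> instN (Var 0) (\<^bold>\<not> ?\<psi>)"
    by (intro derives.Hyp) simp
  then have "?\<Gamma> \<turnstile> ExN (\<^bold>\<not> ?\<psi>)"
    by (rule derives.ExNI)
  moreover have "?\<Gamma> \<turnstile> \<^bold>\<not> (ExN (\<^bold>\<not> ?\<psi>))"
    by (rule derives.Hyp) simp
  ultimately show "?\<Gamma> \<turnstile> \<^bold>\<bottom>"
    using derives.ImpE by blast
qed

lemma not_all_S: "insert (\<^bold>\<not> (ExS (\<^bold>\<not> \<phi>))) \<Gamma> \<turnstile> AllS \<phi>"
proof (rule derives.AllSI, rule derives.Contr)
  let ?\<Gamma> = "insert (\<^bold>\<not> \<phi>) (liftS ` insert (\<^bold>\<not> (ExS (\<^bold>\<not> \<phi>))) \<Gamma>)"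
  let ?\<psi> = "subst Var (upS Suc) \<phi>"
  have "(\<lambda>i. case_nat 0 id (upS Suc i)) = id"
    by (auto simp: upS_def split: nat.splits)
  then have "instS 0 ?\<psi> = \<phi>"
    by (simp add: subst_subst)
  then have "?\<Gamma> \<turnstile> instS 0 (\<^bold>\<not> ?\<psi>)"
    by (intro derives.Hyp) simp
  then have "?\<Gamma> \<turnstile> ExS (\<^bold>\<not> ?\<psi>)"
    by (rule derives.ExSI)
  moreover have "?\<Gamma> \<turnstile> \<^bold>\<not> (ExS (\<^bold>\<not> ?\<psi>))"
    by (rule derives.Hyp) simp
  ultimately show "?\<Gamma> \<turnstile> \<^bold>\<bottom>"
    using derives.ImpE by blast
qed

lemma allN: "AllN \<phi> \<in> \<Delta> \<longleftrightarrow> (\<forall>t. instN t \<phi> \<in> \<Delta>)"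
proof
  show "\<forall>t. instN t \<phi> \<in> \<Delta>" if "AllN \<phi> \<in> \<Delta>"
    using that derives.AllNE[of \<Delta> \<phi>] unfolding closed by blast
  assume *: "\<forall>t. instN t \<phi> \<in> \<Delta>"
  have "(\<^bold>\<not> (ExN (\<^bold>\<not> \<phi>))) \<in> \<Delta>"
    using * by (simp add: neg exN)
  then have "\<Delta> \<turnstile> AllN \<phi>"
    using not_all_N[of \<phi> \<Delta>] by (simp add: insert_absorb)
  then show "AllN \<phi> \<in> \<Delta>" by (simp add: closed)
qed

lemma allS: "AllS \<phi> \<in> \<Delta> \<longleftrightarrow> (\<forall>X. instS X \<phi> \<in> \<Delta>)"
proof
  show "\<forall>X. instS X \<phi> \<in> \<Delta>" if "AllS \<phi> \<in> \<Delta>"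
    using that derives.AllSE[of \<Delta> \<phi>] unfolding closed by blast
  assume *: "\<forall>X. instS X \<phi> \<in> \<Delta>"
  have "(\<^bold>\<not> (ExS (\<^bold>\<not> \<phi>))) \<in> \<Delta>"
    using * by (simp add: neg exS)
  then have "\<Delta> \<turnstile> AllS \<phi>"
    using not_all_S[of \<phi> \<Delta>] by (simp add: insert_absorb)
  then show "AllS \<phi> \<in> \<Delta>" by (simp add: closed)
qed

lemma eq_subst: "(s \<^bold>= t) \<in> \<Delta> \<Longrightarrow> instN s \<phi> \<in> \<Delta> \<Longrightarrow> instN t \<phi> \<in> \<Delta>"
  using derives.EqE[of \<Delta> s t \<phi>] unfolding closed by blast

lemma instN_lift [simp]: "subst_tm (case_nat t Var) (lift_tm s) = s"
  by (simp add: subst_tm_subst_tm)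

lemma eq_refl: "(t \<^bold>= t) \<in> \<Delta>"
  using derives.EqI[of \<Delta> t] unfolding closed .

lemma eq_sym: "(s \<^bold>= t) \<in> \<Delta> \<Longrightarrow> (t \<^bold>= s) \<in> \<Delta>"
  using eq_subst[of s t "Var 0 \<^bold>= lift_tm s"] eq_refl by simp

lemma eq_trans: "(s \<^bold>= t) \<in> \<Delta> \<Longrightarrow> (t \<^bold>= u) \<in> \<Delta> \<Longrightarrow> (s \<^bold>= u) \<in> \<Delta>"
  using eq_subst[of t u "lift_tm s \<^bold>= Var 0"] by simp

lemma eq_add: "(s \<^bold>= s') \<in> \<Delta> \<Longrightarrow> (t \<^bold>= t') \<in> \<Delta> \<Longrightarrow> (s \<^bold>+ t \<^bold>= s' \<^bold>+ t') \<in> \<Delta>"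
  using eq_subst[of s s' "lift_tm (s \<^bold>+ t) \<^bold>= Var 0 \<^bold>+ lift_tm t"]
    eq_subst[of t t' "lift_tm (s \<^bold>+ t) \<^bold>= lift_tm s' \<^bold>+ Var 0"] eq_refl by simp

lemma eq_mul: "(s \<^bold>= s') \<in> \<Delta> \<Longrightarrow> (t \<^bold>= t') \<in> \<Delta> \<Longrightarrow> (s \<^bold>* t \<^bold>= s' \<^bold>* t') \<in> \<Delta>"
  using eq_subst[of s s' "lift_tm (s \<^bold>* t) \<^bold>= Var 0 \<^bold>* lift_tm t"]
    eq_subst[of t t' "lift_tm (s \<^bold>* t) \<^bold>= lift_tm s' \<^bold>* Var 0"] eq_refl by simp

lemma eq_lt: "(s \<^bold>= s') \<in> \<Delta> \<Longrightarrow> (t \<^bold>= t') \<in> \<Delta> \<Longrightarrow> (s \<^bold>< t) \<in> \<Delta> \<Longrightarrow> (s' \<^bold>< t') \<in> \<Delta>"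
  using eq_subst[of s s' "Var 0 \<^bold>< lift_tm t"] eq_subst[of t t' "lift_tm s' \<^bold>< Var 0"] by simp

lemma eq_mem: "(s \<^bold>= s') \<in> \<Delta> \<Longrightarrow> (s \<^bold>\<in> X) \<in> \<Delta> \<Longrightarrow> (s' \<^bold>\<in> X) \<in> \<Delta>"
  using eq_subst[of s s' "Var 0 \<^bold>\<in> X"] by simp

end

section \<open>Fast-growing functions in discrete semirings\<close>

text \<open>As a type class it makes the theory of ordered semirings available for the natural
  numbers and the term model alike.\<close>

class discrete_semidom = linordered_semidom +
  assumes zero_least: "0 \<le> x" and one_le: "0 < x \<Longrightarrow> 1 \<le> x"

instance nat :: discrete_semidom
  by standard auto

context discrete_semidom
begin

lemma less_iff_plus_one_le: "x < y \<longleftrightarrow> x + 1 \<le> y"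
proof
  assume "x < y"
  then have "0 < y - x"
    by (metis add_0 le_add_diff_inverse2 less_imp_le less_le zero_least)
  then have "1 \<le> y - x"
    by (rule one_le)
  then have "1 + x \<le> y - x + x"
    by (rule add_right_mono)
  with \<open>x < y\<close> show "x + 1 \<le> y"
    by (simp add: add_commute)
next
  assume "x + 1 \<le> y"
  moreover have "x < x + 1" by simp
  ultimately show "x < y" by (metis less_le_trans)
qed

lemma less_plus_one_iff: "x < y + 1 \<longleftrightarrow> x \<le> y"
  by (metis less_iff_plus_one_le not_less)

lemma pos_iff: "0 < x \<longleftrightarrow> x \<noteq> 0"
  using zero_least[of x] by auto

lemma le_add_right: "x \<le> x + y"
  using add_left_mono[OF zero_least[of y], of x] by simp

lemma le_sum3: "a \<le> a + b + c" "b \<le> a + b + c" "c \<le> a + b + c"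
  using le_add_right[of a "b + c"] le_add_right[of b "a + c"] le_add_right[of c "a + b"]
  by (simp_all add: ac_simps)

lemma not_less_zero [simp]: "\<not> x < 0"
  by (simp add: not_less zero_least)

text \<open>Makes divisibility expressible by a bounded formula. For \<open>t = 0\<close> the bound
  forces the quotient 0.\<close>

lemma dvd_bounded: "s dvd t \<longleftrightarrow> (\<exists>q<t + 1. s * q = t)"
proof
  assume "s dvd t"
  then obtain q where q: "t = s * q" ..
  show "\<exists>q<t + 1. s * q = t"
  proof (cases "t = 0")
    case True
    then show ?thesis
      by (intro exI[of _ 0]) simp
  next
    case False
    then have "s \<noteq> 0"
      using q by auto
    then have "1 \<le> s"
      by (simp add: one_le pos_iff)
    then have "1 * q \<le> s * q"
      using zero_least by (intro mult_right_mono)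
    then show ?thesis
      using q by (intro exI[of _ q]) (simp add: less_plus_one_iff)
  qed
qed auto

end

definition pr :: "'a::discrete_semidom \<Rightarrow> 'a \<Rightarrow> 'a" where
  "pr a b = (a + b) * (a + b) + a"

lemma pr_less:
  fixes a :: "'a::discrete_semidom"
  assumes "a + b < c + d"
  shows "pr a b < pr c d"
proof -
  let ?s = "a + b"
  have "a \<le> ?s + ?s"
    by (metis add.assoc le_add_right)
  then have "pr a b \<le> ?s * ?s + (?s + ?s)"
    unfolding pr_def by (rule add_left_mono)
  also have "\<dots> < ?s * ?s + (?s + ?s) + 1"
    by simp
  also have "\<dots> = (?s + 1) * (?s + 1)"
    by (simp add: algebra_simps)
  also have "\<dots> \<le> (c + d) * (c + d)"
    using assms by (intro mult_mono) (auto simp: zero_least less_iff_plus_one_le)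
  also have "\<dots> \<le> pr c d"
    unfolding pr_def by (rule le_add_right)
  finally show ?thesis .
qed

lemma pr_eq_iff: "pr a b = pr c d \<longleftrightarrow> a = c \<and> b = (d :: 'a::discrete_semidom)"
proof
  assume eq: "pr a b = pr c d"
  then have s: "a + b = c + d"
    using pr_less[of a b c d] pr_less[of c d a b] by (metis less_irrefl linorder_neqE)
  then have "a = c"
    using eq by (simp add: pr_def)
  with s show "a = c \<and> b = d" by simp
qed auto

text \<open>
  A pair \<open>c, d\<close> codes the set of all \<open>b\<close> whose modulus from Goedel's beta function divides \<open>c\<close>.
\<close>

definition elt :: "'a::discrete_semidom \<Rightarrow> 'a \<Rightarrow> 'a \<Rightarrow> bool" where
  "elt b c d \<longleftrightarrow> (1 + (b + 1) * d) dvd c"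

text \<open>Bezout for the moduli: \<open>(a+1)(1+(b+1)d) - (b+1)(1+(a+1)d) = a - b\<close>, which divides \<open>d\<close>.\<close>

lemma elt_mult:
  fixes a b c d :: "'a::discrete_semidom"
  assumes d: "\<And>k. 0 < k \<Longrightarrow> k \<le> m \<Longrightarrow> k dvd d" and ab: "a < m" "b < m" "a \<noteq> b"
  shows "elt b (c * (1 + (a + 1) * d)) d \<longleftrightarrow> elt b c d"
proof
  let ?p = "1 + (b + 1) * d" and ?q = "1 + (a + 1) * d"
  assume "elt b (c * ?q) d"
  then have pq: "?p dvd c * ?q"
    by (simp add: elt_def)
  have "\<exists>k. k dvd d \<and> ?p dvd c * (k * d)"
  proof (cases "a < b")
    case True
    define k where "k = b - a"
    have b: "b = a + k"
      using True by (simp add: k_def)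
    have "0 < k"
      using True by (metis add_0_right b less_irrefl pos_iff)
    moreover have "k \<le> m"
      using ab(2) by (metis b add.commute le_add_right le_less_trans less_imp_le)
    ultimately have "k dvd d"
      by (rule d)
    moreover have "c * ?p = c * ?q + c * (k * d)"
      by (simp add: b algebra_simps)
    then have "?p dvd c * (k * d)"
      using pq by (metis dvd_add_right_iff dvd_triv_right)
    ultimately show ?thesis by blast
  next
    case False
    define k where "k = a - b"
    have a: "a = b + k"
      using False ab(3) by (simp add: k_def)
    have "0 < k"
      using ab(3) by (metis add_0_right a pos_iff)
    moreover have "k \<le> m"
      using ab(1) by (metis a add.commute le_add_right le_less_trans less_imp_le)
    ultimately have "k dvd d"
      by (rule d)
    moreover have "c * ?q = c * ?p + c * (k * d)"
      by (simp add: a algebra_simps)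
    then have "?p dvd c * (k * d)"
      using pq by (metis dvd_add_right_iff dvd_triv_right)
    ultimately show ?thesis by blast
  qed
  then obtain k where k: "k dvd d" "?p dvd c * (k * d)"
    by blast
  from k(1) obtain h where h: "d = k * h" ..
  from k(2) have "?p dvd c * (k * d) * h"
    by (rule dvd_mult2)
  moreover have "c * (k * d) * h = c * (k * h) * d"
    by (simp only: ac_simps)
  ultimately have "?p dvd c * d * d"
    by (simp flip: h)
  \<comment> \<open>The modulus is 1 plus a multiple of \<open>d\<close>, hence coprime to
    \<open>d\<close>; the two factors \<open>d\<close> are cancelled one after the other.\<close>
  then have "?p dvd c * d * d * (b + 1)"
    by (rule dvd_mult2)
  moreover have "c * d * ?p = c * d * d * (b + 1) + c * d"
    by (simp add: algebra_simps)
  ultimately have "?p dvd c * d"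
    by (metis dvd_add_right_iff dvd_triv_right)
  then have "?p dvd c * d * (b + 1)"
    by (rule dvd_mult2)
  moreover have "c * ?p = c * d * (b + 1) + c"
    by (simp add: algebra_simps)
  ultimately have "?p dvd c"
    by (metis dvd_add_right_iff dvd_triv_right)
  then show "elt b c d"
    by (simp add: elt_def)
qed (simp add: elt_def)

text \<open>The number 1 codes the empty set, from which codes are built up by
  multiplication.\<close>

lemma not_elt_1: "0 < d \<Longrightarrow> \<not> elt b 1 (d :: 'a::discrete_semidom)"
proof
  assume "0 < d" "elt b 1 d"
  then obtain q where q: "1 = (1 + (b + 1) * d) * q"
    by (auto simp: elt_def elim: dvdE)
  have "0 < b + 1"
    by (metis le_less_trans less_plus_one_iff order_refl zero_least)
  then have "0 < (b + 1) * d"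
    using \<open>0 < d\<close> by simp
  then have 1: "1 < 1 + (b + 1) * d"
    by simp
  have "q \<noteq> 0"
    using q by auto
  then have "1 \<le> q"
    by (simp add: one_le pos_iff)
  then have "(1 + (b + 1) * d) * 1 \<le> (1 + (b + 1) * d) * q"
    by (intro mult_left_mono) (auto simp: zero_least)
  with q 1 show False
    by simp
qed

text \<open>
  \<open>thr (Suc n) x l y\<close>: some code below \<open>y\<close> contains the pair of \<open>l\<close> and an upper bound of the
  \<open>l\<close>-th iterate of \<open>fast n\<close> at \<open>x + 1\<close>. Every pair in the code is justified by an earlier one,
  so that no uniqueness of codes is needed.
\<close>

primrec thr :: "nat \<Rightarrow> 'a::discrete_semidom \<Rightarrow> 'a \<Rightarrow> 'a \<Rightarrow> bool" where
  "thr 0 x l y \<longleftrightarrow> x < y"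
| "thr (Suc n) x l y \<longleftrightarrow> (\<exists>c<y. \<exists>d<y. \<exists>m<y. l < m \<and> (\<exists>v<m. elt (pr l v) c d) \<and>
    (\<forall>i<m. \<forall>v<m. elt (pr i v) c d \<longrightarrow> (i = 0 \<and> v = x + 1) \<or>
      (\<exists>j<i. i = j + 1 \<and> (\<exists>u<m. elt (pr j u) c d \<and> thr n u u v))))"

text \<open>Following the justifications back to the pair for 0 shows that each listed value is at
  least the corresponding iterate; monotonicity of \<open>fast n\<close> carries the bound from one
  pair to the next.\<close>

lemma fast_le_thr: "thr n x x y \<Longrightarrow> fast n x \<le> (y :: nat)"
proof (induction n arbitrary: x y)
  case (Suc n)
  from Suc.prems obtain c d m v where *: "m < y" "x < m" "v < m" "elt (pr x v) c d"
    and just: "\<And>i v. i < m \<Longrightarrow> v < m \<Longrightarrow> elt (pr i v) c d \<Longrightarrow> (i = 0 \<and> v = x + 1) \<or>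
      (\<exists>j<i. i = j + 1 \<and> (\<exists>u<m. elt (pr j u) c d \<and> thr n u u v))"
    by auto
  have "(fast n ^^ i) (Suc x) \<le> v" if "i < m" "v < m" "elt (pr i v) c d" for i v
    using that
  proof (induction i arbitrary: v)
    case 0
    then show ?case
      using just[of 0 v] by auto
  next
    case (Suc i)
    then obtain u where u: "u < m" "elt (pr i u) c d" "thr n u u v"
      using just[of "Suc i" v] by auto
    have "fast n ((fast n ^^ i) (Suc x)) \<le> fast n u"
      using Suc.IH[OF _ u(1,2)] Suc.prems(1) fast_mono[of n] by (auto dest: monoD)
    also have "\<dots> \<le> v"
      using \<open>\<And>x y. thr n x x y \<Longrightarrow> fast n x \<le> y\<close> u(3) by blast
    finally show ?case by simp
  qed
  from this[OF *(2-4)] *(1,3) show ?case by simp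
qed auto

section \<open>Bounded formulas for the growth relation\<close>

definition arithM :: "('a::discrete_semidom \<Rightarrow> 's \<Rightarrow> bool) \<Rightarrow> ('a, 's) struct" where
  "arithM mem = \<lparr>domM = UNIV, setsM = UNIV, zeroM = 0, oneM = 1, addM = (+), mulM = (*),
    eqM = (=), ltM = (<), memM = mem\<rparr>"

lemma arithM_simps [simp]:
  "domM (arithM mem) = UNIV" "setsM (arithM mem) = UNIV" "zeroM (arithM mem) = 0" "oneM (arithM mem) = 1"
  "addM (arithM mem) = (+)" "mulM (arithM mem) = (*)" "eqM (arithM mem) = (=)" "ltM (arithM mem) = (<)"
  "memM (arithM mem) = mem"
  by (simp_all add: arithM_def)

abbreviation BEx :: "tm \<Rightarrow> fm \<Rightarrow> fm" where
  "BEx t \<phi> \<equiv> ExN (Var 0 \<^bold>< lift_tm t \<^bold>\<and> \<phi>)"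

abbreviation BAll :: "tm \<Rightarrow> fm \<Rightarrow> fm" where
  "BAll t \<phi> \<equiv> AllN (Var 0 \<^bold>< lift_tm t \<^bold>\<longrightarrow> \<phi>)"

definition elt_fm :: "tm \<Rightarrow> tm \<Rightarrow> tm \<Rightarrow> fm" where
  "elt_fm b c d = BEx (c \<^bold>+ \<^bold>1) (lift_tm (\<^bold>1 \<^bold>+ (b \<^bold>+ \<^bold>1) \<^bold>* d) \<^bold>* Var 0 \<^bold>= lift_tm c)"

text \<open>
  The quantifiers bind, from the outside, \<open>c, d, m\<close> followed by either \<open>v\<close> or \<open>i, v, j, u\<close>.
\<close>

primrec thr_fm :: "nat \<Rightarrow> tm \<Rightarrow> tm \<Rightarrow> tm \<Rightarrow> fm" where
  "thr_fm 0 x l y = (x \<^bold>< y)"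
| "thr_fm (Suc n) x l y =
    BEx y (BEx (lift_tm y) (BEx (lift_tm (lift_tm y))
      (lift_tm (lift_tm (lift_tm l)) \<^bold>< Var 0 \<^bold>\<and>
       BEx (Var 0)
         (elt_fm (pair_tm (lift_tm (lift_tm (lift_tm (lift_tm l)))) (Var 0)) (Var 3) (Var 2)) \<^bold>\<and>
       BAll (Var 0) (BAll (Var 1)
         (elt_fm (pair_tm (Var 1) (Var 0)) (Var 4) (Var 3) \<^bold>\<longrightarrow>
           (Var 1 \<^bold>= \<^bold>0 \<^bold>\<and> Var 0 \<^bold>= lift_tm (lift_tm (lift_tm (lift_tm (lift_tm x)))) \<^bold>+ \<^bold>1) \<^bold>\<or>
           BEx (Var 1) (Var 2 \<^bold>= Var 0 \<^bold>+ \<^bold>1 \<^bold>\<and>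
             BEx (Var 3)
               (elt_fm (pair_tm (Var 1) (Var 0)) (Var 6) (Var 5) \<^bold>\<and> thr_fm n (Var 0) (Var 0) (Var 2))))))))"

lemma bounded_BEx [simp]: "bounded_fm \<phi> \<Longrightarrow> bounded_fm (BEx t \<phi>)"
  by (rule bounded_fm.intros)

lemma bounded_BAll [simp]: "bounded_fm \<phi> \<Longrightarrow> bounded_fm (BAll t \<phi>)"
  by (rule bounded_fm.intros)

lemma bounded_elt_fm [simp]: "bounded_fm (elt_fm b c d)"
  by (simp add: elt_fm_def del: subst_tm.simps)

lemma bounded_thr_fm [simp]: "bounded_fm (thr_fm n x l y)"
  by (induction n arbitrary: x l y) (simp_all del: subst_tm.simps)

lemma sat_BEx [simp]:
  "satM (arithM mem) e v (BEx t \<phi>) \<longleftrightarrow> (\<exists>x<evM (arithM mem) e t. satM (arithM mem) (case_nat x e) v \<phi>)"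
  by (simp add: evM_subst)

lemma sat_BAll [simp]:
  "satM (arithM mem) e v (BAll t \<phi>) \<longleftrightarrow> (\<forall>x<evM (arithM mem) e t. satM (arithM mem) (case_nat x e) v \<phi>)"
  by (simp add: evM_subst)

lemma sat_elt_fm [simp]:
  "satM (arithM mem) e v (elt_fm b c d) \<longleftrightarrow>
    elt (evM (arithM mem) e b) (evM (arithM mem) e c) (evM (arithM mem) e d)"
  by (simp add: elt_fm_def evM_subst elt_def dvd_bounded del: subst_tm.simps)

lemma ev_pair_tm [simp]:
  "evM (arithM mem) e (pair_tm s t) = pr (evM (arithM mem) e s) (evM (arithM mem) e t)"
  by (simp add: pair_tm_def pr_def)

lemma sat_thr_fm [simp]:
  "satM (arithM mem) e v (thr_fm n x l y) \<longleftrightarrow>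
    thr n (evM (arithM mem) e x) (evM (arithM mem) e l) (evM (arithM mem) e y)"
proof (induction n arbitrary: e x l y)
  case (Suc n)
  show ?case
    unfolding thr_fm.simps thr.simps sat_BEx sat_BAll satM.simps Suc.IH sat_elt_fm ev_pair_tm
    by (simp add: evM_subst numeral_2_eq_2 numeral_3_eq_3 eval_nat_numeral)
qed simp

lemma below_lift_tm [simp]: "below_tm k t \<Longrightarrow> below_tm (Suc k) (lift_tm t)"
  by (induction t) auto

lemma below_elt_fm [simp]: "below_tm k b \<Longrightarrow> below_tm k c \<Longrightarrow> below_tm k d \<Longrightarrow> below k 0 (elt_fm b c d)"
  by (simp add: elt_fm_def)

lemma below_thr_fm [simp]:
  "below_tm k x \<Longrightarrow> below_tm k l \<Longrightarrow> below_tm k y \<Longrightarrow> below k 0 (thr_fm n x l y)"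
  by (induction n arbitrary: k x l y) (simp_all add: pair_tm_def)

text \<open>Number variable 0 is the value and number variable 1 the argument.\<close>

definition graph_fm :: "nat \<Rightarrow> fm" where
  "graph_fm n = ExN (thr_fm n (Var 2) (Var 2) (Var 1) \<^bold>\<and> BAll (Var 1) (\<^bold>\<not> (thr_fm n (Var 3) (Var 3) (Var 0))))"

definition total_fm :: "nat \<Rightarrow> fm" where
  "total_fm n = AllN (Ex1N (graph_fm n))"

lemma Sigma01_graph_fm: "Sigma01 (graph_fm n)"
proof -
  have "bounded_fm (thr_fm n (Var 2) (Var 2) (Var 1) \<^bold>\<and> BAll (Var 1) (\<^bold>\<not> (thr_fm n (Var 3) (Var 3) (Var 0))))"
    by (simp del: subst_tm.simps)
  then show ?thesis
    unfolding graph_fm_def Sigma01_def by blast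
qed

lemma below_graph_fm: "below 2 0 (graph_fm n)"
  by (simp add: graph_fm_def eval_nat_numeral)

lemma sat_graph_fm:
  "satM (arithM mem) e v (graph_fm n) \<longleftrightarrow> thr n (e 1) (e 1) (e 0) \<and> (\<forall>y<e 0. \<not> thr n (e 1) (e 1) y)"
  unfolding graph_fm_def satM.simps(9) sat_BAll satM.simps
  by (simp add: eval_nat_numeral)

section \<open>Consistency of the base theory\<close>

lemma RCA0_axiom_cases:
  assumes "\<psi> \<in> RCA0"
  obtains \<phi> where "\<psi> \<in> closures \<phi>" "\<phi> \<in> discrete_ordered_semiring"
  | \<phi> where "\<psi> \<in> closures (induction_axiom \<phi>)" "Sigma01 \<phi>"
  | \<phi> \<chi> where "\<psi> \<in> closures (comprehension_axiom \<phi> \<chi>)" "Sigma01 \<phi>" "Pi01 \<chi>"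
  using assms unfolding RCA0_def by blast

lemma std_RCA0: "\<psi> \<in> RCA0 \<Longrightarrow> satM stdM e v \<psi>"
proof -
  assume "\<psi> \<in> RCA0"
  have env: "env stdM e v" for e v
    by (simp add: env_def stdM_def)
  have "\<exists>\<phi>. \<psi> \<in> closures \<phi> \<and> (\<forall>e v. satM stdM e v \<phi>)"
    using \<open>\<psi> \<in> RCA0\<close>
  proof (cases rule: RCA0_axiom_cases)
    case (1 \<phi>)
    have "sat e v \<phi>" for e v
      using semiring_axiom_cases[OF 1(2)]
    proof
      assume "\<phi> = (Var 0 \<^bold>< Var 1 \<^bold>\<longrightarrow> ExN (lift_tm (Var 0) \<^bold>+ Var 0 \<^bold>= lift_tm (Var 1)))"
      then show ?thesis
        by (auto intro: exI[of _ "e 1 - e 0"])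
    qed simp
    with 1(1) show ?thesis
      unfolding satM_std by blast
  next
    case (2 \<phi>)
    have "sat e v (induction_axiom \<phi>)" for e v
    proof -
      have Suc: "sat (case_nat x e) v (subst (case_nat (Var 0 \<^bold>+ \<^bold>1) (\<lambda>i. Var (Suc i))) id \<phi>) \<longleftrightarrow>
        sat (case_nat (Suc x) e) v \<phi>" for x
      proof -
        have "(\<lambda>i. eval (case_nat x e) (case_nat (Var 0 \<^bold>+ \<^bold>1) (\<lambda>i. Var (Suc i)) i)) = case_nat (Suc x) e"
          by (auto split: nat.splits)
        then show ?thesis by (simp add: sat_subst)
      qed
      have zero: "sat e v (instN \<^bold>0 \<phi>) \<longleftrightarrow> sat (case_nat 0 e) v \<phi>"
      proof -
        have "(\<lambda>i. eval e (case_nat \<^bold>0 Var i)) = case_nat 0 e"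
          by (auto split: nat.splits)
        then show ?thesis by (simp add: sat_subst)
      qed
      show ?thesis
        unfolding induction_axiom_def sat.simps
      proof (intro impI allI)
        fix n
        assume "sat e v (instN \<^bold>0 \<phi>) \<and> (\<forall>n. sat (case_nat n e) v \<phi> \<longrightarrow>
          sat (case_nat n e) v (subst (case_nat (Var 0 \<^bold>+ \<^bold>1) (\<lambda>i. Var (Suc i))) id \<phi>))"
        with Suc zero show "sat (case_nat n e) v \<phi>"
          by (induction n) auto
      qed
    qed
    with 2(1) show ?thesis
      unfolding satM_std by blast
  next
    case (3 \<phi> \<chi>)
    have "sat e v (comprehension_axiom \<phi> \<chi>)" for e v
    proof -
      have "sat e (case_nat {x. sat (case_nat x e) v \<phi>} v) (AllN (Var 0 \<^bold>\<in> 0 \<^bold>\<longleftrightarrow> liftS \<phi>))"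
        by (simp add: sat_subst)
      then show ?thesis
        unfolding comprehension_axiom_def sat.simps(5,11) by blast
    qed
    with 3(1) show ?thesis
      unfolding satM_std by blast
  qed
  then show ?thesis
    using std.sat_closures env by blast
qed

lemma consistent_RCA0: "consistent RCA0"
  unfolding consistent_def
proof
  assume "RCA0 \<turnstile> \<^bold>\<bottom>"
  then have "satM stdM (\<lambda>_. 0) (\<lambda>_. {}) \<^bold>\<bottom>"
  proof (rule std.soundness)
    show "env stdM (\<lambda>_. 0) (\<lambda>_. {})"
      by (simp add: env_def stdM_def)
  qed (rule std_RCA0)
  then show False by simp
qed

lemma RCA0_closed: "\<psi> \<in> RCA0 \<Longrightarrow> below 0 0 \<psi>"
  unfolding RCA0_def using closures_closed by blast

lemma below_subst_tm: "below_tm n t \<Longrightarrow> (\<And>i. i < n \<Longrightarrow> below_tm k (\<sigma> i)) \<Longrightarrow> below_tm k (subst_tm \<sigma> t)"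
  by (induction t) auto

lemma below_subst: "below n m \<phi> \<Longrightarrow> (\<And>i. i < n \<Longrightarrow> below_tm k (\<sigma> i)) \<Longrightarrow> (\<And>i. i < m \<Longrightarrow> \<rho> i < l) \<Longrightarrow> below k l (subst \<sigma> \<rho> \<phi>)"
proof (induction \<phi> arbitrary: n m k l \<sigma> \<rho>)
  case (AllN \<phi>)
  have "below (Suc k) l (subst (upN \<sigma>) \<rho> \<phi>)"
    by (rule AllN.IH[of "Suc n" m]) (use AllN.prems in \<open>auto simp: upN_def split: nat.splits\<close>)
  then show ?case by simp
next
  case (ExN \<phi>)
  have "below (Suc k) l (subst (upN \<sigma>) \<rho> \<phi>)"
    by (rule ExN.IH[of "Suc n" m]) (use ExN.prems in \<open>auto simp: upN_def split: nat.splits\<close>)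
  then show ?case by simp
next
  case (AllS \<phi>)
  have "below k (Suc l) (subst \<sigma> (upS \<rho>) \<phi>)"
    by (rule AllS.IH[of n "Suc m"]) (use AllS.prems in \<open>auto simp: upS_def split: nat.splits\<close>)
  then show ?case by simp
next
  case (ExS \<phi>)
  have "below k (Suc l) (subst \<sigma> (upS \<rho>) \<phi>)"
    by (rule ExS.IH[of n "Suc m"]) (use ExS.prems in \<open>auto simp: upS_def split: nat.splits\<close>)
  then show ?case by simp
next
  case (Imp \<phi> \<psi>)
  from Imp.IH(1)[of n m k \<sigma> \<rho> l] Imp.IH(2)[of n m k \<sigma> \<rho> l] Imp.prems show ?case by simp
next
  case (And \<phi> \<psi>)
  from And.IH(1)[of n m k \<sigma> \<rho> l] And.IH(2)[of n m k \<sigma> \<rho> l] And.prems show ?case by simp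
next
  case (Or \<phi> \<psi>)
  from Or.IH(1)[of n m k \<sigma> \<rho> l] Or.IH(2)[of n m k \<sigma> \<rho> l] Or.prems show ?case by simp
qed (auto intro: below_subst_tm)

lemma below_total_fm: "below 0 0 (total_fm n)"
proof -
  have "below (Suc (Suc (Suc 0))) 0 (subst (case_nat (Var 0) (\<lambda>i. Var (Suc (Suc i)))) id (graph_fm n))"
    by (rule below_subst[OF below_graph_fm]) (auto split: nat.splits)
  moreover have "below (Suc (Suc 0)) 0 (graph_fm n)"
    using below_graph_fm[of n] by (simp add: eval_nat_numeral)
  ultimately show ?thesis
    by (simp add: total_fm_def Ex1N_def)
qed

section \<open>Provable totality of the fast-growing functions\<close>

text \<open>
  A single term model \<open>H\<close> serves for all the sentences \<open>total_fm n\<close>: if one of them is not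
  derivable, \<open>H\<close> refutes such a sentence. A global choice makes the model a type, and
  thereby an instance of the arithmetic type classes.
\<close>

definition countermodel_theory :: "fm set" where
  "countermodel_theory = (if \<forall>n. RCA0 \<turnstile> total_fm n then RCA0
     else insert (\<^bold>\<not> (total_fm (SOME n. \<not> (RCA0 \<turnstile> total_fm n)))) RCA0)"

definition H :: "fm set" where
  "H = (SOME \<Delta>. henkin \<Delta> \<and> countermodel_theory \<subseteq> \<Delta>)"

lemma H: "henkin H" "countermodel_theory \<subseteq> H"
proof -
  have "\<not> (RCA0 \<turnstile> total_fm (SOME n. \<not> (RCA0 \<turnstile> total_fm n)))" if "\<not> (\<forall>n. RCA0 \<turnstile> total_fm n)"
    using that by (intro someI_ex[of "\<lambda>n. \<not> (RCA0 \<turnstile> total_fm n)"]) simp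
  then have "consistent countermodel_theory"
    using consistent_RCA0 derives.Contr unfolding countermodel_theory_def consistent_def by (simp split: if_splits) blast
  then have "\<exists>\<Delta>. henkin \<Delta> \<and> countermodel_theory \<subseteq> \<Delta>"
    by (rule henkin_extension) (auto simp: countermodel_theory_def RCA0_closed below_total_fm split: if_splits)
  then have "henkin H \<and> countermodel_theory \<subseteq> H"
    unfolding H_def by (rule someI_ex)
  then show "henkin H" "countermodel_theory \<subseteq> H"
    by auto
qed

lemma RCA0_H: "RCA0 \<subseteq> H"
  using H(2) by (auto simp: countermodel_theory_def split: if_splits)

global_interpretation H: henkin_set H
  by unfold_locales (rule H(1))

\<comment> \<open>The term model as a discrete ordered semiring\<close>
quotient_type hn = tm / "\<lambda>s t. (s \<^bold>= t) \<in> H"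
  by (rule equivpI) (auto intro!: reflpI sympI transpI intro: H.eq_refl H.eq_sym H.eq_trans)

instantiation hn :: "{zero, one, plus, times, minus, ord}"
begin

lift_definition zero_hn :: hn is "\<^bold>0" .
lift_definition one_hn :: hn is "\<^bold>1" .
lift_definition plus_hn :: "hn \<Rightarrow> hn \<Rightarrow> hn" is "(\<^bold>+)" by (rule H.eq_add)
lift_definition times_hn :: "hn \<Rightarrow> hn \<Rightarrow> hn" is "(\<^bold>*)" by (rule H.eq_mul)
lift_definition less_hn :: "hn \<Rightarrow> hn \<Rightarrow> bool" is "\<lambda>s t. (s \<^bold>< t) \<in> H"
  using H.eq_lt H.eq_sym by blast
definition less_eq_hn :: "hn \<Rightarrow> hn \<Rightarrow> bool" where "less_eq_hn x y \<longleftrightarrow> x < y \<or> x = y"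
text \<open>The axioms only say that differences exist, so one is chosen; cancellation makes it
  unique. The value 0 elsewhere is truncated subtraction.\<close>

definition minus_hn :: "hn \<Rightarrow> hn \<Rightarrow> hn" where "minus_hn x y = (if y < x then SOME z. y + z = x else 0)"

instance ..

end

lift_definition mem_hn :: "hn \<Rightarrow> nat \<Rightarrow> bool" is "\<lambda>t X. (t \<^bold>\<in> X) \<in> H"
  using H.eq_mem H.eq_sym by blast

definition HM :: "(hn, nat) struct" where
  "HM = \<lparr>domM = UNIV, setsM = UNIV, zeroM = 0, oneM = 1, addM = (+), mulM = (*),
    eqM = (=), ltM = (<), memM = mem_hn\<rparr>"

lemma HM_simps [simp]:
  "domM HM = UNIV" "setsM HM = UNIV" "zeroM HM = 0" "oneM HM = 1"
  "addM HM = (+)" "mulM HM = (*)" "eqM HM = (=)" "ltM HM = (<)" "memM HM = mem_hn"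
  by (simp_all add: HM_def)

global_interpretation HM: model HM
  by unfold_locales auto

lemma ev_HM: "evM HM (\<lambda>i. abs_hn (\<sigma> i)) t = abs_hn (subst_tm \<sigma> t)"
  by (induction t) (simp_all add: zero_hn.abs_eq one_hn.abs_eq plus_hn.abs_eq times_hn.abs_eq)

lemma hn_exhaust: obtains t where "x = abs_hn t"
  by (metis Quotient3_abs_rep Quotient3_hn)

lemma truth: "satM HM (\<lambda>i. abs_hn (\<sigma> i)) \<rho> \<phi> \<longleftrightarrow> subst \<sigma> \<rho> \<phi> \<in> H"
proof (induction \<phi> arbitrary: \<sigma> \<rho>)
  case (AllN \<phi>)
  have "satM HM (case_nat (abs_hn t) (\<lambda>i. abs_hn (\<sigma> i))) \<rho> \<phi> \<longleftrightarrow> instN t (subst (upN \<sigma>) \<rho> \<phi>) \<in> H" for t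
  proof -
    have "case_nat (abs_hn t) (\<lambda>i. abs_hn (\<sigma> i)) = (\<lambda>i. abs_hn (case_nat t \<sigma> i))"
      by (auto split: nat.splits)
    moreover have "(\<lambda>i. subst_tm (case_nat t Var) (upN \<sigma> i)) = case_nat t \<sigma>"
      by (auto simp: upN_def subst_tm_subst_tm split: nat.splits)
    ultimately show ?thesis
      using AllN[of "case_nat t \<sigma>" \<rho>] by (simp add: subst_subst)
  qed
  then show ?case
    by (simp add: H.allN) (metis hn_exhaust)
next
  case (ExN \<phi>)
  have "satM HM (case_nat (abs_hn t) (\<lambda>i. abs_hn (\<sigma> i))) \<rho> \<phi> \<longleftrightarrow> instN t (subst (upN \<sigma>) \<rho> \<phi>) \<in> H" for t
  proof -
    have "case_nat (abs_hn t) (\<lambda>i. abs_hn (\<sigma> i)) = (\<lambda>i. abs_hn (case_nat t \<sigma> i))"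
      by (auto split: nat.splits)
    moreover have "(\<lambda>i. subst_tm (case_nat t Var) (upN \<sigma> i)) = case_nat t \<sigma>"
      by (auto simp: upN_def subst_tm_subst_tm split: nat.splits)
    ultimately show ?thesis
      using ExN[of "case_nat t \<sigma>" \<rho>] by (simp add: subst_subst)
  qed
  then show ?case
    by (simp add: H.exN) (metis hn_exhaust)
next
  case (AllS \<phi>)
  have "(\<lambda>i. case_nat X id (upS \<rho> i)) = case_nat X \<rho>" for X
    by (auto simp: upS_def split: nat.splits)
  then show ?case
    by (simp add: H.allS AllS subst_subst)
next
  case (ExS \<phi>)
  have "(\<lambda>i. case_nat X id (upS \<rho> i)) = case_nat X \<rho>" for X
    by (auto simp: upS_def split: nat.splits)
  then show ?case
    by (simp add: H.exS ExS subst_subst)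
next
  case Fls
  then show ?case
    using H.cons by (auto intro: derives.Hyp)
qed (simp_all add: ev_HM hn.abs_eq_iff less_hn.abs_eq mem_hn.abs_eq H.imp H.conj H.disj)

lemma truth_closed: "below 0 0 \<psi> \<Longrightarrow> satM HM e v \<psi> \<longleftrightarrow> \<psi> \<in> H"
proof -
  assume closed: "below 0 0 \<psi>"
  have "e = (\<lambda>i. abs_hn (rep_hn (e i)))"
    by (simp add: Quotient3_abs_rep[OF Quotient3_hn])
  then have "satM HM e v \<psi> \<longleftrightarrow> subst (\<lambda>i. rep_hn (e i)) v \<psi> \<in> H"
    using truth by metis
  also have "subst (\<lambda>i. rep_hn (e i)) v \<psi> = subst Var id \<psi>"
    by (rule subst_below[OF closed]) auto
  finally show ?thesis by simp
qed

lemma HM_axiom: "\<psi> \<in> closures \<phi> \<Longrightarrow> \<psi> \<in> RCA0 \<Longrightarrow> satM HM e v \<phi>"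
  using HM.sat_closures[of \<psi> \<phi>] truth_closed[OF RCA0_closed] RCA0_H by (auto simp: env_def)

lemma HM_semiring: "\<phi> \<in> discrete_ordered_semiring \<Longrightarrow> satM HM e v \<phi>"
proof -
  assume \<phi>: "\<phi> \<in> discrete_ordered_semiring"
  obtain \<psi> where "\<psi> \<in> closures \<phi>"
    using closures_nonempty by blast
  then show ?thesis
    using \<phi> by (intro HM_axiom) (auto simp: RCA0_def)
qed

lemma HM_induction: "Sigma01 \<phi> \<Longrightarrow> satM HM e v (induction_axiom \<phi>)"
proof -
  assume \<phi>: "Sigma01 \<phi>"
  obtain \<psi> where "\<psi> \<in> closures (induction_axiom \<phi>)"
    using closures_nonempty by blast
  then show ?thesis
    using \<phi> by (intro HM_axiom) (auto simp: RCA0_def)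
qed

lemma hn_axioms:
  fixes x y z :: hn
  shows "(x + y) + z = x + (y + z)" "x + y = y + x" "(x * y) * z = x * (y * z)" "x * y = y * x"
    "x * (y + z) = x * y + x * z" "x + 0 = x" "x * 0 = 0" "x * 1 = x"
    "x < y \<Longrightarrow> y < z \<Longrightarrow> x < z" "\<not> x < x" "x < y \<or> x = y \<or> y < x" "x < y \<Longrightarrow> x + z < y + z"
    "0 < z \<Longrightarrow> x < y \<Longrightarrow> x * z < y * z" "x < y \<Longrightarrow> \<exists>u. x + u = y" "(0::hn) < 1"
    "0 < x \<Longrightarrow> 1 = x \<or> 1 < x" "0 = x \<or> 0 < x"
proof -
  let ?e = "\<lambda>i::nat. if i = 0 then x else if i = 1 then y else z"
  have "\<forall>\<phi>\<in>discrete_ordered_semiring. satM HM ?e (\<lambda>_. 0) \<phi>"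
    using HM_semiring by blast
  then have *: "((x + y) + z = x + (y + z)) \<and> x + y = y + x \<and> (x * y) * z = x * (y * z) \<and> x * y = y * x \<and>
    x * (y + z) = x * y + x * z \<and> x + 0 = x \<and> x * 0 = 0 \<and> x * 1 = x \<and>
    (x < y \<and> y < z \<longrightarrow> x < z) \<and> \<not> x < x \<and> (x < y \<or> x = y \<or> y < x) \<and> (x < y \<longrightarrow> x + z < y + z) \<and>
    (0 < z \<and> x < y \<longrightarrow> x * z < y * z) \<and> (x < y \<longrightarrow> (\<exists>u. x + u = y)) \<and> (0::hn) < 1 \<and>
    (0 < x \<longrightarrow> 1 = x \<or> 1 < x) \<and> (0 = x \<or> 0 < x)"
    unfolding discrete_ordered_semiring_def Let_def by (simp (no_asm_use), assumption?)
  then show "(x + y) + z = x + (y + z)" "x + y = y + x" "(x * y) * z = x * (y * z)" "x * y = y * x"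
    "x * (y + z) = x * y + x * z" "x + 0 = x" "x * 0 = 0" "x * 1 = x"
    "x < y \<Longrightarrow> y < z \<Longrightarrow> x < z" "\<not> x < x" "x < y \<or> x = y \<or> y < x" "x < y \<Longrightarrow> x + z < y + z"
    "0 < z \<Longrightarrow> x < y \<Longrightarrow> x * z < y * z" "x < y \<Longrightarrow> \<exists>u. x + u = y" "(0::hn) < 1"
    "0 < x \<Longrightarrow> 1 = x \<or> 1 < x" "0 = x \<or> 0 < x"
    by (blast | iprover | meson)+
qed

lemma hn_minus: "y \<le> x \<Longrightarrow> y + (x - y) = (x :: hn)"
proof -
  assume "y \<le> x"
  then consider "y < x" | "x = y"
    by (auto simp: less_eq_hn_def)
  then show ?thesis
  proof cases
    case 1
    from hn_axioms(14)[OF this] have "y + (SOME z. y + z = x) = x"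
      by (rule someI_ex)
    with 1 show ?thesis by (simp add: minus_hn_def)
  next
    case 2
    then show ?thesis by (simp add: minus_hn_def hn_axioms(10) hn_axioms(6))
  qed
qed

lemma hn_add_less_iff: "x + z < y + z \<longleftrightarrow> x < (y :: hn)"
  using hn_axioms(9-12) by metis

lemma hn_add_cancel: "x + z = y + z \<longleftrightarrow> x = (y :: hn)"
  using hn_axioms(10-12) by metis

lemma hn_le_add: "x \<le> x + (y :: hn)"
  using hn_axioms(2,6,12,17) unfolding less_eq_hn_def by metis

lemma hn_add_diff: "x + y - x = (y :: hn)"
  using hn_minus[OF hn_le_add, of x y] hn_add_cancel hn_axioms(2) by metis

lemma hn_minus_eq_0: "x \<le> y \<Longrightarrow> x - y = (0 :: hn)"
  unfolding minus_hn_def less_eq_hn_def using hn_axioms(9,10) by metis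

instance hn :: discrete_semidom
proof
  fix a b c :: hn
  show "a + b + c = a + (b + c)" "a + b = b + a" "a * b * c = a * (b * c)" "a * b = b * a"
    by (fact hn_axioms)+
  show "0 + a = a" "1 * a = a" "0 * a = 0" "a * 0 = 0"
    using hn_axioms(2,4,6,7,8) by metis+
  show add_diff: "a + b - a = b"
    by (rule hn_add_diff)
  show lin: "a \<le> b \<or> b \<le> a"
    using hn_axioms(11) unfolding less_eq_hn_def by metis
  show "b \<le> a \<Longrightarrow> a - b + b = a"
    using hn_minus hn_axioms(2) by metis
  show "(0::hn) \<noteq> 1"
    using hn_axioms(10,15) by metis
  show "(a + b) * c = a * c + b * c" "a * (b + c) = a * b + a * c"
    using hn_axioms(4,5) by metis+
  show "a - b - c = a - (b + c)"
  proof (cases "b + c \<le> a")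
    case True
    then obtain d where "a = b + c + d"
      using hn_minus by metis
    then show ?thesis
      using hn_add_diff hn_axioms(1) by metis
  next
    case False
    then have F: "a < b + c"
      using hn_axioms(11) unfolding less_eq_hn_def by metis
    show ?thesis
    proof (cases "b \<le> a")
      case True
      then obtain d where d: "a = b + d"
        using hn_minus by metis
      then have "d < c"
        using F hn_add_less_iff hn_axioms(2) by metis
      then have "d - c = 0" "a - (b + c) = 0"
        using F by (auto intro: hn_minus_eq_0 simp: less_eq_hn_def)
      then show ?thesis
        using d hn_add_diff by metis
    next
      case False
      then have "a \<le> b"
        using lin hn_axioms(11) unfolding less_eq_hn_def by metis
      then have "a - b = 0" "a - (b + c) = 0"
        using F by (auto intro: hn_minus_eq_0 simp: less_eq_hn_def)
      moreover have "0 - c = 0"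
        using hn_axioms(17)[of c] by (auto intro: hn_minus_eq_0 simp: less_eq_hn_def)
      ultimately show ?thesis by simp
    qed
  qed
  show le_refl: "a \<le> a"
    by (simp add: less_eq_hn_def)
  show "a < b \<longleftrightarrow> a \<le> b \<and> \<not> b \<le> a"
    using hn_axioms(9,10) unfolding less_eq_hn_def by metis
  show "a \<le> b \<Longrightarrow> b \<le> c \<Longrightarrow> a \<le> c" "a \<le> b \<Longrightarrow> b \<le> a \<Longrightarrow> a = b"
    using hn_axioms(9,10) unfolding less_eq_hn_def by metis+
  show "a \<le> b \<Longrightarrow> c + a \<le> c + b"
    using hn_add_less_iff hn_axioms(2) unfolding less_eq_hn_def by metis
  show "a < b \<Longrightarrow> 0 < c \<Longrightarrow> c * a < c * b"
    using hn_axioms(4,13) by metis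
  show "(0::hn) < 1"
    by (fact hn_axioms)
  show le0: "0 \<le> a"
    using hn_axioms(17) unfolding less_eq_hn_def by metis
  show "0 < a \<Longrightarrow> 1 \<le> a"
    using hn_axioms(16) unfolding less_eq_hn_def by metis
  show "a \<noteq> 0 \<Longrightarrow> b \<noteq> 0 \<Longrightarrow> a * b \<noteq> 0"
    using hn_axioms(4,7,10,13,17) by metis
  show "a * (b - c) = a * b - a * c"
  proof (cases "c \<le> b")
    case True
    then obtain d where "b = c + d"
      using hn_minus by metis
    then show ?thesis
      using hn_add_diff hn_axioms(5) by metis
  next
    case False
    then have "b < c"
      using hn_axioms(11) unfolding less_eq_hn_def by metis
    moreover have "a * b \<le> a * c"
      using \<open>b < c\<close> hn_axioms(4,7,13,17) unfolding less_eq_hn_def by metis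
    ultimately show ?thesis
      using hn_minus_eq_0 hn_axioms(7) unfolding less_eq_hn_def by metis
  qed
qed

lemma HM_arithM: "HM = arithM mem_hn"
  by (simp add: HM_def arithM_def)

text \<open>\<open>\<theta>\<close> displays the predicate as a \<open>\<Sigma>\<^sub>1\<close>
  formula: variable 0 is the witness, variable 1 the induction variable, the rest are parameters. A
  predicate that is already bounded can ignore the witness.\<close>

lemma hn_induct:
  assumes "bounded_fm \<theta>" and P: "\<And>x. P x \<longleftrightarrow> (\<exists>y. satM (arithM mem_hn) (case_nat y (case_nat x e)) (\<lambda>_. 0) \<theta>)"
    and "P 0" "\<And>x. P x \<Longrightarrow> P (x + 1)"
  shows "P x"
proof -
  let ?\<phi> = "ExN \<theta>"
  have P': "P x \<longleftrightarrow> satM HM (case_nat x e) (\<lambda>_. 0) ?\<phi>" for x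
    by (simp add: P HM_arithM)
  have A: "satM HM e (\<lambda>_. 0) (induction_axiom ?\<phi>)"
    using assms(1) by (intro HM_induction) (auto simp: Sigma01_def)
  have B: "satM HM (case_nat x e) (\<lambda>_. 0) (subst (case_nat (Var 0 \<^bold>+ \<^bold>1) (\<lambda>i. Var (Suc i))) id ?\<phi>) \<longleftrightarrow> P (x + 1)" for x
  proof -
    have "(\<lambda>i. evM HM (case_nat x e) (case_nat (Var 0 \<^bold>+ \<^bold>1) (\<lambda>i. Var (Suc i)) i)) = case_nat (x + 1) e"
      by (auto split: nat.splits)
    then show ?thesis
      unfolding satM_subst P' by simp
  qed
  have C: "satM HM e (\<lambda>_. 0) (instN \<^bold>0 ?\<phi>) \<longleftrightarrow> P 0"
    unfolding HM.sat_instN P' by simp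
  have "satM HM e (\<lambda>_. 0) (induction_axiom ?\<phi>) \<longleftrightarrow>
      (P 0 \<and> (\<forall>x. P x \<longrightarrow> P (x + 1)) \<longrightarrow> (\<forall>x. P x))"
    unfolding induction_axiom_def satM.simps(5,6,8) B C by (simp only: P' HM_simps ball_UNIV)
  with A assms(3,4) show ?thesis
    by blast
qed

definition env_of :: "hn list \<Rightarrow> nat \<Rightarrow> hn" where
  "env_of xs i = (if i < length xs then xs ! i else 0)"

lemma env_of_simps [simp]:
  "env_of (x # xs) 0 = x" "env_of (x # xs) (Suc i) = env_of xs i"
  by (simp_all add: env_of_def)

text \<open>Takes the place of a factorial without defining one: multiplication by
  \<open>m + 1\<close> extends a common multiple. This provides the divisibility hypothesis of
  \<open>elt_mult\<close>.\<close>

lemma ex_common_multiple: "\<exists>d::hn. 0 < d \<and> (\<forall>k<m + 1. 0 < k \<longrightarrow> k dvd d)"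
proof (rule hn_induct[where P = "\<lambda>m. \<exists>d::hn. 0 < d \<and> (\<forall>k<m + 1. 0 < k \<longrightarrow> k dvd d)" and e = "env_of []" and \<theta> = "\<^bold>0 \<^bold>< Var 0 \<^bold>\<and>
    BAll (Var 1 \<^bold>+ \<^bold>1) (\<^bold>0 \<^bold>< Var 0 \<^bold>\<longrightarrow> BEx (Var 1 \<^bold>+ \<^bold>1) (Var 1 \<^bold>* Var 0 \<^bold>= Var 2))"])
  show "(\<exists>d::hn. 0 < d \<and> (\<forall>k<m + 1. 0 < k \<longrightarrow> k dvd d)) \<longleftrightarrow> (\<exists>d. satM (arithM mem_hn) (case_nat d (case_nat m (env_of []))) (\<lambda>_. 0)
    (\<^bold>0 \<^bold>< Var 0 \<^bold>\<and> BAll (Var 1 \<^bold>+ \<^bold>1) (\<^bold>0 \<^bold>< Var 0 \<^bold>\<longrightarrow> BEx (Var 1 \<^bold>+ \<^bold>1) (Var 1 \<^bold>* Var 0 \<^bold>= Var 2))))" for m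
    unfolding satM.simps sat_BAll sat_BEx by (simp add: dvd_bounded eval_nat_numeral)
  show "\<exists>d::hn. 0 < d \<and> (\<forall>k<0 + 1. 0 < k \<longrightarrow> k dvd d)"
    by (intro exI[of _ 1]) (auto dest!: one_le)
  fix m :: hn
  assume "\<exists>d. 0 < d \<and> (\<forall>k<m + 1. 0 < k \<longrightarrow> k dvd d)"
  then obtain d where d: "0 < d" "\<And>k. k < m + 1 \<Longrightarrow> 0 < k \<Longrightarrow> k dvd d" by blast
  have "0 < m + 1"
    by (simp add: less_plus_one_iff zero_least)
  have "k dvd d * (m + 1)" if "k < m + 1 + 1" "0 < k" for k
  proof (cases "k = m + 1")
    case False
    moreover have "k \<le> m + 1"
      using that(1) by (simp only: less_plus_one_iff)
    ultimately have "k < m + 1"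
      by (simp add: less_le)
    then show ?thesis
      using d(2) that(2) by (intro dvd_mult2)
  qed simp
  with d(1) \<open>0 < m + 1\<close> show "\<exists>d. 0 < d \<and> (\<forall>k<m + 1 + 1. 0 < k \<longrightarrow> k dvd d)"
    by (intro exI[of _ "d * (m + 1)"]) simp
qed (simp del: subst_tm.simps)

text \<open>A larger range needs a new \<open>d\<close>, so the old code cannot just be multiplied
  by one more factor. The set is coded afresh, running through all \<open>b < M\<close> and
  multiplying by the modulus of each member; from the old code only pairs below \<open>m\<close> are
  taken over.\<close>

lemma code_insert:
  fixes c\<^sub>0 d\<^sub>0 m a M :: hn
  shows "\<exists>c d. \<forall>b<M. elt b c d \<longleftrightarrow> (\<exists>i<m. \<exists>v<m. b = pr i v \<and> elt b c\<^sub>0 d\<^sub>0) \<or> b = a"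
proof -
  obtain d where d: "0 < d" "\<And>k. 0 < k \<Longrightarrow> k < M + 1 \<Longrightarrow> k dvd d"
    using ex_common_multiple[of M] by blast
  define R where "R b \<longleftrightarrow> (\<exists>i<m. \<exists>v<m. b = pr i v \<and> elt b c\<^sub>0 d\<^sub>0) \<or> b = a" for b
  \<comment> \<open>Only the code \<open>c\<close> is quantified without a bound, which keeps
    \<open>P\<close> within the reach of \<open>\<Sigma>\<^sub>1\<close> induction.\<close>
  define P where "P j \<longleftrightarrow> (\<exists>c. \<forall>b<M. (elt b c d \<longrightarrow> b < j \<and> R b) \<and> (b < j \<and> R b \<longrightarrow> elt b c d))" for j
  let ?R = "BEx (Var 5) (BEx (Var 6) (Var 2 \<^bold>= pair_tm (Var 1) (Var 0) \<^bold>\<and> elt_fm (Var 2) (Var 5) (Var 6))) \<^bold>\<or> Var 0 \<^bold>= Var 6"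
  let ?\<theta> = "BAll (Var 6) ((elt_fm (Var 0) (Var 1) (Var 8) \<^bold>\<longrightarrow> Var 0 \<^bold>< Var 2 \<^bold>\<and> ?R) \<^bold>\<and>
    (Var 0 \<^bold>< Var 2 \<^bold>\<and> ?R \<^bold>\<longrightarrow> elt_fm (Var 0) (Var 1) (Var 8)))"
  have "P M"
  proof (rule hn_induct[where P = P and e = "env_of [c\<^sub>0, d\<^sub>0, m, a, M, d]" and \<theta> = ?\<theta>])
    show "P j \<longleftrightarrow> (\<exists>c. satM (arithM mem_hn) (case_nat c (case_nat j (env_of [c\<^sub>0, d\<^sub>0, m, a, M, d]))) (\<lambda>_. 0) ?\<theta>)" for j
      unfolding satM.simps sat_BAll sat_BEx sat_elt_fm P_def R_def by (simp add: eval_nat_numeral)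
    have "\<not> elt b 1 d" for b
      using d(1) by (rule not_elt_1)
    then show "P 0"
      unfolding P_def by (intro exI[of _ 1]) simp
    fix j assume "P j"
    then obtain c where c: "\<And>b. b < M \<Longrightarrow> elt b c d \<longleftrightarrow> b < j \<and> R b"
      unfolding P_def by blast
    show "P (j + 1)"
    proof (cases "R j \<and> j < M")
      case True
      have "elt b (c * (1 + (j + 1) * d)) d \<longleftrightarrow> b < j + 1 \<and> R b" if "b < M" for b
      proof (cases "b = j")
        case True
        then show ?thesis
          using \<open>R j \<and> j < M\<close> by (simp add: elt_def)
      next
        case False
        have "elt b (c * (1 + (j + 1) * d)) d \<longleftrightarrow> elt b c d"
          by (rule elt_mult[of M]) (use d(2) True that False in \<open>auto simp: less_plus_one_iff\<close>)
        also have "\<dots> \<longleftrightarrow> b < j + 1 \<and> R b"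
          using c[OF that] False by (auto simp: less_plus_one_iff)
        finally show ?thesis .
      qed
      then show ?thesis
        unfolding P_def by blast
    next
      case False
      then have "elt b c d \<longleftrightarrow> b < j + 1 \<and> R b" if "b < M" for b
        using c[OF that] that by (auto simp: less_plus_one_iff le_less)
      then show ?thesis
        unfolding P_def by blast
    qed
  qed (simp del: subst_tm.simps)
  then show ?thesis
    unfolding P_def R_def by blast
qed

text \<open>The induction on the level \<open>n\<close> is external, while the one on the number
  \<open>l\<close> of iterates is \<open>\<Sigma>\<^sub>1\<close> induction in the model. The
  external hypothesis supplies the next value, and \<open>code_insert\<close> adds it to the
  list.\<close>

lemma thr_total: "\<exists>y. thr n x x (y :: hn)"
proof (induction n arbitrary: x)
  case 0
  show ?case
    by (intro exI[of _ "x + 1"]) simp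
next
  case (Suc n)
  let ?just = "\<lambda>c d m. \<forall>i<m. \<forall>v<m. elt (pr i v) c d \<longrightarrow> (i = 0 \<and> v = x + 1) \<or>
      (\<exists>j<i. i = j + 1 \<and> (\<exists>u<m. elt (pr j u) c d \<and> thr n u u v))"
  have "\<exists>y. thr (Suc n) x l y" for l
  proof (rule hn_induct[where P = "\<lambda>l. \<exists>y. thr (Suc n) x l y" and e = "env_of [x]" and \<theta> = "thr_fm (Suc n) (Var 2) (Var 1) (Var 0)"])
    show "(\<exists>y. thr (Suc n) x l y) \<longleftrightarrow>
      (\<exists>y. satM (arithM mem_hn) (case_nat y (case_nat l (env_of [x]))) (\<lambda>_. 0) (thr_fm (Suc n) (Var 2) (Var 1) (Var 0)))" for l
      unfolding sat_thr_fm by (simp add: eval_nat_numeral)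
    \<comment> \<open>One extension step serves both the start and the successor case: a justified
      pair of \<open>l'\<close> and \<open>v'\<close> joins the code. The new bound
      \<open>m'\<close> exceeds the old one and both components.\<close>
    have step: "\<exists>y. thr (Suc n) x l' y" if just: "?just c\<^sub>0 d\<^sub>0 m" and v': "(l' = 0 \<and> v' = x + 1) \<or>
      (\<exists>l u. l < m \<and> u < m \<and> l' = l + 1 \<and> elt (pr l u) c\<^sub>0 d\<^sub>0 \<and> thr n u u v')" for l' v' c\<^sub>0 d\<^sub>0 m
    proof -
      define m' where "m' = m + l' + v' + 1"
      have m': "m < m'" "l' < m'" "v' < m'"
        unfolding m'_def less_plus_one_iff by (rule le_sum3)+
      obtain c d where cd: "\<And>b. b < pr m' m' \<Longrightarrow> elt b c d \<longleftrightarrow>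
          (\<exists>i<m. \<exists>v<m. b = pr i v \<and> elt b c\<^sub>0 d\<^sub>0) \<or> b = pr l' v'"
        using code_insert[of "pr m' m'" m c\<^sub>0 d\<^sub>0 "pr l' v'"] by blast
      have S: "elt (pr i v) c d \<longleftrightarrow> (i < m \<and> v < m \<and> elt (pr i v) c\<^sub>0 d\<^sub>0) \<or> (i = l' \<and> v = v')"
        if "i < m'" "v < m'" for i v
      proof -
        have "pr i v < pr m' m'"
          using that by (intro pr_less add_strict_mono)
        then show ?thesis
          unfolding cd[OF \<open>pr i v < pr m' m'\<close>] pr_eq_iff by blast
      qed
      have less: "i < m'" if "i < m" for i
        using that m'(1) by (rule less_trans)
      have "?just c d m'"
      proof (intro allI impI)
        fix i v assume iv: "i < m'" "v < m'" "elt (pr i v) c d"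
        then consider "i < m" "v < m" "elt (pr i v) c\<^sub>0 d\<^sub>0" | "i = l'" "v = v'"
          using S by blast
        then show "(i = 0 \<and> v = x + 1) \<or> (\<exists>j<i. i = j + 1 \<and> (\<exists>u<m'. elt (pr j u) c d \<and> thr n u u v))"
        proof cases
          case 1
          show ?thesis
          proof (rule disjE[OF just[rule_format, OF 1]])
            assume "\<exists>j<i. i = j + 1 \<and> (\<exists>u<m. elt (pr j u) c\<^sub>0 d\<^sub>0 \<and> thr n u u v)"
            then obtain j u where ju: "j < i" "i = j + 1" "u < m" "elt (pr j u) c\<^sub>0 d\<^sub>0" "thr n u u v"
              by blast
            have "j < m"
              using ju(1) 1(1) by (rule less_trans)
            then have "elt (pr j u) c d"
              using S[OF less[OF \<open>j < m\<close>] less[OF ju(3)]] \<open>j < m\<close> ju(3,4) by simp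
            with ju less[OF ju(3)] show ?thesis
              by (intro disjI2 exI[of _ j] conjI exI[of _ u])
          qed simp
        next
          case 2
          from v' show ?thesis
          proof
            assume "\<exists>l u. l < m \<and> u < m \<and> l' = l + 1 \<and> elt (pr l u) c\<^sub>0 d\<^sub>0 \<and> thr n u u v'"
            then obtain l u where lu: "l < m" "u < m" "l' = l + 1" "elt (pr l u) c\<^sub>0 d\<^sub>0" "thr n u u v'"
              by (elim exE conjE)
            then have "elt (pr l u) c d"
              using S[OF less[OF lu(1)] less[OF lu(2)]] by simp
            moreover have "l < l'"
              by (simp add: lu(3))
            ultimately show ?thesis
              using 2 lu less[OF lu(2)] by (intro disjI2 exI[of _ l] conjI exI[of _ u]) auto
          qed (use 2 in simp)
        qed
      qed
      moreover have "elt (pr l' v') c d"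
        using S[OF m'(2,3)] by simp
      moreover have "c < c + d + m' + 1" "d < c + d + m' + 1" "m' < c + d + m' + 1"
        unfolding less_plus_one_iff by (rule le_sum3)+
      ultimately show ?thesis
        unfolding thr.simps using m'(2,3)
        by (intro exI[of _ "c + d + m' + 1"] exI[of _ c] exI[of _ d] exI[of _ m'] conjI exI[of _ v'])
    qed
    \<comment> \<open>With the bound 0 no pair is listed, whatever the code.\<close>
    have "?just 1 1 0"
      by simp
    then show "\<exists>y. thr (Suc n) x 0 y"
      by (rule step[OF _ disjI1[OF conjI[OF refl refl]]])
    fix l assume "\<exists>y. thr (Suc n) x l y"
    then obtain c\<^sub>0 d\<^sub>0 m u where *: "l < m" "u < m" "elt (pr l u) c\<^sub>0 d\<^sub>0" "?just c\<^sub>0 d\<^sub>0 m"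
      unfolding thr.simps by blast
    obtain v' where "thr n u u v'"
      using Suc.IH by blast
    with * show "\<exists>y. thr (Suc n) x (l + 1) y"
      by (intro step[OF *(4), of "l + 1" v'] disjI2 exI[of _ l] exI[of _ u] conjI refl)
  qed (simp del: thr_fm.simps)
  then show ?case by blast
qed

text \<open>The least number principle for a bounded formula: without a least \<open>y\<close>,
  induction would show that \<open>thr\<close> fails everywhere, against
  \<open>thr_total\<close>.\<close>

lemma ex_least_thr: "\<exists>y. thr n x x (y :: hn) \<and> (\<forall>z<y. \<not> thr n x x z)"
proof (rule ccontr)
  assume neg: "\<not> ?thesis"
  have "\<forall>z<y. \<not> thr n x x z" for y
  proof (rule hn_induct[where P = "\<lambda>y. \<forall>z<y. \<not> thr n x x z" and e = "env_of [x]" and \<theta> = "BAll (Var 1) (\<^bold>\<not> (thr_fm n (Var 3) (Var 3) (Var 0)))"])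
    show "(\<forall>z<y. \<not> thr n x x z) \<longleftrightarrow> (\<exists>w. satM (arithM mem_hn) (case_nat w (case_nat y (env_of [x]))) (\<lambda>_. 0)
      (BAll (Var 1) (\<^bold>\<not> (thr_fm n (Var 3) (Var 3) (Var 0)))))" for y
      unfolding sat_BAll satM.simps sat_thr_fm by (simp add: eval_nat_numeral)
    show "\<forall>z<0. \<not> thr n x x z"
      by simp
    fix y assume "\<forall>z<y. \<not> thr n x x z"
    with neg show "\<forall>z<y + 1. \<not> thr n x x z"
      unfolding less_plus_one_iff le_less by blast
  qed (simp del: subst_tm.simps)
  then show False
    using thr_total[of n x] by (metis less_add_one)
qed

lemma sat_total_fm:
  fixes e :: "nat \<Rightarrow> 'a::discrete_semidom"
  shows "satM (arithM mem) e v (total_fm n) \<longleftrightarrow> (\<forall>x::'a. \<exists>!y. thr n x x y \<and> (\<forall>z<y. \<not> thr n x x z))"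
proof -
  have "(\<lambda>i. evM (arithM mem) (case_nat y' (case_nat y (case_nat x e))) (case_nat (Var 0) (\<lambda>i. Var (Suc (Suc i))) i)) =
    case_nat y' (case_nat x e)" for y' y x
    by (auto split: nat.splits)
  then show ?thesis
    by (simp add: total_fm_def Ex1N_def satM_subst sat_graph_fm Ex1_def)
qed

theorem RCA0_total: "RCA0 \<turnstile> total_fm n"
proof (rule ccontr)
  assume "\<not> ?thesis"
  then have "\<not> (\<forall>n. RCA0 \<turnstile> total_fm n)"
    by blast
  with H(2) have "(\<^bold>\<not> (total_fm (SOME n. \<not> (RCA0 \<turnstile> total_fm n)))) \<in> H"
    unfolding countermodel_theory_def by (simp only: if_False insert_subset)
  then obtain k where "total_fm k \<notin> H"
    by (auto simp: H.neg)
  then have "\<not> satM HM (\<lambda>_. 0) (\<lambda>_. 0) (total_fm k)"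
    by (simp add: truth_closed below_total_fm)
  moreover have "\<exists>!y. thr k x x y \<and> (\<forall>z<y. \<not> thr k x x (z :: hn))" for x
    using ex_least_thr[of k x] by (metis linorder_neqE)
  then have "satM HM (\<lambda>_. 0) (\<lambda>_. 0) (total_fm k)"
    unfolding HM_arithM sat_total_fm by (rule allI)
  ultimately show False
    by simp
qed

section \<open>Bounded formulas and recursive functions\<close>

text \<open>\<open>recursive_on\<close> speaks about a function on lists of every length. Only the
  values on lists of length \<open>k\<close> matter here, so functions may be replaced by others
  that agree there.\<close>

definition rec_fun :: "nat \<Rightarrow> (nat list \<Rightarrow> nat) \<Rightarrow> bool" where
  "rec_fun k f \<longleftrightarrow> (\<exists>F. recursive_on k F \<and> (\<forall>xs. length xs = k \<longrightarrow> F xs = f xs))"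

lemma rec_fun_cong: "rec_fun k f \<Longrightarrow> (\<And>xs. length xs = k \<Longrightarrow> f xs = g xs) \<Longrightarrow> rec_fun k g"
  unfolding rec_fun_def by metis

lemma rec_fun_zero: "rec_fun k (\<lambda>xs. 0)"
  unfolding rec_fun_def using recursive_on.intros(1) by blast

lemma rec_fun_proj: "i < k \<Longrightarrow> rec_fun k (\<lambda>xs. xs ! i)"
  unfolding rec_fun_def using recursive_on.intros(3) by blast

lemma rec_fun_comp:
  assumes "rec_fun (length gs) f" "\<And>g. g \<in> set gs \<Longrightarrow> rec_fun k g"
  shows "rec_fun k (\<lambda>xs. f (map (\<lambda>g. g xs) gs))"
proof -
  obtain F where F: "recursive_on (length gs) F" "\<And>xs. length xs = length gs \<Longrightarrow> F xs = f xs"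
    using assms(1) unfolding rec_fun_def by blast
  have "\<forall>g\<in>set gs. \<exists>G. recursive_on k G \<and> (\<forall>xs. length xs = k \<longrightarrow> G xs = g xs)"
    using assms(2) unfolding rec_fun_def by blast
  then obtain G where G: "\<And>g. g \<in> set gs \<Longrightarrow> recursive_on k (G g)"
    "\<And>g xs. g \<in> set gs \<Longrightarrow> length xs = k \<Longrightarrow> G g xs = g xs"
    by metis
  have "recursive_on k (\<lambda>xs. F (map (\<lambda>G. G xs) (map G gs)))"
    by (rule recursive_on.intros(4)) (use F(1) G(1) in auto)
  moreover have "F (map (\<lambda>G. G xs) (map G gs)) = f (map (\<lambda>g. g xs) gs)" if "length xs = k" for xs
  proof -
    have eq: "map (\<lambda>G. G xs) (map G gs) = map (\<lambda>g. g xs) gs"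
      using G(2) that by simp
    show ?thesis
      unfolding eq by (rule F(2)) simp
  qed
  ultimately show ?thesis
    unfolding rec_fun_def by blast
qed

lemma rec_fun_comp1: "rec_fun 1 (\<lambda>xs. h (xs ! 0)) \<Longrightarrow> rec_fun k f \<Longrightarrow> rec_fun k (\<lambda>xs. h (f xs))"
  using rec_fun_comp[of "[f]" "\<lambda>xs. h (xs ! 0)" k] by simp

lemma rec_fun_comp2:
  "rec_fun 2 (\<lambda>xs. h (xs ! 0) (xs ! 1)) \<Longrightarrow> rec_fun k f \<Longrightarrow> rec_fun k g \<Longrightarrow> rec_fun k (\<lambda>xs. h (f xs) (g xs))"
  using rec_fun_comp[of "[f, g]" "\<lambda>xs. h (xs ! 0) (xs ! 1)" k] by (auto simp: numeral_2_eq_2)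

lemma rec_fun_rec:
  assumes "rec_fun k f" "rec_fun (Suc (Suc k)) g"
  shows "rec_fun (Suc k) (\<lambda>xs. rec_nat (f (tl xs)) (\<lambda>n r. g (n # r # tl xs)) (hd xs))"
proof -
  obtain F G where F: "recursive_on k F" "\<And>xs. length xs = k \<Longrightarrow> F xs = f xs"
    and G: "recursive_on (Suc (Suc k)) G" "\<And>xs. length xs = Suc (Suc k) \<Longrightarrow> G xs = g xs"
    using assms unfolding rec_fun_def by blast
  have "rec_nat (F (tl xs)) (\<lambda>n r. G (n # r # tl xs)) m = rec_nat (f (tl xs)) (\<lambda>n r. g (n # r # tl xs)) m"
    if "length xs = Suc k" for xs m
    using that by (induction m) (simp_all add: F(2) G(2))
  with recursive_on.intros(5)[OF F(1) G(1)] show ?thesis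
    unfolding rec_fun_def by blast
qed

lemma rec_fun_Suc: "rec_fun k f \<Longrightarrow> rec_fun k (\<lambda>xs. Suc (f xs))"
proof (rule rec_fun_comp1[where h = Suc])
  show "rec_fun 1 (\<lambda>xs. Suc (xs ! 0))"
    unfolding rec_fun_def using recursive_on.intros(2) by blast
qed

lemma list_length_1: "length xs = Suc 0 \<Longrightarrow> xs = [xs ! 0]"
  by (cases xs) auto

lemma list_length_2: "length xs = Suc (Suc 0) \<Longrightarrow> xs = [xs ! 0, xs ! 1]"
  by (cases xs; cases "tl xs") auto

lemma rec_fun_rec1:
  assumes "rec_fun 2 (\<lambda>xs. h (xs ! 0) (xs ! 1))"
  shows "rec_fun 1 (\<lambda>xs. rec_nat 0 h (xs ! 0))"
proof -
  have "rec_fun (Suc 0) (\<lambda>xs. rec_nat 0 (\<lambda>n r. h ((n # r # tl xs) ! 0) ((n # r # tl xs) ! 1)) (hd xs))"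
    using assms by (intro rec_fun_rec rec_fun_zero) (simp add: numeral_2_eq_2)
  then show ?thesis
    unfolding One_nat_def by (rule rec_fun_cong) (auto simp: length_Suc_conv)
qed

lemma rec_fun_rec2:
  assumes "rec_fun 1 (\<lambda>xs. f (xs ! 0))" "rec_fun 3 (\<lambda>xs. h (xs ! 2) (xs ! 0) (xs ! 1))"
  shows "rec_fun 2 (\<lambda>xs. rec_nat (f (xs ! 1)) (h (xs ! 1)) (xs ! 0))"
proof -
  have "rec_fun (Suc 1) (\<lambda>xs. rec_nat (f (tl xs ! 0)) (\<lambda>n r. h ((n # r # tl xs) ! 2) ((n # r # tl xs) ! 0) ((n # r # tl xs) ! 1)) (hd xs))"
    by (rule rec_fun_rec[OF assms(1)]) (use assms(2) in \<open>simp add: numeral_3_eq_3\<close>)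
  then have "rec_fun 2 (\<lambda>xs. rec_nat (f (tl xs ! 0)) (\<lambda>n r. h ((n # r # tl xs) ! 2) ((n # r # tl xs) ! 0) ((n # r # tl xs) ! 1)) (hd xs))"
    by (simp add: numeral_2_eq_2)
  then show ?thesis
  proof (rule rec_fun_cong)
    fix xs :: "nat list" assume "length xs = 2"
    then obtain a b where "xs = [a, b]"
      using list_length_2[of xs] by (auto simp: numeral_2_eq_2)
    then show "rec_nat (f (tl xs ! 0)) (\<lambda>n r. h ((n # r # tl xs) ! 2) ((n # r # tl xs) ! 0) ((n # r # tl xs) ! 1)) (hd xs) =
      rec_nat (f (xs ! 1)) (h (xs ! 1)) (xs ! 0)"
      by (simp add: numeral_2_eq_2)
  qed
qed

lemma rec_fun_add: "rec_fun k f \<Longrightarrow> rec_fun k g \<Longrightarrow> rec_fun k (\<lambda>xs. f xs + g xs)"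
proof (rule rec_fun_comp2[where h = "(+)"])
  have "rec_nat y (\<lambda>n r. Suc r) x = x + y" for x y :: nat
    by (induction x) auto
  then show "rec_fun 2 (\<lambda>xs. xs ! 0 + xs ! 1)"
    using rec_fun_rec2[of "\<lambda>y. y" "\<lambda>y n r. Suc r"] by (simp add: rec_fun_proj rec_fun_Suc)
qed

lemma rec_fun_mult: "rec_fun k f \<Longrightarrow> rec_fun k g \<Longrightarrow> rec_fun k (\<lambda>xs. f xs * g xs)"
proof (rule rec_fun_comp2[where h = "(*)"])
  have "rec_nat 0 (\<lambda>n r. r + y) x = x * y" for x y :: nat
    by (induction x) auto
  then show "rec_fun 2 (\<lambda>xs. xs ! 0 * xs ! 1)"
    using rec_fun_rec2[of "\<lambda>y. 0" "\<lambda>y n r. r + y"] by (simp add: rec_fun_proj rec_fun_zero rec_fun_add)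
qed

lemma rec_fun_pred: "rec_fun k f \<Longrightarrow> rec_fun k (\<lambda>xs. f xs - 1)"
proof (rule rec_fun_comp1[where h = "\<lambda>x. x - 1"])
  have "rec_nat 0 (\<lambda>n r. n) x = x - 1" for x :: nat
    by (cases x) auto
  then show "rec_fun 1 (\<lambda>xs. xs ! 0 - 1)"
    using rec_fun_rec1[of "\<lambda>n r. n"] by (simp add: rec_fun_proj)
qed

lemma rec_fun_diff: "rec_fun k f \<Longrightarrow> rec_fun k g \<Longrightarrow> rec_fun k (\<lambda>xs. f xs - g xs)"
\<comment> \<open>Primitive recursion runs on the first argument, which has to be the subtrahend;
  hence the exchange of \<open>f\<close> and \<open>g\<close>.\<close>
proof (rule rec_fun_comp2[where h = "\<lambda>x y. y - x" and f = g and g = f])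
  have "rec_nat y (\<lambda>n r. r - 1) x = y - x" for x y :: nat
    by (induction x) auto
  then show "rec_fun 2 (\<lambda>xs. xs ! 1 - xs ! 0)"
    using rec_fun_rec2[of "\<lambda>y. y" "\<lambda>y n r. r - 1"] rec_fun_pred[of 3 "\<lambda>xs. xs ! 1"] by (simp add: rec_fun_proj)
qed

text \<open>Truth is the value 0, in accordance with the minimization scheme, which searches for a
  zero.\<close>

definition rec_pred :: "nat \<Rightarrow> (nat list \<Rightarrow> bool) \<Rightarrow> bool" where
  "rec_pred k P \<longleftrightarrow> rec_fun k (\<lambda>xs. if P xs then 0 else 1)"

lemma rec_pred_zero: "rec_fun k f \<Longrightarrow> rec_pred k (\<lambda>xs. f xs = 0)"
proof -
  assume f: "rec_fun k f"
  have "rec_fun k (\<lambda>xs. Suc 0 - (Suc 0 - f xs))"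
    by (intro rec_fun_diff rec_fun_Suc rec_fun_zero f)
  then show ?thesis
    unfolding rec_pred_def by (rule rec_fun_cong) auto
qed

lemma rec_pred_cong: "rec_pred k P \<Longrightarrow> (\<And>xs. length xs = k \<Longrightarrow> P xs \<longleftrightarrow> Q xs) \<Longrightarrow> rec_pred k Q"
  unfolding rec_pred_def by (erule rec_fun_cong) simp

lemma rec_pred_imp: "rec_pred k P \<Longrightarrow> rec_pred k Q \<Longrightarrow> rec_pred k (\<lambda>xs. P xs \<longrightarrow> Q xs)"
proof -
  assume PQ: "rec_pred k P" "rec_pred k Q"
  have "rec_pred k (\<lambda>xs. (Suc 0 - (if P xs then 0 else 1)) * (if Q xs then 0 else 1) = 0)"
    using PQ unfolding rec_pred_def[of k P] rec_pred_def[of k Q]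
    by (intro rec_pred_zero rec_fun_mult rec_fun_diff rec_fun_Suc rec_fun_zero)
  then show ?thesis
    by (rule rec_pred_cong) auto
qed

lemma rec_pred_False: "rec_pred k (\<lambda>xs. False)"
  unfolding rec_pred_def by (simp add: rec_fun_Suc rec_fun_zero)

lemma rec_pred_not: "rec_pred k P \<Longrightarrow> rec_pred k (\<lambda>xs. \<not> P xs)"
  using rec_pred_imp[OF _ rec_pred_False] by simp

lemma rec_pred_all:
  assumes "rec_pred (Suc k) P" "rec_fun k f"
  shows "rec_pred k (\<lambda>xs. \<forall>y<f xs. P (y # xs))"
proof -
  let ?p = "\<lambda>xs. if P xs then 0 else 1 :: nat"
  \<comment> \<open>\<open>S\<close> counts the failures below the bound, so it vanishes exactly if
    there are none.\<close>
  define S where "S xs = rec_nat 0 (\<lambda>n r. r + ?p (n # tl xs)) (hd xs)" for xs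
  have S: "S (m # xs) = 0 \<longleftrightarrow> (\<forall>y<m. P (y # xs))" for m xs
    unfolding S_def by (induction m) (auto simp: less_Suc_eq)
  \<comment> \<open>The step function of a recursion receives the accumulator at position 1; this
    list of projections removes it.\<close>
  let ?gs = "(\<lambda>xs :: nat list. xs ! 0) # map (\<lambda>i xs. xs ! Suc (Suc i)) [0..<k]"
  have "rec_fun (Suc (Suc k)) (\<lambda>xs. ?p (map (\<lambda>g. g xs) ?gs))"
  proof (rule rec_fun_comp)
    have "length ?gs = Suc k"
      by simp
    then show "rec_fun (length ?gs) ?p"
      using assms(1) by (simp only: rec_pred_def)
  qed (auto intro: rec_fun_proj)
  then have "rec_fun (Suc (Suc k)) (\<lambda>xs. xs ! 1 + ?p (map (\<lambda>g. g xs) ?gs))"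
    by (intro rec_fun_add rec_fun_proj) auto
  from rec_fun_rec[OF rec_fun_zero this]
  have "rec_fun (Suc k) S"
  proof (rule rec_fun_cong)
    fix xs :: "nat list" assume xs: "length xs = Suc k"
    have "map (\<lambda>g. g (n # r # tl xs)) ?gs = n # tl xs" for n r
      using xs map_nth[of "tl xs"] by (simp add: o_def)
    then show "rec_nat 0 (\<lambda>n r. (n # r # tl xs) ! 1 + ?p (map (\<lambda>g. g (n # r # tl xs)) ?gs)) (hd xs) = S xs"
      by (simp add: S_def)
  qed
  then have "rec_fun k (\<lambda>xs. S (map (\<lambda>g. g xs) (f # map (\<lambda>i xs. xs ! i) [0..<k])))"
    by (intro rec_fun_comp) (use assms(2) in \<open>auto intro: rec_fun_proj\<close>)
  then have "rec_fun k (\<lambda>xs. S (f xs # xs))"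
    by (rule rec_fun_cong) (auto simp: o_def map_nth)
  from rec_pred_zero[OF this] show ?thesis
    by (simp add: S)
qed

definition list_env :: "nat list \<Rightarrow> nat \<Rightarrow> nat" where
  "list_env xs i = (if i < length xs then xs ! i else 0)"

lemma list_env_Cons: "list_env (y # xs) = case_nat y (list_env xs)"
  by (auto simp: list_env_def split: nat.splits)

lemma rec_fun_eval: "below_tm k t \<Longrightarrow> rec_fun k (\<lambda>xs. eval (list_env xs) t)"
proof (induction t)
  case (Var i)
  then have "rec_fun k (\<lambda>xs. xs ! i)"
    by (simp add: rec_fun_proj)
  then show ?case
    by (rule rec_fun_cong) (use Var in \<open>simp add: list_env_def\<close>)
qed (simp_all add: rec_fun_zero rec_fun_Suc rec_fun_add rec_fun_mult)

lemma below_lift_tm_iff: "below_tm (Suc k) (lift_tm t) \<longleftrightarrow> below_tm k t"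
  by (induction t) auto

lemma rec_pred_sat: "bounded_fm \<phi> \<Longrightarrow> below k 0 \<phi> \<Longrightarrow> rec_pred k (\<lambda>xs. sat (list_env xs) v \<phi>)"
proof (induction arbitrary: k rule: bounded_fm.induct)
  case (2 s t)
  then have "rec_pred k (\<lambda>xs. (eval (list_env xs) s - eval (list_env xs) t) + (eval (list_env xs) t - eval (list_env xs) s) = 0)"
    by (intro rec_pred_zero rec_fun_add rec_fun_diff rec_fun_eval) auto
  then show ?case
    by (rule rec_pred_cong) auto
next
  case (3 s t)
  then have "rec_pred k (\<lambda>xs. Suc (eval (list_env xs) s) - eval (list_env xs) t = 0)"
    by (intro rec_pred_zero rec_fun_diff rec_fun_eval rec_fun_Suc) auto
  then show ?case
    by (rule rec_pred_cong) auto
next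
  case (5 \<phi> \<psi>)
  then show ?case
    by (simp add: rec_pred_imp)
next
  case (6 \<phi> \<psi>)
  then have "rec_pred k (\<lambda>xs. \<not> (sat (list_env xs) v \<phi> \<longrightarrow> \<not> sat (list_env xs) v \<psi>))"
    by (intro rec_pred_not rec_pred_imp) auto
  then show ?case
    by (rule rec_pred_cong) auto
next
  case (7 \<phi> \<psi>)
  then have "rec_pred k (\<lambda>xs. \<not> sat (list_env xs) v \<phi> \<longrightarrow> sat (list_env xs) v \<psi>)"
    by (intro rec_pred_not rec_pred_imp) auto
  then show ?case
    by (rule rec_pred_cong) auto
next
  case (8 \<phi> t)
  have t: "below_tm k t"
    using "8.prems" below_lift_tm_iff by auto
  have "rec_pred k (\<lambda>xs. \<forall>y<eval (list_env xs) t. sat (list_env (y # xs)) v \<phi>)"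
    using "8.prems" by (intro rec_pred_all "8.IH" rec_fun_eval t) auto
  then show ?case
    by (rule rec_pred_cong) (simp add: list_env_Cons eval_subst)
next
  case (9 \<phi> t)
  have t: "below_tm k t"
    using "9.prems" below_lift_tm_iff by auto
  have "rec_pred k (\<lambda>xs. \<not> (\<forall>y<eval (list_env xs) t. \<not> sat (list_env (y # xs)) v \<phi>))"
    using "9.prems" by (intro rec_pred_not rec_pred_all[where P = "\<lambda>xs. \<not> sat (list_env xs) v \<phi>"] "9.IH" rec_fun_eval t) auto
  then show ?case
    by (rule rec_pred_cong) (simp add: list_env_Cons eval_subst)
qed (simp_all add: rec_pred_False)

lemma recursive_least:
  assumes "bounded_fm \<phi>" "below 2 0 \<phi>" "\<And>x. \<exists>y. sat (list_env [y, x]) v \<phi>"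
  shows "recursive (\<lambda>x. LEAST y. sat (list_env [y, x]) v \<phi>)"
proof -
  obtain F where F: "recursive_on 2 F" "\<And>xs. length xs = 2 \<Longrightarrow> F xs = (if sat (list_env xs) v \<phi> then 0 else 1)"
    using rec_pred_sat[OF assms(1,2)] unfolding rec_pred_def rec_fun_def by blast
  have zero: "F [y, x] = 0 \<longleftrightarrow> sat (list_env [y, x]) v \<phi>" for x y
    using F(2)[of "[y, x]"] by simp
  have "recursive_on 1 (\<lambda>xs. LEAST n. F (n # xs) = 0)"
  proof (rule recursive_on.intros(6))
    show "recursive_on (Suc 1) F"
      using F(1) by (simp add: numeral_2_eq_2)
    show "\<forall>xs. length xs = 1 \<longrightarrow> (\<exists>n. F (n # xs) = 0)"
    proof (intro allI impI)
      fix xs :: "nat list" assume "length xs = 1"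
      then obtain x where "xs = [x]"
        using list_length_1[of xs] by auto
      then show "\<exists>n. F (n # xs) = 0"
        using assms(3)[of x] by (simp add: zero)
    qed
  qed
  then show ?thesis
    unfolding recursive_def by (intro exI conjI) (auto simp: zero)
qed

section \<open>The lower bound and the conclusion\<close>

lemma stdM_arithM: "stdM = arithM (\<in>)"
  by (simp add: stdM_def arithM_def)

lemma sat_thr_nat: "sat e v (thr_fm n x l y) \<longleftrightarrow> thr n (eval e x) (eval e l) (eval e y)"
  unfolding satM_std[symmetric] evM_std[symmetric] stdM_arithM by simp

text \<open>It may exceed \<open>fast n\<close>, as its value also has to bound a code; domination
  from above is all that the lower bound requires.\<close>

definition growth :: "nat \<Rightarrow> nat \<Rightarrow> nat" where
  "growth n x = (LEAST y. thr n x x y)"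

text \<open>Totality in the natural numbers is read off from the formal derivation by soundness, so
  the coding argument is carried out only once.\<close>

lemma thr_nat_total: "\<exists>y::nat. thr n x x y"
proof -
  have "satM stdM (\<lambda>_. 0) (\<lambda>_. {}) (total_fm n)"
  proof (rule std.soundness[OF RCA0_total])
    show "env stdM (\<lambda>_. 0) (\<lambda>_. {})"
      by (simp add: env_def stdM_def)
  qed (rule std_RCA0)
  then show ?thesis
    unfolding stdM_arithM sat_total_fm by blast
qed

lemma thr_growth: "thr n x x (growth n x)"
  unfolding growth_def using thr_nat_total by (rule LeastI_ex)

lemma fast_le_growth: "fast n x \<le> growth n x"
  using thr_growth by (rule fast_le_thr)

lemma recursive_growth: "recursive (growth n)"
proof -
  let ?\<phi> = "thr_fm n (Var 1) (Var 1) (Var 0)"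
  have sat: "sat (list_env [y, x]) (\<lambda>_. {}) ?\<phi> \<longleftrightarrow> thr n x x y" for x y
    by (simp add: sat_thr_nat list_env_def)
  have "recursive (\<lambda>x. LEAST y. sat (list_env [y, x]) (\<lambda>_. {}) ?\<phi>)"
  proof (rule recursive_least)
    show "\<exists>y. sat (list_env [y, x]) (\<lambda>_. {}) ?\<phi>" for x
      unfolding sat by (rule thr_nat_total)
  qed simp_all
  then show ?thesis
    unfolding sat growth_def .
qed

lemma provably_total_growth: "RCA0 \<subseteq> T \<Longrightarrow> provably_total T (growth n)"
proof -
  assume T: "RCA0 \<subseteq> T"
  have "sat (case_nat y (case_nat x e)) v (graph_fm n) \<longleftrightarrow> y = growth n x" for x y e v
  proof -
    have "sat (case_nat y (case_nat x e)) v (graph_fm n) \<longleftrightarrow> thr n x x y \<and> (\<forall>z<y. \<not> thr n x x z)"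
      unfolding satM_std[symmetric] stdM_arithM sat_graph_fm by simp
    also have "\<dots> \<longleftrightarrow> y = growth n x"
      using thr_growth[of n x] not_less_Least[of _ "thr n x x"] unfolding growth_def
      by (metis linorder_neqE_nat)
    finally show ?thesis .
  qed
  then have "Sigma1_defines (graph_fm n) (growth n)"
    by (simp add: Sigma1_defines_def Sigma01_graph_fm below_graph_fm)
  moreover have "T \<turnstile> AllN (Ex1N (graph_fm n))"
    using derives_mono[OF RCA0_total T] by (simp only: total_fm_def)
  ultimately show ?thesis
    by (auto simp: provably_total_def)
qed

text \<open>Growth functions are already provably total in the smaller theory, and unbounded
  functions are excluded in the larger one, so everything in between has the same ordinal.\<close>

lemma ordinal_between_RCA0_WKL0_RT22:
  assumes "RCA0 \<subseteq> T" "T \<subseteq> insert RT22 WKL0"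
  shows "is_proof_theoretic_ordinal T \<omega>\<^sup>\<omega>"
  unfolding is_proof_theoretic_ordinal_def
proof (intro conjI allI impI)
  show "hardy_bounds T \<omega>\<^sup>\<omega>"
    unfolding hardy_bounds_def
  proof (intro allI impI)
    fix f assume f: "recursive f \<and> provably_total T f"
    have "\<exists>n N. \<forall>x\<ge>N. f x \<le> fast n x"
    proof (rule ccontr)
      assume "\<not> ?thesis"
      then have "\<exists>x\<ge>N. fast n x < f x" for n N
        by (meson not_le)
      from unbounded_not_provably_total[OF this assms(2)] f show False
        by blast
    qed
    then obtain n N where "\<And>x. N \<le> x \<Longrightarrow> f x \<le> fast n x"
      by blast
    then have "\<forall>\<^sub>F x in sequentially. f x \<le> hardy {#0, n#} x"
      unfolding eventually_sequentially using fast_less_hardy by (meson le_trans less_imp_le)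
    moreover have "Below {#0, n#} < \<omega>\<^sup>\<omega>"
      by (simp add: less_ord_def)
    ultimately show "\<exists>\<beta>. Below \<beta> < \<omega>\<^sup>\<omega> \<and> (\<forall>\<^sub>F x in sequentially. f x \<le> hardy \<beta> x)"
      by blast
  qed
  fix \<alpha>' assume bounds: "hardy_bounds T \<alpha>'"
  show "\<omega>\<^sup>\<omega> \<le> \<alpha>'"
  proof (cases \<alpha>')
    case (Below \<alpha>)
    obtain m where m: "\<And>j. j \<in># \<alpha> \<Longrightarrow> j \<le> m"
      by (meson Max_ge finite_set_mset)
    \<comment> \<open>An ordinal below \<open>\<alpha>\<close> again has exponents at most
      \<open>m\<close>, so its Hardy function is eventually bounded by \<open>fast (Suc m)\<close>;
      a function one level higher refutes the bound.\<close>
    obtain \<beta> where \<beta>: "Below \<beta> < \<alpha>'" "\<forall>\<^sub>F x in sequentially. growth (Suc (Suc m)) x \<le> hardy \<beta> x"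
      using bounds recursive_growth provably_total_growth[OF assms(1)] unfolding hardy_bounds_def by blast
    have "\<beta> < \<alpha>"
      using \<beta>(1) Below by (auto simp: less_ord_def)
    then obtain j where j: "count \<beta> j < count \<alpha> j" "\<And>i. i > j \<Longrightarrow> count \<beta> i = count \<alpha> i"
      unfolding cnf_less_iff by blast
    have "j \<in># \<alpha>"
      using j(1) by (metis count_greater_zero_iff gr_zeroI not_less_zero)
    have \<beta>m: "i \<le> m" if "i \<in># \<beta>" for i
    proof (cases "i > j")
      case True
      then have "i \<in># \<alpha>"
        using j(2) that by (metis count_greater_zero_iff)
      then show ?thesis by (rule m)
    next
      case False
      then show ?thesis
        using m[OF \<open>j \<in># \<alpha>\<close>] by linarith
    qed
    obtain N where N: "\<And>x. N \<le> x \<Longrightarrow> growth (Suc (Suc m)) x \<le> hardy \<beta> x"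
      using \<beta>(2) unfolding eventually_sequentially by blast
    \<comment> \<open>The summands serve the assumed domination, the hypothesis of
      \<open>hardy_le_fast\<close>, and the room for two iterates of
      \<open>fast (Suc m)\<close>.\<close>
    define x where "x = N + size \<beta> + 2"
    have "hardy \<beta> x \<le> fast (Suc m) x"
      by (rule hardy_le_fast[OF \<beta>m]) (simp_all add: x_def)
    also have "\<dots> < (fast (Suc m) ^^ 2) x"
      using fast_gt[of "fast (Suc m) x" "Suc m"] by (simp only: numeral_2_eq_2 funpow.simps o_apply id_apply)
    also have "\<dots> \<le> (fast (Suc m) ^^ x) (Suc x)"
      by (rule funpow_mono2[OF less_imp_le[OF fast_gt] fast_mono]) (simp_all add: x_def)
    also have "\<dots> = fast (Suc (Suc m)) x"
      by (simp only: fast.simps)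
    also have "\<dots> \<le> growth (Suc (Suc m)) x"
      by (rule fast_le_growth)
    also have "\<dots> \<le> hardy \<beta> x"
      by (rule N) (simp add: x_def)
    finally show ?thesis by simp
  qed simp
qed

theorem corollary7p6:
  shows "is_proof_theoretic_ordinal (insert RT22 RCA0) \<omega>\<^sup>\<omega> \<and>
         is_proof_theoretic_ordinal (insert RT22 WKL0) \<omega>\<^sup>\<omega>"
  by (intro conjI ordinal_between_RCA0_WKL0_RT22) (auto simp: WKL0_def)

end
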